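(* Let $(\vec{U},P)$ be a smooth solution of the steady-state Navier-Stokes equations on $\mathbb{R}^3$, $$-\Delta \vec{U} + (\vec{U}\cdot\vec{\nabla})\vec{U} + \vec{\nabla}P = 0, \qquad \operatorname{div}(\vec{U}) = 0 .$$ If $\vec{U}\in L^p(\mathbb{R}^3)\cap\dot{H}^{-1}(\mathbb{R}^3)$ for $\frac{9}{2}<p<+\infty$, then $\vec{U}=0$ and $P=0$.
   Context: Here $\vec{U}=(U_1,U_2,U_3):\mathbb{R}^3\to\mathbb{R}^3$ is the velocity and $P:\mathbb{R}^3\to\mathbb{R}$ is the pressure. A couple $(\vec{U},P)$ is called a smooth solution if $\vec{U}\in\mathcal{C}^2(\mathbb{R}^3)$, $P\in\mathcal{C}^1(\mathbb{R}^3)$, and the couple satisfies the equations in the classical sense. The space $\dot{H}^{-1}(\mathbb{R}^3)$ is the homogeneous Sobolev space of tempered distributions $g$ whose Fourier transform satisfies $\widehat{g}\in L^1_{loc}(\mathbb{R}^3)$ and $\|g\|_{\dot{H}^{-1}}^2=\int_{\mathbb{R}^3}\frac{1}{|\xi|^2}|\widehat{g}(\xi)|^2\,d\xi<+\infty$. Membership of a vector field in a function space is understood componentwise.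
   Formalization: The conclusion "P = 0" is replaced by "P is constant", since the pressure enters only through its gradient: U = 0, P = 1 satisfies all hypotheses, so P = 0 holds only up to an additive constant. *)

theory Defs
  imports "HOL-Analysis.Analysis"
begin

section \<open>Classical derivatives\<close>

definition pderivative :: "'n \<Rightarrow> (real^'n \<Rightarrow> 'b::real_normed_vector) \<Rightarrow> real^'n \<Rightarrow> 'b" where
  "pderivative i f x = vector_derivative (\<lambda>t. f (x + t *\<^sub>R axis i 1)) (at 0)"

text \<open>A multi-index is represented by the list of the directions of differentiation.\<close>

definition pderivatives :: "'n list \<Rightarrow> (real^'n \<Rightarrow> 'b::real_normed_vector) \<Rightarrow> real^'n \<Rightarrow> 'b" where
  "pderivatives is f = foldr pderivative is f"

primrec C_k :: "nat \<Rightarrow> (real^'n \<Rightarrow> 'b::real_normed_vector) \<Rightarrow> bool" where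
  "C_k 0 f \<longleftrightarrow> continuous_on UNIV f"
| "C_k (Suc k) f \<longleftrightarrow> (\<forall>x. f differentiable (at x)) \<and> (\<forall>i. C_k k (pderivative i f))"

definition gradient :: "(real^'n \<Rightarrow> real) \<Rightarrow> real^'n \<Rightarrow> real^'n" where
  "gradient f x = (\<chi> i. pderivative i f x)"

definition divergence :: "(real^'n \<Rightarrow> real^'n) \<Rightarrow> real^'n \<Rightarrow> real" where
  "divergence U x = (\<Sum>i\<in>UNIV. pderivative i (\<lambda>y. U y $ i) x)"

definition laplacian :: "(real^'n \<Rightarrow> 'b::real_normed_vector) \<Rightarrow> real^'n \<Rightarrow> 'b" where
  "laplacian f x = (\<Sum>i\<in>UNIV. pderivative i (pderivative i f) x)"

definition advection :: "(real^'n \<Rightarrow> real^'n) \<Rightarrow> (real^'n \<Rightarrow> 'b::real_normed_vector) \<Rightarrow> real^'n \<Rightarrow> 'b" where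
  "advection U f x = (\<Sum>i\<in>UNIV. (U x $ i) *\<^sub>R pderivative i f x)"

definition smooth_NS_solution :: "(real^3 \<Rightarrow> real^3) \<Rightarrow> (real^3 \<Rightarrow> real) \<Rightarrow> bool" where
  "smooth_NS_solution U P \<longleftrightarrow>
     C_k 2 U \<and> C_k 1 P \<and>
     (\<forall>x. - laplacian U x + advection U U x + gradient P x = 0) \<and>
     (\<forall>x. divergence U x = 0)"

section \<open>Lebesgue spaces\<close>

text \<open>Only meant for \<open>0 < p < \<infinity>\<close>.\<close>

definition Lp :: "real \<Rightarrow> (real^'n \<Rightarrow> real) set" where
  "Lp p = {f \<in> borel_measurable lebesgue. integrable lebesgue (\<lambda>x. \<bar>f x\<bar> powr p)}"

definition L1_loc :: "(real^'n \<Rightarrow> complex) set" where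
  "L1_loc = {g. \<forall>K. compact K \<longrightarrow> set_integrable lebesgue K g}"

section \<open>Tempered distributions\<close>

definition schwartz :: "(real^'n \<Rightarrow> complex) set" where
  "schwartz = {\<phi>. (\<forall>k. C_k k \<phi>) \<and>
     (\<forall>m is. bounded (range (\<lambda>x. norm x ^ m *\<^sub>R pderivatives is \<phi> x)))}"

definition schwartz_seminorm :: "nat \<Rightarrow> 'n list \<Rightarrow> (real^'n \<Rightarrow> complex) \<Rightarrow> real" where
  "schwartz_seminorm m is \<phi> = (SUP x. norm x ^ m * norm (pderivatives is \<phi> x))"

definition test_functions :: "(real^'n \<Rightarrow> complex) set" where
  "test_functions = {\<phi>. (\<forall>k. C_k k \<phi>) \<and> compact (closure {x. \<phi> x \<noteq> 0})}"

text \<open>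
  A distribution is a functional on all functions of which only the values on
  \<open>schwartz\<close> are meaningful.
\<close>

definition tempered_distribution :: "((real^'n::finite \<Rightarrow> complex) \<Rightarrow> complex) \<Rightarrow> bool" where
  "tempered_distribution T \<longleftrightarrow>
     (\<forall>\<phi>\<in>schwartz. \<forall>\<psi>\<in>schwartz. T (\<lambda>x. \<phi> x + \<psi> x) = T \<phi> + T \<psi>) \<and>
     (\<forall>c. \<forall>\<phi>\<in>schwartz. T (\<lambda>x. c * \<phi> x) = c * T \<phi>) \<and>
     (\<exists>C N. \<forall>\<phi>\<in>schwartz.
        norm (T \<phi>) \<le> C * (\<Sum>m\<le>N. \<Sum>is | length is \<le> N. schwartz_seminorm m is \<phi>))"

definition fourier :: "(real^'n \<Rightarrow> complex) \<Rightarrow> real^'n \<Rightarrow> complex" where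
  "fourier \<phi> \<xi> = (LINT x|lebesgue. cis (- (x \<bullet> \<xi>)) * \<phi> x)"

definition fourier_distribution ::
    "((real^'n \<Rightarrow> complex) \<Rightarrow> complex) \<Rightarrow> (real^'n \<Rightarrow> complex) \<Rightarrow> complex" where
  "fourier_distribution T \<phi> = T (fourier \<phi>)"

definition dist_of_fun :: "(real^'n \<Rightarrow> complex) \<Rightarrow> (real^'n \<Rightarrow> complex) \<Rightarrow> complex" where
  "dist_of_fun f \<phi> = (LINT x|lebesgue. f x * \<phi> x)"

section \<open>The homogeneous Sobolev space of order -1\<close>

text \<open>
  That the Fourier transform of \<open>T\<close> is a locally integrable function \<open>g\<close> is tested against
  smooth functions of compact support, since the product of a general locally integrable
  function with a Schwartz function need not be integrable. The point \<open>\<xi> = 0\<close>, where the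
  weight takes the value \<open>1 / 0 = 0\<close>, is a null set. The space does not depend on the
  normalisation chosen in \<open>fourier\<close>.
\<close>

definition Hdot_minus1 :: "((real^'n::finite \<Rightarrow> complex) \<Rightarrow> complex) set" where
  "Hdot_minus1 = {T. tempered_distribution T \<and>
     (\<exists>g\<in>L1_loc.
        (\<forall>\<phi>\<in>test_functions. fourier_distribution T \<phi> = dist_of_fun g \<phi>) \<and>
        integrable lebesgue (\<lambda>\<xi>. 1 / (norm \<xi>)\<^sup>2 * (norm (g \<xi>))\<^sup>2))}"

text \<open>
  A function belongs to the space when the distribution it induces does; integrability
  against Schwartz functions ensures that this distribution is well defined.
\<close>

definition fun_in_Hdot_minus1 :: "(real^'n::finite \<Rightarrow> real) \<Rightarrow> bool" where
  "fun_in_Hdot_minus1 f \<longleftrightarrow>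
     (\<forall>\<phi>\<in>schwartz. integrable lebesgue (\<lambda>x. complex_of_real (f x) * \<phi> x)) \<and>
     dist_of_fun (\<lambda>x. complex_of_real (f x)) \<in> Hdot_minus1"

end

theory Submission
  imports Defs "HOL-Probability.Probability"
begin

text \<open>
  Write \<open>v\<^sub>n\<close> for a smooth regularisation of \<open>U\<close>. Since \<open>div U = 0\<close> and \<open>U\<close> has negative Sobolev
  regularity, \<open>v\<^sub>n\<close> is the divergence of an antisymmetric matrix field \<open>B\<close> (a vector potential) that is
  bounded in \<open>L\<^sup>2\<close> uniformly in \<open>n\<close>. With a cutoff \<open>\<phi>\<close> at scale \<open>R\<close>, the field
  \<open>\<Sum>\<^sub>j \<partial>\<^sub>j (\<phi> B\<^sub>i\<^sub>j)\<close> is divergence free, so testing the equation with it eliminates the pressure.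
  For \<open>p \<ge> 4\<close> both \<open>|U|\<^sup>3\<close> and \<open>|U|\<^sup>4\<close> are bounded by \<open>|U|\<^sup>2 + |U|\<^sup>p\<close>, and with \<open>T(R)\<close> the mass
  \<open>\<integral> |U|\<^sup>2\<close> at scale \<open>R\<close> one obtains \<open>\<integral> \<phi> |\<nabla>U|\<^sup>2 \<le> C (1 + T(R)) / R\<close>. On the other hand
  \<open>\<integral> \<phi> |U|\<^sup>2\<close> is the limit of \<open>- \<Sum>\<^sub>i\<^sub>j \<integral> \<partial>\<^sub>j (\<phi> U\<^sub>i) B\<^sub>i\<^sub>j\<close>, so the Cauchy--Schwarz inequality gives
  \<open>T(R) \<le> C sqrt ((1 + T(2 R)) / R)\<close>. Starting from \<open>T(R) \<le> C R\<^sup>3\<close>, three iterations show that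
  \<open>T(R)\<close> tends to \<open>0\<close>, hence \<open>U = 0\<close>.
\<close>

section \<open>Partial derivatives and integration by parts\<close>

text \<open>Nothing is assumed about the size of \<open>P\<close>, and no pressure estimate is made:
  testing with \<phi>U alone would leave a pressure term that cannot be bounded, so the pressure has
  to cancel exactly. The potential is the inverse Laplacian of d_j v_i - d_i v_j. Its Fourier symbol
  has the size of the transform of U divided by |\<xi>|, and the square integrability of exactly
  this quotient is what the negative Sobolev space provides. Low frequencies are thus paid by the
  hypothesis; high ones are cut off by a compactly supported multiplier, so that \<open>B\<close> is
  smooth for each n and only its L^2 norm has to be uniform. The gradient of \<open>B\<close> is
  recovered locally from its Laplacian by Caccioppoli's inequality, at the price of the mass of v_n
  at the same scale. The Fourier transform is tested only on products of functions of one variable,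
  which reduces the harmonic analysis to the line and to Fubini's theorem. The equations see the
  pressure only through its gradient, so the conclusion about it is that it is constant.\<close>

definition pd :: "'n::finite \<Rightarrow> (real^'n \<Rightarrow> real) \<Rightarrow> (real^'n \<Rightarrow> real) \<Rightarrow> bool" where
  "pd i f f' \<longleftrightarrow> (\<forall>x. ((\<lambda>t. f (x + t *\<^sub>R axis i 1)) has_real_derivative f' x) (at 0))"

text \<open>\<open>pd\<close> records the derivative at t = 0 only; shifting the base point along
  the line gives it at every t, as the mean value theorem requires.\<close>

lemma pd_at:
  assumes "pd i f f'"
  shows "((\<lambda>t. f (x + t *\<^sub>R axis i 1)) has_real_derivative f' (x + a *\<^sub>R axis i 1)) (at a)"
proof -
  have "((\<lambda>t. f ((x + a *\<^sub>R axis i 1) + t *\<^sub>R axis i 1)) has_real_derivative f' (x + a *\<^sub>R axis i 1)) (at 0)"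
    using assms by (auto simp: pd_def)
  then have "((\<lambda>t. f (x + (t + a) *\<^sub>R axis i 1)) has_real_derivative f' (x + a *\<^sub>R axis i 1)) (at 0)"
    by (simp add: algebra_simps)
  then show ?thesis
    using DERIV_shift[of "\<lambda>t. f (x + t *\<^sub>R axis i 1)" _ 0 a] by simp
qed

lemma pd_unique: "pd i f f' \<Longrightarrow> pd i f f'' \<Longrightarrow> f' = f''"
  by (auto simp: pd_def intro!: ext DERIV_unique)

lemma pd_const: "pd i (\<lambda>x. c) (\<lambda>x. 0)"
  by (simp add: pd_def)

lemma pd_add: "pd i f f' \<Longrightarrow> pd i g g' \<Longrightarrow> pd i (\<lambda>x. f x + g x) (\<lambda>x. f' x + g' x)"
  by (auto simp: pd_def intro!: derivative_intros)

lemma pd_diff: "pd i f f' \<Longrightarrow> pd i g g' \<Longrightarrow> pd i (\<lambda>x. f x - g x) (\<lambda>x. f' x - g' x)"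
  by (auto simp: pd_def intro!: derivative_intros)

lemma pd_sum: "(\<And>a. a \<in> A \<Longrightarrow> pd i (f a) (f' a)) \<Longrightarrow> pd i (\<lambda>x. \<Sum>a\<in>A. f a x) (\<lambda>x. \<Sum>a\<in>A. f' a x)"
  by (auto simp: pd_def intro!: DERIV_sum)

lemma pd_mult: "pd i f f' \<Longrightarrow> pd i g g' \<Longrightarrow> pd i (\<lambda>x. f x * g x) (\<lambda>x. f' x * g x + f x * g' x)"
  unfolding pd_def
proof
  fix x
  assume f: "\<forall>x. ((\<lambda>t. f (x + t *\<^sub>R axis i 1)) has_real_derivative f' x) (at 0)"
    and g: "\<forall>x. ((\<lambda>t. g (x + t *\<^sub>R axis i 1)) has_real_derivative g' x) (at 0)"
  from DERIV_mult[OF f[rule_format, of x] g[rule_format, of x]]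
  show "((\<lambda>t. f (x + t *\<^sub>R axis i 1) * g (x + t *\<^sub>R axis i 1)) has_real_derivative
     f' x * g x + f x * g' x) (at 0)" by (simp add: algebra_simps)
qed

lemma pd_chain:
  assumes "pd i f f'" "\<And>y. (h has_real_derivative h' y) (at y)"
  shows "pd i (\<lambda>x. h (f x)) (\<lambda>x. h' (f x) * f' x)"
  unfolding pd_def
proof
  fix x
  have "((\<lambda>t. f (x + t *\<^sub>R axis i 1)) has_real_derivative f' x) (at 0)"
    using assms(1) by (simp add: pd_def)
  from DERIV_chain2[OF _ this, of h "h' (f x)"] assms(2)[of "f x"]
  show "((\<lambda>t. h (f (x + t *\<^sub>R axis i 1))) has_real_derivative h' (f x) * f' x) (at 0)"
    by simp
qed

lemma pd_coord: "pd i (\<lambda>x. x $ j) (\<lambda>x. if i = j then 1 else 0)"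
  unfolding pd_def by (auto simp: axis_def intro!: derivative_eq_intros)

section \<open>Translation invariance, compact support and integration by parts\<close>

lemma lborel_integral_translate:
  fixes f :: "'a::euclidean_space \<Rightarrow> 'b::{banach, second_countable_topology}"
  shows "(LBINT x. f (x + a)) = (LBINT x. f x)"
proof -
  have "(\<integral>x. f x \<partial>distr lborel borel ((+) a)) = (LBINT x. f (a + x))" if "f \<in> borel_measurable borel"
    using that by (intro integral_distr) auto
  \<comment> \<open>For a nonmeasurable f neither side is integrable, and both integrals are the
    default value 0.\<close>
  moreover have "\<not> integrable lborel f" "\<not> integrable lborel (\<lambda>x. f (x + a))" if "f \<notin> borel_measurable borel"
  proof -
    show "\<not> integrable lborel f" using that by (auto dest: borel_measurable_integrable)
    have "f \<in> borel_measurable borel" if "integrable lborel (\<lambda>x. f (x + a))"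
    proof -
      have "(\<lambda>x. f (x + a)) \<in> borel_measurable borel"
        using borel_measurable_integrable[OF that] by simp
      then have "(\<lambda>x. f (x + a)) \<circ> (\<lambda>x. x - a) \<in> borel_measurable borel"
        by (intro measurable_comp) auto
      then show ?thesis by (simp add: comp_def)
    qed
    then show "\<not> integrable lborel (\<lambda>x. f (x + a))" using that by blast
  qed
  ultimately show ?thesis
    by (cases "f \<in> borel_measurable borel")
       (simp_all add: lborel_distr_plus add.commute not_integrable_integral_eq)
qed

lemma lborel_integrable_translate:
  fixes f :: "'a::euclidean_space \<Rightarrow> 'b::{banach, second_countable_topology}"
  assumes "integrable lborel f"
  shows "integrable lborel (\<lambda>x. f (x + a))"
proof -
  have "integrable (distr lborel borel ((+) a)) f"
    using assms by (simp add: lborel_distr_plus)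
  then show ?thesis
    using borel_measurable_integrable[OF assms]
    by (subst (asm) integrable_distr_eq) (auto simp: add.commute)
qed

definition cc :: "real \<Rightarrow> (real^'n::finite \<Rightarrow> real) \<Rightarrow> bool" where
  "cc R f \<longleftrightarrow> continuous_on UNIV f \<and> (\<forall>x. R < norm x \<longrightarrow> f x = 0)"

lemma cc_mult1: "cc R f \<Longrightarrow> continuous_on UNIV g \<Longrightarrow> cc R (\<lambda>x. f x * g x)"
  by (auto simp: cc_def intro!: continuous_intros)

lemma cc_mult2: "cc R f \<Longrightarrow> continuous_on UNIV g \<Longrightarrow> cc R (\<lambda>x. g x * f x)"
  by (auto simp: cc_def intro!: continuous_intros)

lemma cc_add: "cc R f \<Longrightarrow> cc R g \<Longrightarrow> cc R (\<lambda>x. f x + g x)"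
  by (auto simp: cc_def intro!: continuous_intros)

lemma cc_abs: "cc R f \<Longrightarrow> cc R (\<lambda>x. \<bar>f x\<bar>)"
  by (auto simp: cc_def intro!: continuous_intros)

lemma cc_integrable: "cc R f \<Longrightarrow> integrable lborel f"
proof -
  assume f: "cc R f"
  then have "continuous_on (cball 0 R) f"
    by (auto simp: cc_def intro: continuous_on_subset)
  then have "integrable lborel (\<lambda>x. indicator (cball 0 R) x *\<^sub>R f x)"
    by (intro borel_integrable_compact) auto
  moreover have "(\<lambda>x. indicator (cball 0 R) x *\<^sub>R f x) = f"
    using f by (auto simp: cc_def indicator_def fun_eq_iff)
  ultimately show ?thesis by simp
qed

text \<open>The complement of the closed ball is open, so \<open>f\<close> vanishes on a whole
  segment around a point outside it, and the derivative there is that of 0.\<close>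

lemma cc_pd:
  assumes "cc R f" "pd i f f'" "continuous_on UNIV f'"
  shows "cc R f'"
  unfolding cc_def
proof (intro conjI allI impI)
  fix x :: "real^'a" assume x: "R < norm x"
  have "\<forall>\<^sub>F t in nhds 0. f (x + t *\<^sub>R axis i 1) = 0"
  proof -
    have "((\<lambda>t. norm (x + t *\<^sub>R axis i 1)) \<longlongrightarrow> norm (x + 0 *\<^sub>R axis i (1::real))) (nhds (0::real))"
      by (intro tendsto_intros filterlim_ident)
    then have "\<forall>\<^sub>F t in nhds (0::real). R < norm (x + t *\<^sub>R axis i 1)"
      using x by (intro order_tendstoD(1)) auto
    then show ?thesis
      by (rule eventually_mono) (use assms(1) in \<open>auto simp: cc_def\<close>)
  qed
  moreover have "((\<lambda>t. f (x + t *\<^sub>R axis i 1)) has_real_derivative f' x) (at 0)"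
    using assms(2) by (simp add: pd_def)
  ultimately have "((\<lambda>t. 0) has_real_derivative f' x) (at 0)"
    by (subst DERIV_cong_ev[OF refl _ refl, of _ "\<lambda>t. f (x + t *\<^sub>R axis i 1)"]) (auto elim: eventually_mono)
  then show "f' x = 0"
    using DERIV_unique DERIV_const by blast
qed (use assms in auto)

lemma cc_bounded: "cc R f \<Longrightarrow> \<exists>M>0. \<forall>x. \<bar>f x\<bar> \<le> M"
proof -
  assume f: "cc R f"
  then have "continuous_on (cball 0 R) f"
    by (auto simp: cc_def intro: continuous_on_subset)
  then have "bounded (f ` cball 0 R)"
    by (intro compact_imp_bounded compact_continuous_image) auto
  then obtain M where M: "M > 0" "\<And>x. norm x \<le> R \<Longrightarrow> \<bar>f x\<bar> \<le> M"
    by (auto simp: bounded_pos)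
  show ?thesis
  proof (intro exI conjI allI)
    show "M > 0" by fact
    show "\<bar>f x\<bar> \<le> M" for x
      using M(2)[of x] M(1) f by (cases "norm x \<le> R") (auto simp: cc_def)
  qed
qed

text \<open>Translation invariance kills the integral of each difference quotient; dominated convergence
  then gives the same for the derivative, without Fubini.\<close>

lemma integral_pd_eq_0:
  assumes f: "cc R f" and pd: "pd i f f'" and c: "continuous_on UNIV f'"
  shows "(LBINT x. f' x) = 0"
proof -
  define e :: "real^'a" where "e = axis i 1"
  have ne: "norm e = 1" by (simp add: e_def)
  obtain M where M: "M > 0" "\<And>x. \<bar>f' x\<bar> \<le> M"
    using cc_bounded[OF cc_pd[OF f pd c]] by blast
  define q where "q n x = (f (x + inverse (real (Suc n)) *\<^sub>R e) - f x) * real (Suc n)" for n x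
  have int: "integrable lborel f" using f by (rule cc_integrable)
  have int2: "integrable lborel (\<lambda>x. f (x + a))" for a
    using int by (rule lborel_integrable_translate)
  have q0: "(LBINT x. q n x) = 0" for n
    unfolding q_def by (simp add: int int2 lborel_integral_translate)
  \<comment> \<open>Inside the larger ball the mean value theorem turns the quotient into a value of
    \<open>f'\<close>; outside it a step of length at most 1 cannot reach the support.\<close>
  have bq: "\<bar>q n x\<bar> \<le> M * indicator (cball 0 (R+1)) x" for n x
  proof (cases "norm x \<le> R + 1")
    case True
    define h where "h = inverse (real (Suc n))"
    have h: "h > 0" by (simp add: h_def)
    have "\<exists>z. 0 < z \<and> z < h \<and> f (x + h *\<^sub>R e) - f (x + 0 *\<^sub>R e) = (h - 0) * f' (x + z *\<^sub>R e)"
      by (rule MVT2[OF h]) (use pd_at[OF pd] in \<open>auto simp: e_def\<close>)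
    then obtain z where "f (x + h *\<^sub>R e) - f x = h * f' (x + z *\<^sub>R e)" by auto
    then have "q n x = f' (x + z *\<^sub>R e)"
      by (simp add: q_def h_def field_simps)
    then show ?thesis using True M by simp
  next
    case False
    have "norm x - norm (inverse (real (Suc n)) *\<^sub>R e) \<le> norm (x + inverse (real (Suc n)) *\<^sub>R e)"
      by (rule norm_diff_ineq)
    moreover have "norm (inverse (real (Suc n)) *\<^sub>R e) \<le> 1"
      using ne by (simp add: field_simps)
    ultimately have "norm (x + inverse (real (Suc n)) *\<^sub>R e) > R" using False by linarith
    with False f show ?thesis by (simp add: q_def cc_def)
  qed
  have "(\<lambda>n. LBINT x. q n x) \<longlonglongrightarrow> (LBINT x. f' x)"
  proof (rule integral_dominated_convergence[where w="\<lambda>x. M * indicator (cball 0 (R+1)) x"])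
    show "f' \<in> borel_measurable lborel"
      using borel_measurable_continuous_onI[OF c] by simp
    have "f \<in> borel_measurable borel" using f by (intro borel_measurable_continuous_onI) (simp add: cc_def)
    then show "q n \<in> borel_measurable lborel" for n
      unfolding q_def by simp
    show "integrable lborel (\<lambda>x. M * indicator (cball (0::real^'a) (R + 1)) x)"
      by (rule integrable_mult_right, rule integrable_real_indicator)
         (simp, rule emeasure_bounded_finite, simp)
    show "AE x in lborel. (\<lambda>n. q n x) \<longlonglongrightarrow> f' x"
    proof (rule AE_I2)
      fix x
      have "((\<lambda>t. f (x + t *\<^sub>R e)) has_real_derivative f' x) (at 0)"
        using pd by (simp add: pd_def e_def)
      then have "((\<lambda>t. (f (x + t *\<^sub>R e) - f x) / t) \<longlongrightarrow> f' x) (at 0)"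
        by (simp add: DERIV_def)
      moreover have "filterlim (\<lambda>n. inverse (real (Suc n))) (at 0) sequentially"
        unfolding filterlim_at using LIMSEQ_inverse_real_of_nat by auto
      ultimately have "(\<lambda>n. (f (x + inverse (real (Suc n)) *\<^sub>R e) - f x) / inverse (real (Suc n))) \<longlonglongrightarrow> f' x"
        by (rule filterlim_compose)
      then show "(\<lambda>n. q n x) \<longlonglongrightarrow> f' x"
        by (simp add: q_def divide_inverse)
    qed
    show "AE x in lborel. norm (q n x) \<le> M * indicator (cball 0 (R + 1)) x" for n
      using bq by auto
  qed
  then show ?thesis
    by (simp add: q0 LIMSEQ_const_iff)
qed

text \<open>Compact support is asked of one factor only; the other may be the pressure or a
  component of the potential.\<close>

lemma integral_by_parts_pd:
  assumes f: "cc R f" "pd i f f'" "continuous_on UNIV f'"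
    and g: "continuous_on UNIV g" "pd i g g'" "continuous_on UNIV g'"
  shows "(LBINT x. g' x * f x) = - (LBINT x. g x * f' x)"
proof -
  have i1: "integrable lborel (\<lambda>x. g' x * f x)"
    by (rule cc_integrable[OF cc_mult2[OF f(1) g(3)]])
  have i2: "integrable lborel (\<lambda>x. g x * f' x)"
    by (rule cc_integrable[OF cc_mult2[OF cc_pd[OF f] g(1)]])
  have "(LBINT x. g' x * f x + g x * f' x) = 0"
  proof (rule integral_pd_eq_0)
    show "cc R (\<lambda>x. g x * f x)" by (rule cc_mult2[OF f(1) g(1)])
    show "pd i (\<lambda>x. g x * f x) (\<lambda>x. g' x * f x + g x * f' x)" by (rule pd_mult[OF g(2) f(2)])
    show "continuous_on UNIV (\<lambda>x. g' x * f x + g x * f' x)"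
      using f g by (auto intro!: continuous_intros simp: cc_def)
  qed
  then show ?thesis by (simp add: i1 i2)
qed

section \<open>Cutoff functions\<close>

text \<open>An exponent of at least two removes the kink of the positive part: at 0 the difference
  quotient of the power k + 2 is the positive part to the power k + 1, which tends to 0.\<close>

lemma max0_power_has_derivative:
  fixes y :: real
  shows "((\<lambda>y. max 0 y ^ Suc (Suc k)) has_real_derivative real (Suc (Suc k)) * max 0 y ^ Suc k) (at y)"
proof -
  consider "y > 0" | "y < 0" | "y = 0" by linarith
  then show ?thesis
  proof cases
    case 1
    have "((\<lambda>y. y ^ Suc (Suc k)) has_real_derivative real (Suc (Suc k)) * max 0 y ^ Suc k) (at y)"
      using 1 DERIV_pow[of "Suc (Suc k)" y] by (simp add: max_def)
    moreover have "\<forall>\<^sub>F x in nhds y. x ^ Suc (Suc k) = max 0 x ^ Suc (Suc k)"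
      using eventually_nhds_in_open[of "{0<..}" y] 1 by (auto elim!: eventually_mono)
    ultimately show ?thesis by (subst (asm) DERIV_cong_ev[OF refl _ refl])
  next
    case 2
    have "((\<lambda>y. 0) has_real_derivative real (Suc (Suc k)) * max 0 y ^ Suc k) (at y)"
      using 2 by (auto intro!: derivative_eq_intros)
    moreover have "\<forall>\<^sub>F x in nhds y. 0 = max 0 x ^ Suc (Suc k)"
      using eventually_nhds_in_open[of "{..<0}" y] 2 by (auto elim!: eventually_mono)
    ultimately show ?thesis by (subst (asm) DERIV_cong_ev[OF refl _ refl])
  next
    case 3
    have "((\<lambda>h. max 0 h ^ Suc k) \<longlongrightarrow> max 0 0 ^ Suc k) (at (0::real))"
      by (intro tendsto_intros)
    moreover have "\<forall>\<^sub>F h in at (0::real). max 0 h ^ Suc k = max 0 h ^ Suc (Suc k) / h"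
      by (auto simp: eventually_at_filter max_def)
    ultimately have "((\<lambda>h. max 0 h ^ Suc (Suc k) / h) \<longlongrightarrow> 0) (at (0::real))"
      using Lim_transform_eventually by fastforce
    then show ?thesis using 3 by (simp add: DERIV_def)
  qed
qed

text \<open>The positive part of 1 - |x|^2 / R^2. Derivatives of its powers are again powers of it
  times polynomials, so the powers lost by differentiation can be counted exactly. The sum of
  squares is written out for coordinatewise differentiation.\<close>

definition cutoff :: "real \<Rightarrow> real^3 \<Rightarrow> real" where
  "cutoff R x = max 0 (1 - (\<Sum>i\<in>UNIV. (x $ i)\<^sup>2) / R\<^sup>2)"

lemma sum_squares_norm: "(\<Sum>i\<in>UNIV. (x $ i)\<^sup>2) = (norm (x::real^'n::finite))\<^sup>2"
  by (simp add: norm_vec_def L2_set_def sum_nonneg)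

lemma cutoff_nonneg [simp]: "0 \<le> cutoff R x" and cutoff_le_1 [simp]: "cutoff R x \<le> 1"
  by (auto simp: cutoff_def sum_nonneg)

lemma continuous_cutoff [continuous_intros]: "continuous_on S (cutoff R)"
proof (cases "R = 0")
  \<comment> \<open>Division by 0 gives 0, so \<open>cutoff 0\<close> is the constant 1.\<close>
  case True
  then show ?thesis unfolding cutoff_def by simp
next
  case False
  then show ?thesis unfolding cutoff_def[abs_def] by (intro continuous_intros) auto
qed

lemma cutoff_eq_0: "R > 0 \<Longrightarrow> R \<le> norm x \<Longrightarrow> cutoff R x = 0"
  unfolding cutoff_def sum_squares_norm by (auto simp: field_simps max_def)

lemma cutoff_ge: "R > 0 \<Longrightarrow> norm x \<le> R / 2 \<Longrightarrow> 3 / 4 \<le> cutoff R x"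
proof -
  assume "R > 0" "norm x \<le> R / 2"
  then have "(norm x)\<^sup>2 \<le> (R/2)\<^sup>2" by (intro power_mono) auto
  then have "(norm x)\<^sup>2 / R\<^sup>2 \<le> 1 / 4" using \<open>R > 0\<close> by (simp add: field_simps)
  then show ?thesis
    unfolding cutoff_def sum_squares_norm by linarith
qed

lemma cc_cutoff_power: "R > 0 \<Longrightarrow> cc R (\<lambda>x. cutoff R x ^ Suc k)"
  by (auto simp: cc_def cutoff_eq_0 intro!: continuous_intros)

lemma pd_cutoff_power:
  "pd i (\<lambda>x. cutoff R x ^ Suc (Suc k)) (\<lambda>x. - (2 * real (Suc (Suc k)) / R\<^sup>2) * x $ i * cutoff R x ^ Suc k)"
proof -
  have "pd i (\<lambda>x. (x $ j) * (x $ j) :: real) (\<lambda>x. if i = j then 2 * x $ i else 0)" for j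
    using pd_mult[OF pd_coord[of i j] pd_coord[of i j]] by (auto simp: if_distrib cong: if_cong)
  then have "pd i (\<lambda>x. \<Sum>j\<in>UNIV. (x $ j) * (x $ j)) (\<lambda>x. \<Sum>j\<in>UNIV. if i = j then 2 * x $ i else 0)"
    by (intro pd_sum)
  then have "pd i (\<lambda>x. \<Sum>j\<in>UNIV. (x $ j)\<^sup>2) (\<lambda>x. 2 * x $ i)"
    by (simp add: power2_eq_square)
  moreover have "((\<lambda>y. 1 - y / R\<^sup>2) has_real_derivative - 1 / R\<^sup>2) (at y)" for y
    unfolding divide_inverse by (auto intro!: derivative_eq_intros)
  ultimately have "pd i (\<lambda>x. 1 - (\<Sum>j\<in>UNIV. (x $ j)\<^sup>2) / R\<^sup>2) (\<lambda>x. - 1 / R\<^sup>2 * (2 * x $ i))"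
    by (rule pd_chain)
  from pd_chain[OF this max0_power_has_derivative[of k]]
  show ?thesis unfolding cutoff_def[symmetric] by (simp add: mult_ac)
qed

text \<open>Where the cutoff is nonzero each coordinate is at most R in size, so a coordinate
  produced by differentiation costs one factor R.\<close>

lemma cutoff_coord_bound:
  assumes "R > 0" shows "\<bar>x $ i\<bar> * cutoff R x \<le> R * cutoff R x"
proof (cases "R \<le> norm x")
  case True then show ?thesis using assms cutoff_eq_0 by simp
next
  case False
  then have "\<bar>x $ i\<bar> \<le> R" using component_le_norm_cart[of x i] by linarith
  then show ?thesis by (intro mult_right_mono) auto
qed

section \<open>The fourth-power cutoff and its first two derivatives\<close>

definition phi :: "real \<Rightarrow> real^3 \<Rightarrow> real" where
  "phi R x = cutoff R x ^ 4"

definition phi1 :: "real \<Rightarrow> 3 \<Rightarrow> real^3 \<Rightarrow> real" where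
  "phi1 R j x = - (8 / R\<^sup>2) * x $ j * cutoff R x ^ 3"

definition phi2 :: "real \<Rightarrow> 3 \<Rightarrow> 3 \<Rightarrow> real^3 \<Rightarrow> real" where
  "phi2 R j k x = (if k = j then - (8 / R\<^sup>2) * cutoff R x ^ 3 else 0)
     + 48 / R^4 * (x $ j * x $ k) * (cutoff R x)\<^sup>2"

lemma phi2_sym: "phi2 R j k x = phi2 R k j x"
  by (simp add: phi2_def mult_ac)

lemma pd_phi: "pd j (phi R) (phi1 R j)"
  using pd_cutoff_power[of j R 2] unfolding phi_def[abs_def] phi1_def[abs_def] by (simp add: eval_nat_numeral)

lemma pd_phi1: "pd k (phi1 R j) (phi2 R j k)"
proof -
  have 3: "pd k (\<lambda>x. cutoff R x ^ 3) (\<lambda>x. - (6 / R\<^sup>2) * x $ k * (cutoff R x)\<^sup>2)"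
    using pd_cutoff_power[of k R 1] by (simp add: eval_nat_numeral)
  have "pd k (\<lambda>x. - (8 / R\<^sup>2) * x $ j) (\<lambda>x. if k = j then - (8 / R\<^sup>2) else 0)"
    using pd_mult[OF pd_const[of k "- (8 / R\<^sup>2)"] pd_coord[of k j]] by (simp add: if_distrib cong: if_cong)
  from pd_mult[OF this 3]
  show ?thesis
    unfolding phi1_def[abs_def] phi2_def[abs_def]
    by (rule back_subst[of "pd k _"]) (auto simp: fun_eq_iff algebra_simps power2_eq_square eval_nat_numeral)
qed

lemma continuous_phi [continuous_intros]:
  "continuous_on S (phi R)" "continuous_on S (phi1 R j)" "continuous_on S (phi2 R j k)"
proof -
  show "continuous_on S (phi R)" unfolding phi_def[abs_def] by (intro continuous_intros)
  have c: "continuous_on S (\<lambda>x. c * x $ j * cutoff R x ^ 3)" for c by (intro continuous_intros)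
  show "continuous_on S (phi1 R j)" unfolding phi1_def[abs_def] by (rule c)
  have "continuous_on S (\<lambda>x. (if k = j then c * cutoff R x ^ 3 else 0) + d * (x $ j * x $ k) * (cutoff R x)\<^sup>2)" for c d
    by (cases "k = j") (auto intro!: continuous_intros)
  then show "continuous_on S (phi2 R j k)" unfolding phi2_def[abs_def] .
qed

lemma cc_phi: "R > 0 \<Longrightarrow> cc R (phi R)"
  using cc_cutoff_power[of R 3] unfolding phi_def[abs_def] by (simp add: eval_nat_numeral)

lemma cc_phi1: "R > 0 \<Longrightarrow> cc R (phi1 R j)"
  using cc_pd[OF cc_phi pd_phi continuous_phi(2)] by blast

text \<open>The fourth power is chosen for these bounds: each derivative costs 1 / R and one power
  of the cutoff, so the gradient keeps the cube and the Hessian the square. The cube splits as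
  square times first power; the square next to a derivative of u has the weight \<open>phi R\<close>
  after squaring, and the first power next to u becomes the weight of the local mass.\<close>

lemma phi1_bound: assumes "R > 0" shows "\<bar>phi1 R j x\<bar> \<le> 8 / R * cutoff R x ^ 3"
proof -
  have "\<bar>phi1 R j x\<bar> = 8 / R\<^sup>2 * (cutoff R x)\<^sup>2 * (\<bar>x $ j\<bar> * cutoff R x)"
    using assms by (simp add: phi1_def abs_mult eval_nat_numeral)
  also have "\<dots> \<le> 8 / R\<^sup>2 * (cutoff R x)\<^sup>2 * (R * cutoff R x)"
    using assms by (intro mult_left_mono cutoff_coord_bound) auto
  also have "\<dots> = 8 / R * cutoff R x ^ 3"
    using assms by (simp add: eval_nat_numeral)
  finally show ?thesis .
qed

lemma phi2_bound: assumes "R > 0" shows "\<bar>phi2 R j k x\<bar> \<le> 56 / R\<^sup>2 * (cutoff R x)\<^sup>2"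
proof -
  have 1: "\<bar>if k = j then - (8 / R\<^sup>2) * cutoff R x ^ 3 else 0\<bar> \<le> 8 / R\<^sup>2 * (cutoff R x)\<^sup>2"
  proof -
    have "cutoff R x ^ 3 \<le> (cutoff R x)\<^sup>2" by (intro power_decreasing) auto
    then show ?thesis using assms by (auto simp: abs_mult divide_simps)
  qed
  have "\<bar>48 / R^4 * (x $ j * x $ k) * (cutoff R x)\<^sup>2\<bar>
      = 48 / R^4 * ((\<bar>x $ j\<bar> * cutoff R x) * (\<bar>x $ k\<bar> * cutoff R x))"
    using assms by (simp add: abs_mult eval_nat_numeral)
  also have "\<dots> \<le> 48 / R^4 * ((R * cutoff R x) * (R * cutoff R x))"
    using assms by (intro mult_left_mono mult_mono cutoff_coord_bound) auto
  also have "\<dots> = 48 / R\<^sup>2 * (cutoff R x)\<^sup>2"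
    using assms by (simp add: eval_nat_numeral)
  finally have "\<bar>phi2 R j k x\<bar> \<le> 8 / R\<^sup>2 * (cutoff R x)\<^sup>2 + 48 / R\<^sup>2 * (cutoff R x)\<^sup>2"
    using 1 unfolding phi2_def by (intro order_trans[OF abs_triangle_ineq] add_mono) auto
  also have "\<dots> = 56 / R\<^sup>2 * (cutoff R x)\<^sup>2" by (simp add: field_simps)
  finally show ?thesis .
qed

section \<open>A local gradient estimate\<close>

text \<open>Expand the square of 2 c |a| - |b|. The weight c is tuned at each use to leave a share
  that can be absorbed.\<close>

lemma weighted_young:
  fixes a b c :: real
  assumes "c > 0"
  shows "\<bar>a * b\<bar> \<le> c * a\<^sup>2 + b\<^sup>2 / (4 * c)"
proof -
  have "0 \<le> (2 * c * \<bar>a\<bar> - \<bar>b\<bar>)\<^sup>2 / (4 * c)" using assms by simp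
  also have "\<dots> = c * a\<^sup>2 + b\<^sup>2 / (4 * c) - \<bar>a * b\<bar>"
    using assms by (simp add: power2_diff power_mult_distrib abs_mult field_simps power2_eq_square)
  finally show ?thesis by simp
qed

lemma abs_integral_le:
  fixes f g :: "'a \<Rightarrow> real"
  assumes "integrable M f" "integrable M g" "\<And>x. \<bar>f x\<bar> \<le> g x"
  shows "\<bar>\<integral>x. f x \<partial>M\<bar> \<le> (\<integral>x. g x \<partial>M)"
  by (rule order_trans[OF integral_abs_bound]) (intro integral_mono integrable_abs assms)

text \<open>Caccioppoli's inequality for the equation Laplacian of V = d_l a - d_m b. Testing with
  s^2 V and integrating by parts on the right as well leaves a and b undifferentiated. It serves the
  potential, where a and b are components of v_n, and, with a = b = 0, the harmonic function that
  measures the defect in the divergence of the potential.\<close>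

lemma gradient_estimate:
  fixes V :: "real^3 \<Rightarrow> real"
  assumes R: "R \<ge> 1"
    and V: "continuous_on UNIV V" "integrable lborel (\<lambda>x. (V x)\<^sup>2)"
    and V1: "\<And>k. pd k V (V1 k)" "\<And>k. continuous_on UNIV (V1 k)"
    and V2: "\<And>k. pd k (V1 k) (V2 k)" "\<And>k. continuous_on UNIV (V2 k)"
    and a: "continuous_on UNIV a" "pd l a da" "continuous_on UNIV da"
    and b: "continuous_on UNIV b" "pd m b db" "continuous_on UNIV db"
    and eq: "\<And>x. (\<Sum>k\<in>UNIV. V2 k x) = da x - db x"
  shows "(\<Sum>k\<in>UNIV. LBINT x. (cutoff R x)\<^sup>2 * (V1 k x)\<^sup>2)
    \<le> 8 * (LBINT x. (cutoff R x)\<^sup>2 * (a x)\<^sup>2) + 8 * (LBINT x. (cutoff R x)\<^sup>2 * (b x)\<^sup>2)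
      + 200 / R * (LBINT x. (V x)\<^sup>2)"
proof -
  define s where "s = cutoff R"
  define t where "t k x = - (4 / R\<^sup>2) * x $ k * s x" for k :: 3 and x :: "real^3"
  have R0: "R > 0" using R by simp
  have s01: "0 \<le> s x" "s x \<le> 1" for x by (auto simp: s_def)
  have sc: "continuous_on UNIV s" by (simp add: s_def continuous_cutoff)
  have cs: "cc R (\<lambda>x. (s x)\<^sup>2)"
    using cc_cutoff_power[OF R0, of 1] by (simp add: s_def eval_nat_numeral)
  have ps: "pd k (\<lambda>x. (s x)\<^sup>2) (t k)" for k
    using pd_cutoff_power[of k R 0] by (simp add: s_def t_def[abs_def] eval_nat_numeral)
  have tc: "continuous_on UNIV (t k)" for k
  proof -
    have "continuous_on UNIV (\<lambda>x. c * x $ k * s x)" for c :: real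
      using sc by (intro continuous_intros)
    then show ?thesis unfolding t_def[abs_def] .
  qed
  have ct: "cc R (t k)" for k by (rule cc_pd[OF cs ps tc])
  have tb: "\<bar>t k x\<bar> \<le> 4 / R * s x" for k x
  proof -
    have "\<bar>t k x\<bar> = 4 / R\<^sup>2 * (\<bar>x $ k\<bar> * s x)" by (simp add: t_def abs_mult s01)
    also have "\<dots> \<le> 4 / R\<^sup>2 * (R * s x)"
      unfolding s_def by (intro mult_left_mono cutoff_coord_bound) (use R0 in auto)
    also have "\<dots> = 4 / R * s x" using R0 by (simp add: power2_eq_square)
    finally show ?thesis .
  qed
  note cont = V(1) V1(2) V2(2) a(1,3) b(1,3) sc tc
  have int: "integrable lborel (\<lambda>x. (s x)\<^sup>2 * (f x)\<^sup>2)" if "continuous_on UNIV f" for f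
    by (intro cc_integrable[OF cc_mult1[OF cs]] continuous_intros that)
  have ibp1: "(LBINT x. (s x)\<^sup>2 * (V1 k x)\<^sup>2) = - (LBINT x. V x * (t k x * V1 k x + (s x)\<^sup>2 * V2 k x))" for k
  proof -
    have "(LBINT x. V1 k x * ((s x)\<^sup>2 * V1 k x)) = - (LBINT x. V x * (t k x * V1 k x + (s x)\<^sup>2 * V2 k x))"
      by (intro integral_by_parts_pd[where R=R and i=k] cc_mult1[OF cs] pd_mult ps V1 V2 V(1) continuous_intros cont)
    then show ?thesis by (simp add: power2_eq_square mult_ac)
  qed
  have ibp2: "(LBINT x. da x * ((s x)\<^sup>2 * V x)) = - (LBINT x. a x * (t l x * V x + (s x)\<^sup>2 * V1 l x))"
    by (intro integral_by_parts_pd[where R=R and i=l] cc_mult1[OF cs] pd_mult ps V1 V(1) continuous_intros cont a)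
  have ibp3: "(LBINT x. db x * ((s x)\<^sup>2 * V x)) = - (LBINT x. b x * (t m x * V x + (s x)\<^sup>2 * V1 m x))"
    by (intro integral_by_parts_pd[where R=R and i=m] cc_mult1[OF cs] pd_mult ps V1 V(1) continuous_intros cont b)
  note cci = cc_integrable[of R]
  have i1: "integrable lborel (\<lambda>x. V x * (t k x * V1 k x))" for k
    by (intro cci cc_mult2 cc_mult1 ct cont)
  have i2: "integrable lborel (\<lambda>x. V x * ((s x)\<^sup>2 * V2 k x))" for k
    by (intro cci cc_mult2 cc_mult1 cs cont)
  have i3: "integrable lborel (\<lambda>x. da x * ((s x)\<^sup>2 * V x))" "integrable lborel (\<lambda>x. db x * ((s x)\<^sup>2 * V x))"
    by (intro cci cc_mult2 cc_mult1 cs cont)+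
  have i4: "integrable lborel (\<lambda>x. a x * (t l x * V x + (s x)\<^sup>2 * V1 l x))"
    "integrable lborel (\<lambda>x. b x * (t m x * V x + (s x)\<^sup>2 * V1 m x))"
    by (intro cci cc_mult2 cc_add cc_mult1 cs ct cont)+
  define S where "S = (\<Sum>k\<in>UNIV. LBINT x. (s x)\<^sup>2 * (V1 k x)\<^sup>2)"
  have S_int: "S = (LBINT x. (\<Sum>k\<in>UNIV. (s x)\<^sup>2 * (V1 k x)\<^sup>2))"
    unfolding S_def by (rule Bochner_Integration.integral_sum[symmetric]) (intro int cont)
  have "S = - (\<Sum>k\<in>UNIV. LBINT x. V x * (t k x * V1 k x)) - (\<Sum>k\<in>UNIV. LBINT x. V x * ((s x)\<^sup>2 * V2 k x))"
    unfolding S_def ibp1 by (simp add: distrib_left i1 i2 sum_negf sum_subtractf)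
  also have "(\<Sum>k\<in>UNIV. LBINT x. V x * ((s x)\<^sup>2 * V2 k x)) = (LBINT x. (\<Sum>k\<in>UNIV. V x * ((s x)\<^sup>2 * V2 k x)))"
    by (rule Bochner_Integration.integral_sum[symmetric]) (rule i2)
  also have "(\<lambda>x. \<Sum>k\<in>UNIV. V x * ((s x)\<^sup>2 * V2 k x)) = (\<lambda>x. da x * ((s x)\<^sup>2 * V x) - db x * ((s x)\<^sup>2 * V x))"
    unfolding sum_distrib_left[symmetric] eq by (simp add: algebra_simps)
  also have "(LBINT x. da x * ((s x)\<^sup>2 * V x) - db x * ((s x)\<^sup>2 * V x))
      = (LBINT x. b x * (t m x * V x + (s x)\<^sup>2 * V1 m x)) - (LBINT x. a x * (t l x * V x + (s x)\<^sup>2 * V1 l x))"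
    by (simp add: i3 ibp2 ibp3)
  also have "(\<Sum>k\<in>UNIV. LBINT x. V x * (t k x * V1 k x)) = (LBINT x. (\<Sum>k\<in>UNIV. V x * (t k x * V1 k x)))"
    by (rule Bochner_Integration.integral_sum[symmetric]) (rule i1)
  finally have S_eq: "S = (LBINT x. a x * (t l x * V x + (s x)\<^sup>2 * V1 l x) - b x * (t m x * V x + (s x)\<^sup>2 * V1 m x)
       - (\<Sum>k\<in>UNIV. V x * (t k x * V1 k x)))"
    by (simp add: i1 i4)
  \<comment> \<open>R \<ge> 1 weakens 1 / R^2 to 1 / R.\<close>
  have VR: "(V x / R)\<^sup>2 \<le> 1 / R * (V x)\<^sup>2" for x
    using R by (simp add: power_divide power2_eq_square divide_left_mono)
  have tV: "\<bar>c * (t k x * V x)\<bar> \<le> 2 * ((s x)\<^sup>2 * c\<^sup>2) + 2 * (1 / R * (V x)\<^sup>2)" for c k x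
  proof -
    have "\<bar>c * (t k x * V x)\<bar> = \<bar>c\<bar> * \<bar>V x\<bar> * \<bar>t k x\<bar>" by (simp add: abs_mult)
    also have "\<dots> \<le> \<bar>c\<bar> * \<bar>V x\<bar> * (4 / R * s x)" by (intro mult_left_mono tb) auto
    also have "\<dots> = 4 * \<bar>(s x * c) * (V x / R)\<bar>" using s01 R0 by (simp add: abs_mult)
    also have "\<dots> \<le> 4 * (1/2 * (s x * c)\<^sup>2 + (V x / R)\<^sup>2 / (4 * (1/2)))"
      by (intro mult_left_mono weighted_young) auto
    also have "\<dots> \<le> 4 * (1/2 * (s x * c)\<^sup>2 + (1 / R * (V x)\<^sup>2) / (4 * (1/2)))"
      by (intro mult_left_mono add_left_mono divide_right_mono VR) auto
    finally show ?thesis by (simp add: power_mult_distrib mult_ac)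
  qed
  have sV: "\<bar>c * ((s x)\<^sup>2 * V1 k x)\<bar> \<le> 2 * ((s x)\<^sup>2 * c\<^sup>2) + 1/8 * ((s x)\<^sup>2 * (V1 k x)\<^sup>2)" for c k x
  proof -
    have "\<bar>c * ((s x)\<^sup>2 * V1 k x)\<bar> = \<bar>(s x * c) * (s x * V1 k x)\<bar>" by (simp add: power2_eq_square mult_ac)
    also have "\<dots> \<le> 2 * (s x * c)\<^sup>2 + (s x * V1 k x)\<^sup>2 / (4 * 2)" by (rule weighted_young) auto
    finally show ?thesis by (simp add: power_mult_distrib mult_ac)
  qed
  have tV1: "\<bar>V x * (t k x * V1 k x)\<bar> \<le> 1/8 * ((s x)\<^sup>2 * (V1 k x)\<^sup>2) + 32 * (1 / R * (V x)\<^sup>2)" for k x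
  proof -
    have "\<bar>V x * (t k x * V1 k x)\<bar> = \<bar>V1 k x\<bar> * \<bar>V x\<bar> * \<bar>t k x\<bar>" by (simp add: abs_mult)
    also have "\<dots> \<le> \<bar>V1 k x\<bar> * \<bar>V x\<bar> * (4 / R * s x)" by (intro mult_left_mono tb) auto
    also have "\<dots> = 4 * \<bar>(s x * V1 k x) * (V x / R)\<bar>" using s01 R0 by (simp add: abs_mult)
    also have "\<dots> \<le> 4 * (1/32 * (s x * V1 k x)\<^sup>2 + (V x / R)\<^sup>2 / (4 * (1/32)))"
      by (intro mult_left_mono weighted_young) auto
    also have "\<dots> \<le> 4 * (1/32 * (s x * V1 k x)\<^sup>2 + (1 / R * (V x)\<^sup>2) / (4 * (1/32)))"
      by (intro mult_left_mono add_left_mono divide_right_mono VR) auto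
    finally show ?thesis by (simp add: power_mult_distrib mult_ac)
  qed
  have single: "1/8 * ((s x)\<^sup>2 * (V1 k x)\<^sup>2) \<le> 1/8 * (\<Sum>k\<in>UNIV. (s x)\<^sup>2 * (V1 k x)\<^sup>2)" for k x
    using member_le_sum[of k UNIV "\<lambda>k. (s x)\<^sup>2 * (V1 k x)\<^sup>2"] by simp
  \<comment> \<open>Two terms for each of a and b give 4 = 2 + 2; the V^2 terms add up to 100 = 2 +
    2 + 3 * 32; the gradient shares are 1/8 from a, 1/8 from b and 1/8 from the whole sum over
    k.\<close>
  have "S \<le> (LBINT x. 4 * ((s x)\<^sup>2 * (a x)\<^sup>2) + 4 * ((s x)\<^sup>2 * (b x)\<^sup>2) + 100 * (1 / R * (V x)\<^sup>2)
      + 3/8 * (\<Sum>k\<in>UNIV. (s x)\<^sup>2 * (V1 k x)\<^sup>2))" (is "_ \<le> (LBINT x. ?g x)")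
    unfolding S_eq
  proof (rule integral_mono)
    show "integrable lborel (\<lambda>x. a x * (t l x * V x + (s x)\<^sup>2 * V1 l x) - b x * (t m x * V x + (s x)\<^sup>2 * V1 m x)
       - (\<Sum>k\<in>UNIV. V x * (t k x * V1 k x)))"
      by (intro Bochner_Integration.integrable_diff Bochner_Integration.integrable_sum i1 i4)
    show "integrable lborel ?g"
      by (intro Bochner_Integration.integrable_add Bochner_Integration.integrable_sum integrable_mult_right int V cont)
    fix x
    have "\<bar>\<Sum>k\<in>UNIV. V x * (t k x * V1 k x)\<bar> \<le> (\<Sum>k\<in>UNIV. 1/8 * ((s x)\<^sup>2 * (V1 k x)\<^sup>2) + 32 * (1 / R * (V x)\<^sup>2))"
      by (rule order_trans[OF sum_abs]) (intro sum_mono tV1)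
    also have "\<dots> = 1/8 * (\<Sum>k\<in>UNIV. (s x)\<^sup>2 * (V1 k x)\<^sup>2) + 96 * (1 / R * (V x)\<^sup>2)"
      by (simp add: sum.distrib sum_distrib_left)
    finally have "\<bar>\<Sum>k\<in>UNIV. V x * (t k x * V1 k x)\<bar> \<le> 1/8 * (\<Sum>k\<in>UNIV. (s x)\<^sup>2 * (V1 k x)\<^sup>2) + 96 * (1 / R * (V x)\<^sup>2)" .
    then show "a x * (t l x * V x + (s x)\<^sup>2 * V1 l x) - b x * (t m x * V x + (s x)\<^sup>2 * V1 m x)
       - (\<Sum>k\<in>UNIV. V x * (t k x * V1 k x)) \<le> ?g x"
      using tV[of "a x" l x] tV[of "b x" m x] sV[of "a x" x l] sV[of "b x" x m] single[of x l] single[of x m]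
      unfolding distrib_left by linarith
  qed
  also have "\<dots> = 4 * (LBINT x. (s x)\<^sup>2 * (a x)\<^sup>2) + 4 * (LBINT x. (s x)\<^sup>2 * (b x)\<^sup>2)
      + 100 * (1 / R * (LBINT x. (V x)\<^sup>2)) + 3/8 * S"
    unfolding S_int by (simp add: int cont V)
  \<comment> \<open>Absorbing 3/8 of \<open>S\<close> leaves 5/8 of it; the resulting 32/5 and 160
    are rounded up to 8 and 200.\<close>
  finally have "5 * S \<le> 32 * (LBINT x. (s x)\<^sup>2 * (a x)\<^sup>2) + 32 * (LBINT x. (s x)\<^sup>2 * (b x)\<^sup>2)
      + 800 * (1 / R * (LBINT x. (V x)\<^sup>2))" by linarith
  moreover have "0 \<le> (LBINT x. (s x)\<^sup>2 * (a x)\<^sup>2)" "0 \<le> (LBINT x. (s x)\<^sup>2 * (b x)\<^sup>2)"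
    "0 \<le> 1 / R * (LBINT x. (V x)\<^sup>2)" using R0 by simp_all
  ultimately have "S \<le> 8 * (LBINT x. (s x)\<^sup>2 * (a x)\<^sup>2) + 8 * (LBINT x. (s x)\<^sup>2 * (b x)\<^sup>2)
      + 200 / R * (LBINT x. (V x)\<^sup>2)" by linarith
  then show ?thesis by (simp add: S_def s_def)
qed

section \<open>Energy estimates\<close>

text \<open>From some index on the integrands are dominated by |f| (|w| + 1), which is integrable
  because f has compact support; the finitely many earlier indices are skipped.\<close>

lemma uniform_limit_integral_cc:
  assumes lim: "uniform_limit (cball 0 R) v w sequentially"
    and f: "cc R f" and v: "\<And>n. continuous_on UNIV (v n)" and w: "continuous_on UNIV (w :: real^'n::finite \<Rightarrow> real)"
  shows "(\<lambda>n. LBINT x. f x * v n x) \<longlonglongrightarrow> (LBINT x. f x * w x)"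
proof -
  have "\<exists>N. \<forall>n\<ge>N. \<forall>x\<in>cball 0 R. \<bar>v n x - w x\<bar> < 1"
    using uniform_limitD[OF lim, of 1] unfolding eventually_sequentially by (auto simp: dist_real_def)
  then obtain N where N: "\<And>n x. N \<le> n \<Longrightarrow> norm x \<le> R \<Longrightarrow> \<bar>v n x - w x\<bar> < 1"
    by (metis mem_cball_0)
  have "(\<lambda>n. LBINT x. f x * v (n + N) x) \<longlonglongrightarrow> (LBINT x. f x * w x)"
  proof (rule integral_dominated_convergence[where w="\<lambda>x. \<bar>f x\<bar> * (\<bar>w x\<bar> + 1)"])
    show "(\<lambda>x. f x * w x) \<in> borel_measurable lborel" "\<And>n. (\<lambda>x. f x * v (n + N) x) \<in> borel_measurable lborel"
      using f v w by (auto simp: cc_def intro!: borel_measurable_continuous_onI continuous_intros)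
    show "integrable lborel (\<lambda>x. \<bar>f x\<bar> * (\<bar>w x\<bar> + 1))"
      by (intro cc_integrable[of R] cc_mult1 cc_abs f continuous_intros w)
    show "AE x in lborel. (\<lambda>n. f x * v (n + N) x) \<longlonglongrightarrow> f x * w x" (is "AE x in lborel. ?P x")
    proof (rule AE_I2)
      fix x
      show "?P x"
      proof (cases "norm x \<le> R")
        case True
        then have "(\<lambda>n. v n x) \<longlonglongrightarrow> w x" using tendsto_uniform_limitI[OF lim] by auto
        then show ?thesis by (intro tendsto_intros LIMSEQ_ignore_initial_segment)
      next
        case False
        then show ?thesis using f by (simp add: cc_def)
      qed
    qed
    fix n
    show "AE x in lborel. norm (f x * v (n + N) x) \<le> \<bar>f x\<bar> * (\<bar>w x\<bar> + 1)" (is "AE x in lborel. ?P x")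
    proof (rule AE_I2)
      fix x
      show "?P x"
      proof (cases "norm x \<le> R")
        case True
        then have "\<bar>v (n + N) x\<bar> \<le> \<bar>w x\<bar> + 1" using N[of "n + N" x] by simp
        then show ?thesis by (auto simp: abs_mult intro: mult_left_mono)
      next
        case False
        then show ?thesis using f by (simp add: cc_def)
      qed
    qed
  qed
  then show ?thesis by (rule LIMSEQ_offset)
qed

lemma uniform_limit_square:
  assumes "uniform_limit (cball 0 R) v w sequentially" "continuous_on UNIV (w :: real^'n::finite \<Rightarrow> real)"
  shows "uniform_limit (cball 0 R) (\<lambda>n x. (v n x)\<^sup>2) (\<lambda>x. (w x)\<^sup>2) sequentially"
proof -
  have "bounded (w ` cball 0 R)"
    by (intro compact_imp_bounded compact_continuous_image continuous_on_subset[OF assms(2)]) auto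
  then show ?thesis
    unfolding power2_eq_square by (intro uniform_lim_mult assms)
qed

text \<open>The interface between the energy argument and the construction of the potential. Uniform
  in n are only the L^2 bound of \<open>B\<close> and the locally uniform convergence of
  \<open>v\<close>; their derivatives exist for each n without a common bound.\<close>

locale ns_approx =
  fixes u :: "3 \<Rightarrow> real^3 \<Rightarrow> real" and du d2u :: "3 \<Rightarrow> 3 \<Rightarrow> real^3 \<Rightarrow> real"
    and P :: "real^3 \<Rightarrow> real" and dP :: "3 \<Rightarrow> real^3 \<Rightarrow> real"
    and v :: "nat \<Rightarrow> 3 \<Rightarrow> real^3 \<Rightarrow> real" and dv :: "nat \<Rightarrow> 3 \<Rightarrow> 3 \<Rightarrow> real^3 \<Rightarrow> real"
    and B :: "nat \<Rightarrow> 3 \<Rightarrow> 3 \<Rightarrow> real^3 \<Rightarrow> real" and dB :: "nat \<Rightarrow> 3 \<Rightarrow> 3 \<Rightarrow> 3 \<Rightarrow> real^3 \<Rightarrow> real"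
    and d2B :: "nat \<Rightarrow> 3 \<Rightarrow> 3 \<Rightarrow> 3 \<Rightarrow> 3 \<Rightarrow> real^3 \<Rightarrow> real"
    and K p :: real
  assumes u_cont: "continuous_on UNIV (u i)" "continuous_on UNIV (du i k)" "continuous_on UNIV (d2u i k)"
    and u_pd: "pd k (u i) (du i k)" "pd k (du i k) (d2u i k)"
    and P_cont: "continuous_on UNIV P" "continuous_on UNIV (dP i)" and P_pd: "pd i P (dP i)"
    and div_u: "(\<Sum>k\<in>UNIV. du k k x) = 0"
    and NS: "dP i x = (\<Sum>k\<in>UNIV. d2u i k x) - (\<Sum>k\<in>UNIV. u k x * du i k x)"
    and v_cont: "continuous_on UNIV (v n i)" "continuous_on UNIV (dv n i k)" and v_pd: "pd k (v n i) (dv n i k)"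
    and B_cont: "continuous_on UNIV (B n i j)" "continuous_on UNIV (dB n i j k)" "continuous_on UNIV (d2B n i j k l)"
    and B_pd: "pd k (B n i j) (dB n i j k)" "pd l (dB n i j k) (d2B n i j k l)"
    and B_antisym: "B n i j x = - B n j i x"
    and d2B_sym: "d2B n i j k l x = d2B n i j l k x"
    and div_B: "(\<Sum>j\<in>UNIV. dB n i j j x) = v n i x"
    and lap_B: "(\<Sum>k\<in>UNIV. d2B n i j k k x) = dv n i j x - dv n j i x"
    and B_L2: "integrable lborel (\<lambda>x. (B n i j x)\<^sup>2)" "(LBINT x. (B n i j x)\<^sup>2) \<le> K"
    and v_lim: "uniform_limit (cball 0 R) (\<lambda>n. v n i) (u i) sequentially"
    and p: "4 \<le> p" and u_Lp: "integrable lborel (\<lambda>x. (\<Sum>i\<in>UNIV. (u i x)\<^sup>2) powr (p / 2))"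
begin

lemma dB_antisym: "dB n i j k x = - dB n j i k x"
proof -
  have "pd k (\<lambda>x. 0 - B n j i x) (\<lambda>x. 0 - dB n j i k x)"
    by (intro pd_diff pd_const B_pd)
  moreover have "(\<lambda>x. 0 - B n j i x) = B n i j"
    by (auto simp: fun_eq_iff B_antisym[of n i j])
  ultimately show ?thesis using fun_cong[OF pd_unique[OF B_pd(1)[of k n i j]]] by simp
qed

lemma d2B_antisym: "d2B n i j k l x = - d2B n j i k l x"
proof -
  have "pd l (\<lambda>x. 0 - dB n j i k x) (\<lambda>x. 0 - d2B n j i k l x)"
    by (intro pd_diff pd_const B_pd)
  moreover have "(\<lambda>x. 0 - dB n j i k x) = dB n i j k"
    by (auto simp: fun_eq_iff dB_antisym[of n i j])
  ultimately show ?thesis using fun_cong[OF pd_unique[OF B_pd(2)[of l n i j k]]] by simp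
qed

section \<open>Squared speed and momentum flux\<close>

definition q :: "real^3 \<Rightarrow> real" where "q x = (\<Sum>i\<in>UNIV. (u i x)\<^sup>2)"

lemma q_nonneg: "0 \<le> q x" by (simp add: q_def sum_nonneg)

lemma q_cont: "continuous_on UNIV q"
  unfolding q_def[abs_def] by (intro continuous_intros u_cont)

lemma u_sq_le: "(u i x)\<^sup>2 \<le> q x"
  unfolding q_def by (intro member_le_sum[of i UNIV "\<lambda>i. (u i x)\<^sup>2"]) auto

lemma u_mult_le: "\<bar>u i x * u k x\<bar> \<le> q x"
proof -
  have "\<bar>u i x * u k x\<bar> \<le> 1/2 * (u i x)\<^sup>2 + (u k x)\<^sup>2 / (4 * (1/2))"
    by (rule weighted_young) simp
  then show ?thesis using u_sq_le[of i x] u_sq_le[of k x] by simp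
qed

text \<open>The flux of the momentum equation: velocity gradient minus u_i u_k. By incompressibility
  its divergence over k is the i-th component of the pressure gradient, so that after integration by
  parts a pressure term involves first derivatives of u only.\<close>

definition \<sigma> :: "3 \<Rightarrow> 3 \<Rightarrow> real^3 \<Rightarrow> real" where
  "\<sigma> i k x = du i k x - u i x * u k x"

definition d\<sigma> :: "3 \<Rightarrow> 3 \<Rightarrow> real^3 \<Rightarrow> real" where
  "d\<sigma> i k x = d2u i k x - (du i k x * u k x + u i x * du k k x)"

lemma pd_\<sigma>: "pd k (\<sigma> i k) (d\<sigma> i k)"
  unfolding \<sigma>_def[abs_def] d\<sigma>_def[abs_def] by (intro pd_diff pd_mult u_pd)

lemma \<sigma>_cont: "continuous_on UNIV (\<sigma> i k)" "continuous_on UNIV (d\<sigma> i k)"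
  unfolding \<sigma>_def[abs_def] d\<sigma>_def[abs_def] by (intro continuous_intros u_cont)+

lemma div_\<sigma>: "(\<Sum>k\<in>UNIV. d\<sigma> i k x) = dP i x"
  unfolding d\<sigma>_def NS sum_subtractf sum.distrib sum_distrib_left[symmetric] div_u
  by (simp add: mult.commute)

lemma integral_dP:
  assumes "cc R f" "\<And>k. pd k f (f' k)" "\<And>k. continuous_on UNIV (f' k)"
  shows "(LBINT x. dP i x * f x) = - (\<Sum>k\<in>UNIV. LBINT x. \<sigma> i k x * f' k x)"
proof -
  have "(LBINT x. dP i x * f x) = (LBINT x. (\<Sum>k\<in>UNIV. d\<sigma> i k x * f x))"
    by (simp add: div_\<sigma>[symmetric] sum_distrib_right)
  also have "\<dots> = (\<Sum>k\<in>UNIV. LBINT x. d\<sigma> i k x * f x)"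
    by (intro Bochner_Integration.integral_sum cc_integrable[of R] cc_mult2 assms \<sigma>_cont)
  also have "\<dots> = (\<Sum>k\<in>UNIV. - (LBINT x. \<sigma> i k x * f' k x))"
  proof (rule sum.cong[OF refl])
    fix k
    show "(LBINT x. d\<sigma> i k x * f x) = - (LBINT x. \<sigma> i k x * f' k x)"
      by (rule integral_by_parts_pd[OF assms(1,2,3) \<sigma>_cont(1) pd_\<sigma> \<sigma>_cont(2)])
  qed
  finally show ?thesis by (simp add: sum_negf)
qed

context
  fixes R :: real
  assumes R: "R \<ge> 1"
begin

lemma R0: "R > 0" using R by simp

abbreviation "s \<equiv> cutoff R"
abbreviation "DU i k \<equiv> LBINT x. phi R x * (du i k x)\<^sup>2"
abbreviation "UU i \<equiv> LBINT x. (s x)\<^sup>2 * (u i x)\<^sup>2"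
abbreviation "UUU i k \<equiv> LBINT x. phi1 R k x * (u k x * (u i x)\<^sup>2)"
abbreviation "VV n i \<equiv> LBINT x. (s x)\<^sup>2 * (v n i x)\<^sup>2"
abbreviation "BB n i j \<equiv> LBINT x. (B n i j x)\<^sup>2"
abbreviation "DB n i j k \<equiv> LBINT x. (s x)\<^sup>2 * (dB n i j k x)\<^sup>2"
abbreviation "err n i \<equiv> (LBINT x. dP i x * phi R x * u i x) - (LBINT x. dP i x * phi R x * v n i x)"
abbreviation "grad_\<phi>B n i j k x \<equiv> phi2 R j k x * B n i j x + phi1 R j x * dB n i j k x"

lemma pd_phi_u: "pd k (\<lambda>x. phi R x * u i x) (\<lambda>x. phi1 R k x * u i x + phi R x * du i k x)"
  by (intro pd_mult pd_phi u_pd)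

lemma pd_phi1_B: "pd k (\<lambda>x. phi1 R j x * B n i j x) (\<lambda>x. grad_\<phi>B n i j k x)"
  by (intro pd_mult pd_phi1 B_pd)

text \<open>The test field \<open>\<Sum>\<^sub>j \<partial>\<^sub>j (\<phi> B\<^sub>i\<^sub>j)\<close> is divergence free since \<open>B\<close> is antisymmetric, so that it does
  not see the pressure.\<close>

lemma pressure_free:
  "(\<Sum>i\<in>UNIV. LBINT x. dP i x * (phi R x * v n i x))
     + (\<Sum>i\<in>UNIV. \<Sum>j\<in>UNIV. LBINT x. dP i x * (phi1 R j x * B n i j x)) = 0"
proof -
  note cont = B_cont P_cont v_cont continuous_phi
  define z where "z i j x = phi1 R j x * B n i j x + phi R x * dB n i j j x" for i j x
  define y where "y i j k x = grad_\<phi>B n i j k x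
     + (phi1 R k x * dB n i j j x + phi R x * d2B n i j j k x)" for i j k x
  have zc: "cc R (z i j)" for i j
    unfolding z_def[abs_def] by (intro cc_add cc_mult1 cc_phi cc_phi1 R0 cont)
  have zp: "pd k (z i j) (y i j k)" for i j k
    unfolding z_def[abs_def] y_def[abs_def] by (intro pd_add pd_mult pd_phi pd_phi1 B_pd)
  have yc: "continuous_on UNIV (y i j k)" for i j k
    unfolding y_def[abs_def] by (intro continuous_intros cont)
  have ycc: "cc R (y i j k)" for i j k
    by (rule cc_pd[OF zc zp yc])
  have i: "integrable lborel (\<lambda>x. P x * y i j k x)" for i j k
    by (intro cc_integrable[of R] cc_mult2 ycc cont)
  \<comment> \<open>\<open>y i j i\<close> is the mixed second derivative of \<open>phi R\<close>
    times \<open>B n i j\<close>: symmetric in the order of differentiation and antisymmetric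
    through \<open>B\<close>, so its double sum vanishes.\<close>
  have y_anti: "y i j i x = - y j i j x" for i j x
    unfolding y_def using B_antisym[of n i j x] dB_antisym[of n i j i x] dB_antisym[of n i j j x]
      phi2_sym[of R i j x] d2B_sym[of n i j j i x] d2B_antisym[of n i j i j x] by simp
  have "(\<Sum>i\<in>UNIV. \<Sum>j\<in>UNIV. y i j i x) = 0" for x
  proof -
    have "(\<Sum>i\<in>UNIV. \<Sum>j\<in>UNIV. y i j i x) = (\<Sum>j\<in>UNIV. \<Sum>i\<in>UNIV. - y j i j x)"
      by (subst sum.swap) (simp add: y_anti[symmetric])
    then show ?thesis by (simp add: sum_negf)
  qed
  then have "0 = (LBINT x. (\<Sum>i\<in>UNIV. \<Sum>j\<in>UNIV. P x * y i j i x))"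
    by (simp add: sum_distrib_left[symmetric])
  also have "\<dots> = (\<Sum>i\<in>UNIV. \<Sum>j\<in>UNIV. LBINT x. P x * y i j i x)"
    by (simp add: Bochner_Integration.integral_sum i)
  also have "\<dots> = - (\<Sum>i\<in>UNIV. \<Sum>j\<in>UNIV. LBINT x. dP i x * z i j x)"
    unfolding sum_negf[symmetric]
    by (intro sum.cong refl) (simp add: integral_by_parts_pd[OF zc zp yc P_cont(1) P_pd P_cont(2)])
  also have "(\<Sum>i\<in>UNIV. \<Sum>j\<in>UNIV. LBINT x. dP i x * z i j x)
     = (\<Sum>i\<in>UNIV. \<Sum>j\<in>UNIV. (LBINT x. dP i x * (phi1 R j x * B n i j x))
           + (LBINT x. dP i x * (phi R x * dB n i j j x)))"
    unfolding z_def distrib_left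
    by (intro sum.cong refl Bochner_Integration.integral_add cc_integrable[of R] cc_mult2 cc_mult1 cc_phi cc_phi1 R0 cont)
  also have "\<dots> = (\<Sum>i\<in>UNIV. \<Sum>j\<in>UNIV. (LBINT x. dP i x * (phi1 R j x * B n i j x)))
       + (\<Sum>i\<in>UNIV. LBINT x. (\<Sum>j\<in>UNIV. dP i x * (phi R x * dB n i j j x)))"
    unfolding sum.distrib
    by (intro arg_cong2[of _ _ _ _ "(+)"] refl sum.cong Bochner_Integration.integral_sum[symmetric]
        cc_integrable[of R] cc_mult2 cc_mult1 cc_phi cc_phi1 R0 cont)
  finally show ?thesis by (simp add: sum_distrib_left[symmetric] div_B)
qed

text \<open>Because div u = 0, the divergence of u_i^2 u is twice u_i times the convection of u_i.
  Integrating against the cutoff moves the derivative onto the cutoff; this is the origin of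
  1/2.\<close>

lemma convection_identity:
  "(\<Sum>k\<in>UNIV. LBINT x. phi R x * (u i x * u k x * du i k x))
     = - (1/2) * (\<Sum>k\<in>UNIV. UUU i k)"
proof -
  note cont = u_cont continuous_phi
  have ibp: "(LBINT x. (du k k x * (u i x * u i x) + u k x * (du i k x * u i x + u i x * du i k x)) * phi R x)
      = - (LBINT x. (u k x * (u i x * u i x)) * phi1 R k x)" for k
    by (rule integral_by_parts_pd[OF cc_phi[OF R0] pd_phi]) (intro pd_mult u_pd continuous_intros cont)+
  have i: "integrable lborel (\<lambda>x. phi R x * f x)" if "continuous_on UNIV f" for f
    by (intro cc_integrable[of R] cc_mult1 cc_phi R0 that)
  have i1: "integrable lborel (\<lambda>x. phi R x * (u i x * u k x * du i k x))"
    "integrable lborel (\<lambda>x. phi R x * (du k k x * (u i x)\<^sup>2))" for k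
    by (intro i continuous_intros cont)+
  have *: "(LBINT x. phi R x * (du k k x * (u i x)\<^sup>2)) + 2 * (LBINT x. phi R x * (u i x * u k x * du i k x))
      = - UUU i k" for k
  proof -
    have "(LBINT x. phi R x * (du k k x * (u i x)\<^sup>2)) + 2 * (LBINT x. phi R x * (u i x * u k x * du i k x))
      = (LBINT x. phi R x * (du k k x * (u i x)\<^sup>2) + 2 * (phi R x * (u i x * u k x * du i k x)))"
      by (simp add: i1)
    also have "\<dots> = (LBINT x. (du k k x * (u i x * u i x) + u k x * (du i k x * u i x + u i x * du i k x)) * phi R x)"
      by (intro Bochner_Integration.integral_cong refl) (simp add: algebra_simps power2_eq_square)
    also have "\<dots> = - UUU i k"
      unfolding ibp by (simp add: mult_ac power2_eq_square)
    finally show ?thesis .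
  qed
  have "(\<Sum>k\<in>UNIV. LBINT x. phi R x * (du k k x * (u i x)\<^sup>2))
      = (LBINT x. (\<Sum>k\<in>UNIV. phi R x * (du k k x * (u i x)\<^sup>2)))"
    by (rule Bochner_Integration.integral_sum[symmetric]) (rule i1)
  also have "\<dots> = 0"
    unfolding sum_distrib_left[symmetric] sum_distrib_right[symmetric] div_u by simp
  finally have "(\<Sum>k\<in>UNIV. (LBINT x. phi R x * (du k k x * (u i x)\<^sup>2))
       + 2 * (LBINT x. phi R x * (u i x * u k x * du i k x)))
      = 2 * (\<Sum>k\<in>UNIV. LBINT x. phi R x * (u i x * u k x * du i k x))"
    by (simp add: sum.distrib sum_distrib_left)
  then show ?thesis unfolding * by (simp add: sum_negf)
qed

text \<open>Testing with \<phi>u leaves a pressure term with u. It is exchanged for the one with v_n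
  at the cost of \<open>err\<close>, then by \<open>pressure_free\<close> for terms with
  \<open>B\<close>, which \<open>integral_dP\<close> rewrites through the flux. The pressure
  survives only in \<open>err\<close>, which tends to 0.\<close>

lemma energy_identity:
  "(\<Sum>i\<in>UNIV. \<Sum>k\<in>UNIV. DU i k) =
     (\<Sum>i\<in>UNIV. \<Sum>k\<in>UNIV. 1/2 * UUU i k
         - (LBINT x. du i k x * (phi1 R k x * u i x)))
     - (\<Sum>i\<in>UNIV. err n i)
     - (\<Sum>i\<in>UNIV. \<Sum>j\<in>UNIV. \<Sum>k\<in>UNIV.
         LBINT x. \<sigma> i k x * grad_\<phi>B n i j k x)"
proof -
  note cont = u_cont continuous_phi B_cont P_cont v_cont
  have a: "(\<Sum>i\<in>UNIV. LBINT x. dP i x * (phi R x * v n i x)) = (\<Sum>i\<in>UNIV. \<Sum>j\<in>UNIV. \<Sum>k\<in>UNIV.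
         LBINT x. \<sigma> i k x * grad_\<phi>B n i j k x)"
  proof -
    have "(LBINT x. dP i x * (phi1 R j x * B n i j x)) = - (\<Sum>k\<in>UNIV.
         LBINT x. \<sigma> i k x * grad_\<phi>B n i j k x)" for i j
      by (rule integral_dP[where R=R]) (intro pd_phi1_B cc_mult1 cc_phi1 R0 continuous_intros cont)+
    then show ?thesis using pressure_free[of n] by (simp add: sum_negf)
  qed
  have b: "(LBINT x. dP i x * (phi R x * u i x)) =
    - (\<Sum>k\<in>UNIV. LBINT x. \<sigma> i k x * (phi1 R k x * u i x + phi R x * du i k x))" for i
    by (rule integral_dP[where R=R]) (intro pd_phi_u cc_mult1 cc_phi R0 continuous_intros cont)+
  have i1: "integrable lborel (\<lambda>x. phi R x * (du i k x)\<^sup>2)"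
    "integrable lborel (\<lambda>x. du i k x * (phi1 R k x * u i x))"
    "integrable lborel (\<lambda>x. phi1 R k x * (u k x * (u i x)\<^sup>2))"
    "integrable lborel (\<lambda>x. phi R x * (u i x * u k x * du i k x))" for i k
    by (intro cc_integrable[of R] cc_mult1 cc_mult2 cc_phi cc_phi1 R0 continuous_intros cont)+
  have c: "(LBINT x. \<sigma> i k x * (phi1 R k x * u i x + phi R x * du i k x))
    = DU i k + (LBINT x. du i k x * (phi1 R k x * u i x))
      - UUU i k - (LBINT x. phi R x * (u i x * u k x * du i k x))" for i k
  proof -
    have "(LBINT x. \<sigma> i k x * (phi1 R k x * u i x + phi R x * du i k x))
      = (LBINT x. phi R x * (du i k x)\<^sup>2 + du i k x * (phi1 R k x * u i x)
        - phi1 R k x * (u k x * (u i x)\<^sup>2) - phi R x * (u i x * u k x * du i k x))"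
      by (intro Bochner_Integration.integral_cong refl) (simp add: \<sigma>_def algebra_simps power2_eq_square)
    then show ?thesis by (simp add: i1)
  qed
  have d: "(\<Sum>k\<in>UNIV. LBINT x. \<sigma> i k x * (phi1 R k x * u i x + phi R x * du i k x))
    = (\<Sum>k\<in>UNIV. DU i k)
      - (\<Sum>k\<in>UNIV. 1/2 * UUU i k
         - (LBINT x. du i k x * (phi1 R k x * u i x)))" for i
    unfolding c by (simp add: sum.distrib sum_subtractf convection_identity sum_distrib_left[symmetric] sum_divide_distrib[symmetric])
  show ?thesis
    using a unfolding mult.assoc b d by (simp add: sum_subtractf sum_negf)
qed

section \<open>Bounds for the terms of the energy identity\<close>

lemma cc_s2: "cc R (\<lambda>x. (s x)\<^sup>2)"
  using cc_cutoff_power[OF R0, of 1] by (simp add: eval_nat_numeral)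

lemma phi1_le: "\<bar>phi1 R j x\<bar> \<le> 8 / R * (s x ^ 3)" by (rule phi1_bound[OF R0])

lemma phi2_le: "\<bar>phi2 R j k x\<bar> \<le> 56 / R\<^sup>2 * (s x)\<^sup>2" by (rule phi2_bound[OF R0])

lemma inverse_R_sq: "0 \<le> c \<Longrightarrow> c / R\<^sup>2 \<le> c / R"
  using R by (intro divide_left_mono) (auto simp: power2_eq_square)

lemma integrable_basic:
  "integrable lborel (\<lambda>x. phi R x * (du i k x)\<^sup>2)"
  "integrable lborel (\<lambda>x. (s x)\<^sup>2 * (u i x)\<^sup>2)"
  "integrable lborel (\<lambda>x. (s x)\<^sup>2 * q x)"
  "integrable lborel (\<lambda>x. (s x)\<^sup>2 * (q x)\<^sup>2)"
  "integrable lborel (\<lambda>x. (s x)\<^sup>2 * (dB n i j k x)\<^sup>2)"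
  "integrable lborel (\<lambda>x. (s x)\<^sup>2 * (v n i x)\<^sup>2)"
  by (intro cc_integrable[of R] cc_mult1 cc_phi cc_s2 R0 continuous_intros u_cont q_cont B_cont v_cont)+

text \<open>The cube of the cutoff is split as square times first power before Young's inequality;
  128 = 8^2 / (4 * 1/8).\<close>

lemma term_a: "\<bar>LBINT x. du i k x * (phi1 R k x * u i x)\<bar>
   \<le> 1/8 * DU i k + 128 / R * UU i"
proof -
  have "\<bar>LBINT x. du i k x * (phi1 R k x * u i x)\<bar>
    \<le> (LBINT x. 1/8 * (phi R x * (du i k x)\<^sup>2) + 128 / R * ((s x)\<^sup>2 * (u i x)\<^sup>2))" (is "\<bar>LBINT x. ?f x\<bar> \<le> (LBINT x. ?g x)")
  proof (rule abs_integral_le)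
    show "integrable lborel ?f"
      by (intro cc_integrable[of R] cc_mult1 cc_mult2 cc_phi1 R0 u_cont)
    show "integrable lborel ?g"
      by (intro Bochner_Integration.integrable_add integrable_mult_right integrable_basic)
    fix x
    have "\<bar>du i k x * (phi1 R k x * u i x)\<bar> = \<bar>du i k x\<bar> * \<bar>u i x\<bar> * \<bar>phi1 R k x\<bar>" by (simp add: abs_mult)
    also have "\<dots> \<le> \<bar>du i k x\<bar> * \<bar>u i x\<bar> * (8 / R * (s x ^ 3))" by (intro mult_left_mono phi1_le) auto
    also have "\<dots> = \<bar>((s x)\<^sup>2 * du i k x) * (8 / R * (s x * u i x))\<bar>"
      using R0 by (simp add: abs_mult eval_nat_numeral)
    also have "\<dots> \<le> 1/8 * ((s x)\<^sup>2 * du i k x)\<^sup>2 + (8 / R * (s x * u i x))\<^sup>2 / (4 * (1/8))"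
      by (rule weighted_young) simp
    also have "\<dots> = 1/8 * (phi R x * (du i k x)\<^sup>2) + 128 / R\<^sup>2 * ((s x)\<^sup>2 * (u i x)\<^sup>2)"
      by (simp add: phi_def power_mult_distrib power_divide)
    also have "\<dots> \<le> ?g x"
      by (intro add_left_mono mult_right_mono inverse_R_sq) auto
    finally show "\<bar>?f x\<bar>
      \<le> ?g x" .
  qed
  then show ?thesis by (simp add: integrable_basic)
qed

lemma s3_le: "s x ^ 3 \<le> (s x)\<^sup>2"
  by (intro power_decreasing) auto

text \<open>Young's inequality for the product of u_i u_k and u_i places the cubic term between a
  quadratic and a quartic one.\<close>

lemma term_b: "\<bar>UUU i k\<bar>
   \<le> 4 / R * ((LBINT x. (s x)\<^sup>2 * q x) + (LBINT x. (s x)\<^sup>2 * (q x)\<^sup>2))"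
proof -
  have "\<bar>UUU i k\<bar>
    \<le> (LBINT x. 4 / R * ((s x)\<^sup>2 * q x + (s x)\<^sup>2 * (q x)\<^sup>2))" (is "_ \<le> (LBINT x. ?g x)")
  proof (rule abs_integral_le)
    show "integrable lborel (\<lambda>x. phi1 R k x * (u k x * (u i x)\<^sup>2))"
      by (intro cc_integrable[of R] cc_mult1 cc_phi1 R0 continuous_intros u_cont)
    show "integrable lborel ?g"
      by (intro Bochner_Integration.integrable_add integrable_mult_right integrable_basic)
    fix x
    have "\<bar>(u i x * u k x) * u i x\<bar> \<le> 1/2 * (u i x * u k x)\<^sup>2 + (u i x)\<^sup>2 / (4 * (1/2))"
      by (rule weighted_young) simp
    moreover have "(u i x * u k x)\<^sup>2 \<le> (q x)\<^sup>2"
      using u_mult_le[of i x k] q_nonneg[of x] by (simp add: abs_le_square_iff[symmetric])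
    ultimately have "\<bar>(u i x * u k x) * u i x\<bar> \<le> 1/2 * (q x + (q x)\<^sup>2)"
      using u_sq_le[of i x] by simp
    moreover have "(u i x * u k x) * u i x = u k x * (u i x)\<^sup>2" by (simp add: power2_eq_square)
    ultimately have *: "\<bar>u k x * (u i x)\<^sup>2\<bar> \<le> 1/2 * (q x + (q x)\<^sup>2)" by simp
    have "\<bar>phi1 R k x * (u k x * (u i x)\<^sup>2)\<bar> = \<bar>phi1 R k x\<bar> * \<bar>u k x * (u i x)\<^sup>2\<bar>" by (rule abs_mult)
    also have "\<dots> \<le> (8 / R * (s x)\<^sup>2) * (1/2 * (q x + (q x)\<^sup>2))"
    proof (intro mult_mono *)
      show "\<bar>phi1 R k x\<bar> \<le> 8 / R * (s x)\<^sup>2"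
        by (rule order_trans[OF phi1_le]) (intro mult_left_mono s3_le, use R0 in simp)
    qed (use R0 in auto)
    also have "\<dots> = ?g x" by (simp add: algebra_simps)
    finally show "\<bar>phi1 R k x * (u k x * (u i x)\<^sup>2)\<bar> \<le> ?g x" .
  qed
  then show ?thesis by (simp add: integrable_basic)
qed

text \<open>The flux is at most |grad u| + |u|^2, and each summand meets \<open>B\<close> or its
  gradient: four products for Young's inequality. The share 1/24 = 1/48 + 1/48 adds up over the
  three values of j to 1/8 of the energy. The gradient of \<open>B\<close> must keep the weight s^2,
  which is the one that \<open>dB_bound\<close> controls. Constants: 37660 = 12 * 56^2 + 28, 772 =
  12 * 8^2 + 4 and 32 = 28 + 4.\<close>

lemma term_c: "\<bar>LBINT x. \<sigma> i k x * grad_\<phi>B n i j k x\<bar>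
   \<le> 1/24 * DU i k + 1 / R * (37660 * BB n i j
     + 772 * DB n i j k + 32 * (LBINT x. (s x)\<^sup>2 * (q x)\<^sup>2))"
proof -
  have "\<bar>LBINT x. \<sigma> i k x * grad_\<phi>B n i j k x\<bar>
    \<le> (LBINT x. 1/24 * (phi R x * (du i k x)\<^sup>2) + 1 / R * (37660 * (B n i j x)\<^sup>2
     + 772 * ((s x)\<^sup>2 * (dB n i j k x)\<^sup>2) + 32 * ((s x)\<^sup>2 * (q x)\<^sup>2)))" (is "\<bar>LBINT x. ?f x\<bar> \<le> (LBINT x. ?g x)")
  proof (rule abs_integral_le)
    have "cc R (phi2 R j k)"
      by (rule cc_pd[OF cc_phi1[OF R0] pd_phi1 continuous_phi(3)])
    then show "integrable lborel ?f"
      by (intro cc_integrable[of R] cc_mult2 cc_add cc_mult1 cc_phi1 R0 B_cont \<sigma>_cont)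
    show "integrable lborel ?g"
      by (intro Bochner_Integration.integrable_add integrable_mult_right integrable_basic B_L2)
    fix x
    define d b e where "d = \<bar>du i k x\<bar>" and "b = \<bar>B n i j x\<bar>" and "e = \<bar>dB n i j k x\<bar>"
    have pos: "0 \<le> d" "0 \<le> b" "0 \<le> e" "0 \<le> q x" "0 \<le> s x" "s x \<le> 1"
      by (auto simp: d_def b_def e_def q_nonneg)
    have s2: "(s x)\<^sup>2 \<le> 1" using pos by (simp add: power_le_one)
    have "\<bar>\<sigma> i k x\<bar> \<le> d + q x"
      unfolding \<sigma>_def d_def using u_mult_le[of i x k] by linarith
    moreover have "\<bar>grad_\<phi>B n i j k x\<bar>
       \<le> 56 / R\<^sup>2 * (s x)\<^sup>2 * b + 8 / R * (s x ^ 3) * e"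
      unfolding b_def e_def
      by (rule order_trans[OF abs_triangle_ineq], unfold abs_mult)
         (intro add_mono mult_right_mono phi1_le phi2_le; simp)
    ultimately have "\<bar>\<sigma> i k x * grad_\<phi>B n i j k x\<bar>
       \<le> (d + q x) * (56 / R\<^sup>2 * (s x)\<^sup>2 * b + 8 / R * (s x ^ 3) * e)"
      unfolding abs_mult using pos by (intro mult_mono) auto
    also have "\<dots> = ((s x)\<^sup>2 * d) * (56 / R\<^sup>2 * b) + ((s x)\<^sup>2 * d) * (8 / R * (s x * e))
      + 56 / R\<^sup>2 * ((s x * q x) * (s x * b)) + 8 / R * ((s x * q x) * ((s x)\<^sup>2 * e))"
    proof -
      have "(d + q x) * (c1 * (s x)\<^sup>2 * b + c2 * (s x ^ 3) * e) = ((s x)\<^sup>2 * d) * (c1 * b) + ((s x)\<^sup>2 * d) * (c2 * (s x * e))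
        + c1 * ((s x * q x) * (s x * b)) + c2 * ((s x * q x) * ((s x)\<^sup>2 * e))" for c1 c2
        by (simp add: algebra_simps eval_nat_numeral)
      then show ?thesis .
    qed
    also have "\<dots> \<le> (1/48 * (phi R x * d\<^sup>2) + 37632 / R * b\<^sup>2) + (1/48 * (phi R x * d\<^sup>2) + 768 / R * ((s x)\<^sup>2 * e\<^sup>2))
      + 56 / R * (1/2 * ((s x)\<^sup>2 * (q x)\<^sup>2) + 1/2 * b\<^sup>2) + 8 / R * (1/2 * ((s x)\<^sup>2 * (q x)\<^sup>2) + 1/2 * ((s x)\<^sup>2 * e\<^sup>2))"
    proof (intro add_mono)
      have "((s x)\<^sup>2 * d) * (56 / R\<^sup>2 * b) \<le> 1/48 * ((s x)\<^sup>2 * d)\<^sup>2 + (56 / R\<^sup>2 * b)\<^sup>2 / (4 * (1/48))"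
        by (rule order_trans[OF abs_ge_self weighted_young]) simp
      also have "\<dots> = 1/48 * (phi R x * d\<^sup>2) + 37632 / R ^ 4 * b\<^sup>2"
        by (simp add: phi_def power_mult_distrib power_divide)
      also have "\<dots> \<le> 1/48 * (phi R x * d\<^sup>2) + 37632 / R * b\<^sup>2"
        using R by (intro add_left_mono mult_right_mono divide_left_mono self_le_power) auto
      finally show "((s x)\<^sup>2 * d) * (56 / R\<^sup>2 * b) \<le> 1/48 * (phi R x * d\<^sup>2) + 37632 / R * b\<^sup>2" .
      have "((s x)\<^sup>2 * d) * (8 / R * (s x * e)) \<le> 1/48 * ((s x)\<^sup>2 * d)\<^sup>2 + (8 / R * (s x * e))\<^sup>2 / (4 * (1/48))"
        by (rule order_trans[OF abs_ge_self weighted_young]) simp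
      also have "\<dots> = 1/48 * (phi R x * d\<^sup>2) + 768 / R\<^sup>2 * ((s x)\<^sup>2 * e\<^sup>2)"
        by (simp add: phi_def power_mult_distrib power_divide)
      also have "\<dots> \<le> 1/48 * (phi R x * d\<^sup>2) + 768 / R * ((s x)\<^sup>2 * e\<^sup>2)"
        by (intro add_left_mono mult_right_mono inverse_R_sq) auto
      finally show "((s x)\<^sup>2 * d) * (8 / R * (s x * e)) \<le> 1/48 * (phi R x * d\<^sup>2) + 768 / R * ((s x)\<^sup>2 * e\<^sup>2)" .
      have "(s x * q x) * (s x * b) \<le> 1/2 * (s x * q x)\<^sup>2 + (s x * b)\<^sup>2 / (4 * (1/2))"
        by (rule order_trans[OF abs_ge_self weighted_young]) simp
      also have "\<dots> \<le> 1/2 * ((s x)\<^sup>2 * (q x)\<^sup>2) + 1/2 * b\<^sup>2"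
        using mult_right_mono[OF s2, of "b\<^sup>2"] by (simp add: power_mult_distrib)
      finally have *: "(s x * q x) * (s x * b) \<le> 1/2 * ((s x)\<^sup>2 * (q x)\<^sup>2) + 1/2 * b\<^sup>2" .
      show "56 / R\<^sup>2 * ((s x * q x) * (s x * b)) \<le> 56 / R * (1/2 * ((s x)\<^sup>2 * (q x)\<^sup>2) + 1/2 * b\<^sup>2)"
        by (intro mult_mono inverse_R_sq *) (use pos R0 in auto)
      have "(s x * q x) * ((s x)\<^sup>2 * e) \<le> 1/2 * (s x * q x)\<^sup>2 + ((s x)\<^sup>2 * e)\<^sup>2 / (4 * (1/2))"
        by (rule order_trans[OF abs_ge_self weighted_young]) simp
      also have "((s x)\<^sup>2 * e)\<^sup>2 = (s x)\<^sup>2 * ((s x)\<^sup>2 * e\<^sup>2)" by (simp add: power2_eq_square)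
      also have "\<dots> \<le> 1 * ((s x)\<^sup>2 * e\<^sup>2)" by (intro mult_right_mono s2) auto
      finally have *: "(s x * q x) * ((s x)\<^sup>2 * e) \<le> 1/2 * ((s x)\<^sup>2 * (q x)\<^sup>2) + 1/2 * ((s x)\<^sup>2 * e\<^sup>2)"
        by (simp add: power_mult_distrib)
      show "8 / R * ((s x * q x) * ((s x)\<^sup>2 * e)) \<le> 8 / R * (1/2 * ((s x)\<^sup>2 * (q x)\<^sup>2) + 1/2 * ((s x)\<^sup>2 * e\<^sup>2))"
        by (intro mult_left_mono *) (use R0 in auto)
    qed
    also have "\<dots> = ?g x"
      unfolding d_def b_def e_def power2_abs using R0 by (simp add: field_simps)
    finally show "\<bar>?f x\<bar>
      \<le> ?g x" .
  qed
  then show ?thesis by (simp add: integrable_basic B_L2)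
qed

section \<open>Local energy, mass and fourth moment\<close>

definition E :: real where "E = (\<Sum>i\<in>UNIV. \<Sum>k\<in>UNIV. DU i k)"
definition T :: real where "T = (LBINT x. (s x)\<^sup>2 * q x)"
definition T2 :: real where "T2 = (LBINT x. (s x)\<^sup>2 * (q x)\<^sup>2)"

lemma T_sum: "T = (\<Sum>i\<in>UNIV. UU i)"
proof -
  have "T = (LBINT x. (\<Sum>i\<in>UNIV. (s x)\<^sup>2 * (u i x)\<^sup>2))"
    by (simp add: T_def q_def sum_distrib_left)
  also have "\<dots> = (\<Sum>i\<in>UNIV. UU i)"
    by (rule Bochner_Integration.integral_sum) (rule integrable_basic)
  finally show ?thesis .
qed

text \<open>The Laplacian of \<open>B n i j\<close> is d_j v_i - d_i v_j, so Caccioppoli's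
  inequality applies with a = v_i and b = v_j: the gradient of \<open>B\<close> costs only the mass
  of v_n at the same scale and the uniform bound \<open>K\<close>.\<close>

lemma dB_bound:
  "(\<Sum>k\<in>UNIV. DB n i j k)
    \<le> 8 * VV n i + 8 * VV n j + 200 * K"
proof -
  have "(\<Sum>k\<in>UNIV. DB n i j k)
    \<le> 8 * VV n i + 8 * VV n j
      + 200 / R * BB n i j"
    by (rule gradient_estimate[OF R, where l=j and m=i and da="dv n i j" and db="dv n j i"
          and ?V2.0="\<lambda>k. d2B n i j k k"]) (intro B_cont B_L2 B_pd v_cont v_pd lap_B)+
  also have "200 / R * BB n i j \<le> 200 * K"
    using R B_L2(2)[of n i j] by (intro mult_mono) (auto simp: divide_le_eq)
  finally show ?thesis by simp
qed

text \<open>Two shares of 1/8 of the energy are absorbed, which leaves 3/4. The numerals count index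
  pairs and triples: 402 = 9 * 2 + 3 * 128, 882 = 9 * 2 + 27 * 32, 37056 = 772 * 48 and 2406420 = 27
  * 37660 + 772 * 1800.\<close>

lemma energy_bound_n:
  "3 / 4 * E \<le> (\<Sum>i\<in>UNIV. \<bar>err n i\<bar>)
     + 1 / R * (402 * T + 882 * T2 + 37056 * (\<Sum>i\<in>UNIV. VV n i) + 2406420 * K)"
proof -
  define W where "W = (\<Sum>i\<in>UNIV. VV n i)"
  have i: "(\<Sum>i\<in>UNIV. \<Sum>k\<in>UNIV. 1/2 * UUU i k
         - (LBINT x. du i k x * (phi1 R k x * u i x))) \<le> 1/8 * E + 1 / R * (402 * T + 18 * T2)"
  proof -
    have "1/2 * UUU i k - (LBINT x. du i k x * (phi1 R k x * u i x))
       \<le> 2 / R * (T + T2) + 1/8 * DU i k + 128 / R * UU i" for i k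
    proof -
      have "4 / R * (T + T2) = 2 * (2 / R * (T + T2))" by simp
      then show ?thesis
        using term_a[of i k] term_b[of k i] unfolding T_def[symmetric] T2_def[symmetric] by linarith
    qed
    then have "(\<Sum>i\<in>UNIV. \<Sum>k\<in>UNIV. 1/2 * UUU i k
         - (LBINT x. du i k x * (phi1 R k x * u i x)))
      \<le> (\<Sum>i\<in>UNIV. \<Sum>k\<in>(UNIV::3 set). 2 / R * (T + T2) + 1/8 * DU i k + 128 / R * UU i)"
      by (intro sum_mono)
    also have "\<dots> = 18 / R * (T + T2) + 1/8 * E + 384 / R * T"
      by (simp add: sum.distrib sum_distrib_left[symmetric] sum_divide_distrib[symmetric] E_def T_sum[symmetric])
    also have "\<dots> = 1/8 * E + 1 / R * (402 * T + 18 * T2)"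
      using R0 by (simp add: field_simps)
    finally show ?thesis .
  qed
  have "- (\<Sum>i\<in>UNIV. \<Sum>j\<in>UNIV. \<Sum>k\<in>UNIV.
         LBINT x. \<sigma> i k x * grad_\<phi>B n i j k x)
     \<le> (\<Sum>i\<in>UNIV. \<Sum>j\<in>(UNIV::3 set). \<Sum>k\<in>UNIV. 1/24 * DU i k + 1 / R * (37660 * K
     + 772 * DB n i j k + 32 * T2))"
    unfolding sum_negf[symmetric]
  proof (intro sum_mono)
    fix i j k
    have "- (LBINT x. \<sigma> i k x * grad_\<phi>B n i j k x)
      \<le> 1/24 * DU i k + 1 / R * (37660 * BB n i j
     + 772 * DB n i j k + 32 * T2)"
      using term_c[of i k j n] unfolding T2_def by linarith
    also have "\<dots> \<le> 1/24 * DU i k + 1 / R * (37660 * K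
     + 772 * DB n i j k + 32 * T2)"
      using R0 B_L2(2)[of n i j] by (intro add_left_mono mult_left_mono add_right_mono) auto
    finally show "- (LBINT x. \<sigma> i k x * grad_\<phi>B n i j k x)
      \<le> 1/24 * DU i k + 1 / R * (37660 * K
     + 772 * DB n i j k + 32 * T2)" .
  qed
  also have "\<dots> = 1/8 * E + 1 / R * (1016820 * K + 864 * T2
     + 772 * (\<Sum>i\<in>UNIV. \<Sum>j\<in>UNIV. \<Sum>k\<in>UNIV. DB n i j k))"
    by (simp add: sum.distrib sum_distrib_left[symmetric] sum_divide_distrib[symmetric] E_def field_simps)
  also have "\<dots> \<le> 1/8 * E + 1 / R * (1016820 * K + 864 * T2 + 772 * (48 * W + 1800 * K))"
  proof -
    have "(\<Sum>i\<in>UNIV. \<Sum>j\<in>UNIV. \<Sum>k\<in>UNIV. DB n i j k)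
      \<le> (\<Sum>i\<in>UNIV. \<Sum>j\<in>UNIV. 8 * VV n i + 8 * VV n j + 200 * K)"
      by (intro sum_mono dB_bound)
    also have "\<dots> = 48 * W + 1800 * K"
      by (simp add: sum.distrib sum_distrib_left[symmetric] W_def)
    finally show ?thesis using R0 by (intro add_left_mono mult_left_mono) auto
  qed
  finally have ii: "- (\<Sum>i\<in>UNIV. \<Sum>j\<in>UNIV. \<Sum>k\<in>UNIV.
         LBINT x. \<sigma> i k x * grad_\<phi>B n i j k x)
     \<le> 1/8 * E + 1 / R * (864 * T2 + 37056 * W + 2406420 * K)"
    by (simp add: algebra_simps)
  have iii: "- (\<Sum>i\<in>UNIV. err n i)
     \<le> (\<Sum>i\<in>UNIV. \<bar>err n i\<bar>)"
    unfolding sum_negf[symmetric] by (intro sum_mono) linarith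
  have "E \<le> 1/8 * E + 1 / R * (402 * T + 18 * T2)
    + (\<Sum>i\<in>UNIV. \<bar>err n i\<bar>)
    + (1/8 * E + 1 / R * (864 * T2 + 37056 * W + 2406420 * K))"
    using i ii iii energy_identity[of n] unfolding E_def by linarith
  moreover have "1 / R * (402 * T + 18 * T2) + 1 / R * (864 * T2 + 37056 * W + 2406420 * K)
     = 1 / R * (402 * T + 882 * T2 + 37056 * W + 2406420 * K)" by (simp add: algebra_simps)
  ultimately show ?thesis unfolding W_def[symmetric] by linarith
qed

text \<open>The limit in n removes \<open>err\<close>, the last trace of the pressure, and turns the
  mass of v_n into that of u, whence 37458 = 402 + 37056.\<close>

lemma energy_bound: "3 / 4 * E \<le> 1 / R * (37458 * T + 882 * T2 + 2406420 * K)"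
proof (rule LIMSEQ_le_const)
  have 1: "(\<lambda>n. LBINT x. dP i x * phi R x * v n i x) \<longlonglongrightarrow> (LBINT x. dP i x * phi R x * u i x)" for i
    by (intro uniform_limit_integral_cc[where R=R, OF v_lim] cc_mult2 cc_phi R0 P_cont v_cont u_cont)
  have 2: "(\<lambda>n. VV n i) \<longlonglongrightarrow> UU i" for i
    by (intro uniform_limit_integral_cc[where R=R, OF uniform_limit_square[OF v_lim u_cont(1)]] cc_s2 continuous_intros v_cont u_cont)
  have "(\<lambda>n. (\<Sum>i\<in>UNIV. \<bar>err n i\<bar>)
     + 1 / R * (402 * T + 882 * T2 + 37056 * (\<Sum>i\<in>UNIV. VV n i) + 2406420 * K))
    \<longlonglongrightarrow> (\<Sum>i\<in>(UNIV::3 set). \<bar>(LBINT x. dP i x * phi R x * u i x) - (LBINT x. dP i x * phi R x * u i x)\<bar>)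
     + 1 / R * (402 * T + 882 * T2 + 37056 * (\<Sum>i\<in>UNIV. UU i) + 2406420 * K)"
    by (intro tendsto_intros 1 2)
  then show "(\<lambda>n. (\<Sum>i\<in>UNIV. \<bar>err n i\<bar>)
     + 1 / R * (402 * T + 882 * T2 + 37056 * (\<Sum>i\<in>UNIV. VV n i) + 2406420 * K))
    \<longlonglongrightarrow> 1 / R * (37458 * T + 882 * T2 + 2406420 * K)"
    by (simp add: T_sum[symmetric])
qed (use energy_bound_n in blast)

text \<open>Writing v_n as the divergence of \<open>B\<close> and integrating by parts puts the
  derivative on \<phi>u, so the mass is paid by the L^2 norm of \<open>B\<close> and the local
  energy. The free parameter \<mu> stands in for the Cauchy-Schwarz inequality and is chosen in
  \<open>T_half\<close>.\<close>

lemma mass_bound_n: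
  assumes "\<mu> > 0"
  shows "(\<Sum>i\<in>UNIV. LBINT x. phi R x * u i x * v n i x) \<le> 9 / \<mu> * K + \<mu> * (384 / R * T + 6 * E)"
proof -
  note cont = u_cont B_cont continuous_phi
  have i: "integrable lborel (\<lambda>x. phi R x * u i x * dB n i j j x)" for i j
    by (intro cc_integrable[of R] cc_mult1 cc_phi R0 cont)
  have "(\<Sum>i\<in>UNIV. LBINT x. phi R x * u i x * v n i x)
     = (\<Sum>i\<in>UNIV. LBINT x. (\<Sum>j\<in>UNIV. phi R x * u i x * dB n i j j x))"
    by (simp add: sum_distrib_left[symmetric] div_B)
  also have "\<dots> = (\<Sum>i\<in>UNIV. \<Sum>j\<in>UNIV. LBINT x. phi R x * u i x * dB n i j j x)"
    by (simp add: Bochner_Integration.integral_sum i)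
  also have "\<dots> \<le> (\<Sum>i\<in>UNIV. \<Sum>j\<in>UNIV. 1 / \<mu> * K
       + \<mu> * (128 / R * UU i + 2 * DU i j))"
  proof (intro sum_mono)
    fix i j
    have "(LBINT x. dB n i j j x * (phi R x * u i x))
       = - (LBINT x. B n i j x * (phi1 R j x * u i x + phi R x * du i j x))"
      by (rule integral_by_parts_pd[where R=R, OF _ pd_phi_u]) (intro cc_mult1 cc_phi R0 continuous_intros cont B_pd)+
    then have "(LBINT x. phi R x * u i x * dB n i j j x)
       \<le> \<bar>LBINT x. B n i j x * (phi1 R j x * u i x + phi R x * du i j x)\<bar>"
      by (simp add: mult_ac)
    also have "\<dots> \<le> (LBINT x. 1 / \<mu> * (B n i j x)\<^sup>2 + \<mu> * (128 / R * ((s x)\<^sup>2 * (u i x)\<^sup>2) + 2 * (phi R x * (du i j x)\<^sup>2)))" (is "_ \<le> (LBINT x. ?g x)")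
    proof (rule abs_integral_le)
      show "integrable lborel (\<lambda>x. B n i j x * (phi1 R j x * u i x + phi R x * du i j x))"
        by (intro cc_integrable[of R] cc_mult2 cc_add cc_mult1 cc_phi1 cc_phi R0 cont)
      show "integrable lborel ?g"
        by (intro Bochner_Integration.integrable_add integrable_mult_right integrable_basic B_L2)
      fix x
      have s1: "0 \<le> s x" "s x \<le> 1" by auto
      have "\<bar>phi1 R j x\<bar> \<le> 8 / R * s x"
      proof -
        have "s x ^ 3 \<le> s x ^ 1" by (intro power_decreasing) auto
        then show ?thesis using R0 by (intro order_trans[OF phi1_le] mult_left_mono) auto
      qed
      then have "(phi1 R j x)\<^sup>2 \<le> (8 / R * s x)\<^sup>2"
        using R0 by (simp add: abs_le_square_iff[symmetric])
      then have 1: "(phi1 R j x * u i x)\<^sup>2 \<le> (8 / R * s x)\<^sup>2 * (u i x)\<^sup>2"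
        unfolding power_mult_distrib[of "phi1 R j x"] by (rule mult_right_mono) simp
      have "(phi R x)\<^sup>2 \<le> phi R x ^ 1"
        by (intro power_decreasing) (auto simp: phi_def power_le_one)
      then have 2: "(phi R x * du i j x)\<^sup>2 \<le> phi R x * (du i j x)\<^sup>2"
        unfolding power_mult_distrib by (intro mult_right_mono) auto
      have "(8 / R * s x)\<^sup>2 * (u i x)\<^sup>2 = 64 / R\<^sup>2 * ((s x)\<^sup>2 * (u i x)\<^sup>2)"
        by (simp add: power_mult_distrib power_divide)
      also have "\<dots> \<le> 64 / R * ((s x)\<^sup>2 * (u i x)\<^sup>2)"
        by (intro mult_right_mono inverse_R_sq) auto
      finally have 3: "(phi1 R j x * u i x)\<^sup>2 \<le> 64 / R * ((s x)\<^sup>2 * (u i x)\<^sup>2)"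
        using 1 by linarith
      have "\<bar>B n i j x * (phi1 R j x * u i x + phi R x * du i j x)\<bar>
         \<le> 1 / \<mu> * (B n i j x)\<^sup>2 + (phi1 R j x * u i x + phi R x * du i j x)\<^sup>2 / (4 * (1 / \<mu>))"
        using assms by (intro weighted_young) simp
      also have "\<dots> \<le> 1 / \<mu> * (B n i j x)\<^sup>2 + \<mu> * (phi1 R j x * u i x + phi R x * du i j x)\<^sup>2"
        using assms by simp
      also have "(phi1 R j x * u i x + phi R x * du i j x)\<^sup>2 \<le> 2 * (phi1 R j x * u i x)\<^sup>2 + 2 * (phi R x * du i j x)\<^sup>2"
        using sum_squares_bound[of "phi1 R j x * u i x" "phi R x * du i j x"] by (simp add: power2_sum)
      also have "\<dots> \<le> 128 / R * ((s x)\<^sup>2 * (u i x)\<^sup>2) + 2 * (phi R x * (du i j x)\<^sup>2)"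
        using 2 3 by simp
      finally show "\<bar>B n i j x * (phi1 R j x * u i x + phi R x * du i j x)\<bar>
        \<le> ?g x"
        using assms by simp
    qed
    also have "\<dots> = 1 / \<mu> * BB n i j
       + \<mu> * (128 / R * UU i + 2 * DU i j)"
      by (simp add: integrable_basic B_L2)
    also have "\<dots> \<le> 1 / \<mu> * K
       + \<mu> * (128 / R * UU i + 2 * DU i j)"
      using assms by (intro add_right_mono mult_left_mono B_L2) auto
    finally show "(LBINT x. phi R x * u i x * dB n i j j x) \<le> 1 / \<mu> * K
       + \<mu> * (128 / R * UU i + 2 * DU i j)" .
  qed
  also have "\<dots> = 9 / \<mu> * K + \<mu> * (384 / R * T + 2 * E)"
    by (simp add: sum.distrib sum_distrib_left[symmetric] sum_divide_distrib[symmetric] E_def T_sum field_simps)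
  also have "\<dots> \<le> 9 / \<mu> * K + \<mu> * (384 / R * T + 6 * E)"
  proof -
    have "0 \<le> E" by (auto simp: E_def phi_def intro!: sum_nonneg)
    then show ?thesis using assms by simp
  qed
  finally show ?thesis .
qed

end

end

section \<open>Vanishing of the velocity\<close>

text \<open>The set where \<open>f\<close> differs from 0 is open, and a nonempty open set is not
  negligible.\<close>

lemma AE_eq_0_continuous:
  fixes f :: "'a::euclidean_space \<Rightarrow> real"
  assumes "AE x in lborel. f x = 0" "continuous_on UNIV f"
  shows "f x = 0"
proof (rule ccontr)
  assume "f x \<noteq> 0"
  have "open {y. f y \<noteq> 0}"
    using open_Collect_neq[OF assms(2) continuous_on_const[of _ 0]] .
  moreover from this have "{y. f y \<noteq> 0} \<in> null_sets lborel"
    using assms(1) by (subst AE_iff_null_sets) auto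
  then have "negligible {y. f y \<noteq> 0}"
    by (simp add: negligible_iff_null_sets null_sets_completionI)
  ultimately show False
    using open_not_negligible \<open>f x \<noteq> 0\<close> by blast
qed

lemma cutoff_mono: "0 < R \<Longrightarrow> R \<le> R' \<Longrightarrow> cutoff R x \<le> cutoff R' x"
  unfolding cutoff_def
  by (intro max.mono order_refl diff_mono divide_left_mono power_mono) (auto intro!: sum_nonneg mult_pos_pos)

context ns_approx
begin

lemma K_nonneg: "0 \<le> K"
  using B_L2(2)[of 0 1 1] by (rule order_trans[rotated]) simp

section \<open>Growth of the local mass\<close>

definition L :: real where "L = (LBINT x. q x powr (p / 2))"

lemma L_nonneg: "0 \<le> L" by (simp add: L_def)

lemma q_Lp: "integrable lborel (\<lambda>x. q x powr (p / 2))"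
  using u_Lp by (simp add: q_def)

text \<open>Here the exponent enters: p / 2 \<ge> 2, so the square of q is below q where q \<le> 1
  and below the integrable power elsewhere.\<close>

lemma q_square_le: "(q x)\<^sup>2 \<le> q x + q x powr (p / 2)"
proof (cases "q x \<le> 1")
  case True
  then have "(q x)\<^sup>2 \<le> q x" using q_nonneg[of x] by (simp add: power2_eq_square mult_left_le)
  then show ?thesis by (simp add: add_increasing2)
next
  case False
  then have "q x powr 2 \<le> q x powr (p / 2)" using p by (intro powr_mono) auto
  then show ?thesis using False by (simp add: powr_numeral)
qed

lemma q_le: "q x \<le> 1 + q x powr (p / 2)"
proof (cases "q x \<le> 1")
  case False
  then have "q x powr 1 \<le> q x powr (p / 2)" using p by (intro powr_mono) auto
  then show ?thesis using False by simp
qed (simp add: add_increasing2)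

lemma cutoff_sq_le_1: "(cutoff R x)\<^sup>2 \<le> 1"
  by (simp add: power_le_one)

lemma T2_le: assumes "R \<ge> 1" shows "T2 R \<le> T R + L"
proof -
  have "T2 R \<le> (LBINT x. (cutoff R x)\<^sup>2 * q x + q x powr (p / 2))" (is "_ \<le> (LBINT x. ?g x)")
    unfolding T2_def[OF assms]
  proof (rule integral_mono)
    fix x
    have "(cutoff R x)\<^sup>2 * (q x)\<^sup>2 \<le> (cutoff R x)\<^sup>2 * (q x + q x powr (p / 2))"
      by (intro mult_left_mono q_square_le) simp
    also have "\<dots> \<le> (cutoff R x)\<^sup>2 * q x + 1 * q x powr (p / 2)"
      unfolding distrib_left by (intro add_left_mono mult_right_mono cutoff_sq_le_1) simp
    finally show "(cutoff R x)\<^sup>2 * (q x)\<^sup>2 \<le> ?g x" by simp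
  qed (intro integrable_basic[OF assms] Bochner_Integration.integrable_add q_Lp)+
  then show ?thesis
    by (simp add: T_def[OF assms] L_def integrable_basic[OF assms] q_Lp)
qed

text \<open>The start of the iteration: where the speed exceeds 1 the mass is controlled by
  \<open>L\<close>, elsewhere by the volume of the ball.\<close>

lemma T_le_cube: "\<exists>C\<ge>1. \<forall>R\<ge>1. T R \<le> C * R ^ 3"
proof (intro exI conjI allI impI)
  define C where "C = unit_ball_vol 3 + L + 1"
  show "1 \<le> C" using L_nonneg unit_ball_vol_nonneg[of 3] by (simp add: C_def)
  fix R :: real assume R: "1 \<le> R"
  have "T R \<le> (LBINT x. indicator (cball (0::real^3) R) x + q x powr (p / 2))" (is "_ \<le> (LBINT x. ?g x)")
    unfolding T_def[OF R]
  proof (rule integral_mono)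
    show "integrable lborel (\<lambda>x. indicat_real (cball (0::real^3) R) x + q x powr (p / 2))"
      by (intro Bochner_Integration.integrable_add q_Lp, rule integrable_real_indicator)
         (simp, rule emeasure_bounded_finite, simp)
    fix x :: "real^3"
    show "(cutoff R x)\<^sup>2 * q x \<le> indicator (cball 0 R) x + q x powr (p / 2)"
    proof (cases "norm x \<le> R")
      case True
      have "(cutoff R x)\<^sup>2 * q x \<le> 1 * q x" by (intro mult_right_mono cutoff_sq_le_1 q_nonneg)
      then show ?thesis using True q_le[of x] by simp
    next
      case False
      then show ?thesis using R by (simp add: cutoff_eq_0)
    qed
  qed (rule integrable_basic[OF R])
  also have "\<dots> = measure lborel (cball (0::real^3) R) + L"
  proof -
    have "integrable lborel (indicat_real (cball (0::real^3) R))"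
      by (rule integrable_real_indicator) (simp, rule emeasure_bounded_finite, simp)
    then show ?thesis by (simp add: q_Lp L_def)
  qed
  also have "measure lborel (cball (0::real^3) R) = unit_ball_vol 3 * R ^ 3"
    using content_cball[of R "0::real^3"] R by (simp add: measure_completion)
  also have "unit_ball_vol 3 * R ^ 3 + L \<le> C * R ^ 3"
  proof -
    have "L * 1 \<le> L * R ^ 3" using L_nonneg R by (intro mult_left_mono one_le_power) auto
    moreover have "0 \<le> R ^ 3" using R by simp
    ultimately show ?thesis unfolding C_def distrib_right by linarith
  qed
  finally show "T R \<le> C * R ^ 3" .
qed

lemma T_nonneg: "R \<ge> 1 \<Longrightarrow> 0 \<le> T R"
  by (simp add: T_def q_nonneg)

text \<open>Energy bound and mass bound are combined on the ball of doubled radius, where the cutoff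
  is bounded below on the smaller one. The choice \<mu> = 1 / sqrt X makes both terms of the mass
  bound multiples of sqrt X.\<close>

lemma T_half: "\<exists>C\<ge>0. \<forall>R\<ge>1. T R \<le> C * sqrt ((1 + T (2 * R)) / R)"
proof (intro exI conjI allI impI)
  \<comment> \<open>4/3 of the constants of \<open>energy_bound\<close> after replacing
    \<open>T2\<close> by \<open>T\<close> plus \<open>L\<close>: 51120 = 4/3 * (37458 + 882), 1176 =
    4/3 * 882 and 3208560 = 4/3 * 2406420.\<close>
  define C1 where "C1 = 51120 + 1176 * L + 3208560 * K"
  define C2 where "C2 = 9 * K + 384 + 6 * C1"
  have C1: "C1 \<ge> 0" using K_nonneg L_nonneg by (simp add: C1_def)
  have C2: "C2 \<ge> 0" using C1 K_nonneg by (simp add: C2_def)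
  show "0 \<le> 4 * C2" using C2 by simp
  fix R :: real assume R: "R \<ge> 1"
  define r where "r = 2 * R"
  have r: "r \<ge> 1" using R by (simp add: r_def)
  define X where "X = (1 + T r) / r"
  have X: "X > 0" using T_nonneg[OF r] r by (auto simp: X_def intro!: divide_pos_pos)
  have "4 / 3 * (37458 * T r + 882 * T2 r + 2406420 * K) \<le> C1 * (1 + T r)"
  proof -
    have "51120 * T r \<le> C1 * T r"
      using K_nonneg L_nonneg T_nonneg[OF r] by (intro mult_right_mono) (auto simp: C1_def)
    then show ?thesis
      using T2_le[OF r] K_nonneg L_nonneg T_nonneg[OF r] unfolding distrib_left mult_1_right
      by (simp add: C1_def)
  qed
  then have "1 / r * (4 / 3 * (37458 * T r + 882 * T2 r + 2406420 * K)) \<le> 1 / r * (C1 * (1 + T r))"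
    using r by (intro mult_left_mono) auto
  then have E: "E r \<le> C1 * X"
  proof -
    define Y where "Y = 37458 * T r + 882 * T2 r + 2406420 * K"
    assume *: "1 / r * (4 / 3 * (37458 * T r + 882 * T2 r + 2406420 * K)) \<le> 1 / r * (C1 * (1 + T r))"
    have "e \<le> 4 / 3 * z" if "3 / 4 * e \<le> z" for e z :: real using that by simp
    from this[OF energy_bound[OF r, folded Y_def]] have "E r \<le> 4 / 3 * (1 / r * Y)" .
    also have "\<dots> = 1 / r * (4 / 3 * Y)" by simp
    also have "\<dots> \<le> 1 / r * (C1 * (1 + T r))" using * by (simp add: Y_def)
    also have "\<dots> = C1 * X" by (simp add: X_def)
    finally show ?thesis .
  qed
  have M: "(\<Sum>i\<in>UNIV. LBINT x. phi r x * u i x * u i x) \<le> 9 / \<mu> * K + \<mu> * (384 / r * T r + 6 * E r)" if "\<mu> > 0" for \<mu>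
  proof (rule LIMSEQ_le_const2)
    show "(\<lambda>n. \<Sum>i\<in>UNIV. LBINT x. phi r x * u i x * v n i x) \<longlonglongrightarrow> (\<Sum>i\<in>UNIV. LBINT x. phi r x * u i x * u i x)"
      using r by (intro tendsto_sum uniform_limit_integral_cc[where R=r, OF v_lim] cc_mult1 cc_phi v_cont u_cont) simp
  qed (use mass_bound_n[OF r that] in blast)
  have "384 / r * T r \<le> 384 * X"
    using r by (simp add: X_def field_simps)
  then have "384 / r * T r + 6 * E r \<le> (384 + 6 * C1) * X"
    using E by (simp add: algebra_simps)
  then have "1 / sqrt X * (384 / r * T r + 6 * E r) \<le> 1 / sqrt X * ((384 + 6 * C1) * X)"
    using X by (intro mult_left_mono) auto
  also have "\<dots> = (384 + 6 * C1) * sqrt X"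
  proof -
    have "1 / sqrt X * (c * X) = c * (X / sqrt X)" for c by simp
    then show ?thesis using X by (simp add: real_div_sqrt del: times_divide_eq_right)
  qed
  finally have M': "(\<Sum>i\<in>UNIV. LBINT x. phi r x * u i x * u i x) \<le> C2 * sqrt X"
    using M[of "1 / sqrt X"] X by (simp add: C2_def algebra_simps)
  have i: "integrable lborel (\<lambda>x. phi r x * q x)" "\<And>i. integrable lborel (\<lambda>x. phi r x * u i x * u i x)"
    using r by (intro cc_integrable[of r] cc_mult1 cc_phi q_cont u_cont; simp)+
  have "T R \<le> (LBINT x. 4 * (phi r x * q x))" (is "_ \<le> (LBINT x. ?g x)")
    unfolding T_def[OF R]
  proof (rule integral_mono)
    show "integrable lborel (\<lambda>x. (cutoff R x)\<^sup>2 * q x)" by (rule integrable_basic[OF R])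
    show "integrable lborel ?g" using i by simp
    fix x
    have "(cutoff R x)\<^sup>2 \<le> 4 * phi r x"
    proof (cases "norm x \<le> R")
      case True
      then have "3 / 4 \<le> cutoff r x" using R by (intro cutoff_ge) (auto simp: r_def)
      \<comment> \<open>(3/4)^4 exceeds 1/4, whence the factor 4.\<close>
      then have "(3 / 4) ^ 4 \<le> phi r x" unfolding phi_def by (intro power_mono) auto
      then show ?thesis using cutoff_sq_le_1[of R x] by (simp add: eval_nat_numeral)
    next
      case False
      then show ?thesis using R by (simp add: cutoff_eq_0 phi_def)
    qed
    then show "(cutoff R x)\<^sup>2 * q x \<le> ?g x"
      using mult_right_mono[OF _ q_nonneg[of x]] by fastforce
  qed
  also have "\<dots> = 4 * (LBINT x. phi r x * q x)" by simp
  also have "(\<lambda>x. phi r x * q x) = (\<lambda>x. \<Sum>i\<in>UNIV. phi r x * u i x * u i x)"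
    by (simp add: q_def power2_eq_square sum_distrib_left mult.assoc)
  also have "4 * (LBINT x. (\<Sum>i\<in>UNIV. phi r x * u i x * u i x))
      = 4 * (\<Sum>i\<in>UNIV. LBINT x. phi r x * u i x * u i x)"
    by (simp add: i)
  also have "\<dots> \<le> 4 * C2 * sqrt X" using M' by simp
  also have "\<dots> \<le> 4 * C2 * sqrt ((1 + T (2 * R)) / R)"
  proof (intro mult_left_mono real_sqrt_le_mono)
    show "X \<le> (1 + T (2 * R)) / R"
      unfolding X_def r_def[symmetric] using R T_nonneg[OF r] by (intro divide_left_mono) (auto simp: r_def)
  qed (use C2 in simp)
  finally show "T R \<le> 4 * C2 * sqrt ((1 + T (2 * R)) / R)" .
qed

text \<open>For a \<ge> 0, growth R^a of the mass is improved by \<open>T_half\<close> to R^((a - 1)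
  / 2). The exponents run through 3, 1, 0, -1/2, and since the mass increases with the radius, the
  last one forces it to be 0.\<close>

lemma T_eq_0: assumes "R \<ge> 1" shows "T R = 0"
proof -
  obtain C where C: "C \<ge> 0" "\<And>R. R \<ge> 1 \<Longrightarrow> T R \<le> C * sqrt ((1 + T (2 * R)) / R)"
    using T_half by blast
  obtain C0 where C0: "C0 \<ge> 1" "\<And>R. R \<ge> 1 \<Longrightarrow> T R \<le> C0 * R ^ 3"
    using T_le_cube by blast
  have step1: "T R \<le> (C * sqrt (9 * C0)) * R" if R: "R \<ge> 1" for R
  proof -
    have "1 \<le> C0 * R ^ 3"
      using C0(1) R mult_mono[of 1 C0 1 "R ^ 3"] by (simp add: one_le_power)
    moreover have "T (2 * R) \<le> 8 * (C0 * R ^ 3)"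
      using C0(2)[of "2 * R"] R by (simp add: power_mult_distrib)
    ultimately have "(1 + T (2 * R)) / R \<le> 9 * C0 * R\<^sup>2"
      using R by (simp add: divide_le_eq eval_nat_numeral)
    then have "sqrt ((1 + T (2 * R)) / R) \<le> sqrt (9 * C0 * R\<^sup>2)" by simp
    also have "\<dots> = sqrt (9 * C0) * R" using R by (simp add: real_sqrt_mult)
    finally have "C * sqrt ((1 + T (2 * R)) / R) \<le> C * (sqrt (9 * C0) * R)"
      using C(1) by (intro mult_left_mono)
    then show ?thesis using C(2)[OF R] by simp
  qed
  define C4 where "C4 = C * sqrt (9 * C0)"
  have C4: "C4 \<ge> 0" using C C0 by (simp add: C4_def)
  have step2: "T R \<le> C * sqrt (1 + 2 * C4)" if R: "R \<ge> 1" for R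
  proof -
    have "T (2 * R) \<le> C4 * (2 * R)" using step1[of "2 * R"] R by (simp add: C4_def)
    then have "(1 + T (2 * R)) / R \<le> 1 + 2 * C4"
      using R by (simp add: divide_le_eq algebra_simps)
    then have "C * sqrt ((1 + T (2 * R)) / R) \<le> C * sqrt (1 + 2 * C4)"
      using C(1) by (intro mult_left_mono) auto
    then show ?thesis using C(2)[OF R] by simp
  qed
  define C5 where "C5 = C * sqrt (1 + 2 * C4)"
  have step3: "T r \<le> C * sqrt ((1 + C5) / r)" if r: "r \<ge> 1" for r
  proof -
    have "T (2 * r) \<le> C5" using step2[of "2 * r"] r by (simp add: C5_def)
    then have "C * sqrt ((1 + T (2 * r)) / r) \<le> C * sqrt ((1 + C5) / r)"
      using C(1) r by (intro mult_left_mono) (auto intro!: divide_right_mono)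
    then show ?thesis using C(2)[OF r] by simp
  qed
  have "((\<lambda>r. C * sqrt ((1 + C5) / r)) \<longlongrightarrow> C * sqrt 0) at_top"
    by (intro tendsto_intros real_tendsto_divide_at_top[OF tendsto_const] filterlim_ident)
  moreover have "\<forall>\<^sub>F r in at_top. T R \<le> C * sqrt ((1 + C5) / r)"
    using eventually_ge_at_top[of R]
  proof eventually_elim
    case (elim r)
    then have r: "r \<ge> 1" using assms by simp
    have "T R \<le> T r"
      unfolding T_def[OF assms] T_def[OF r]
    proof (rule integral_mono)
      fix x
      show "(cutoff R x)\<^sup>2 * q x \<le> (cutoff r x)\<^sup>2 * q x"
        by (intro mult_right_mono power_mono cutoff_mono q_nonneg) (use assms elim in auto)
    qed (intro integrable_basic[OF assms] integrable_basic[OF r])+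
    then show ?case using step3[OF r] by simp
  qed
  ultimately have "T R \<le> C * sqrt 0"
    by (intro tendsto_le[OF _ _ tendsto_const]) auto
  then show ?thesis using T_nonneg[OF assms] by simp
qed

theorem u_eq_0: "u i x = 0"
proof -
  define R where "R = 2 * norm x + 1"
  have R: "R \<ge> 1" by (simp add: R_def)
  have "(LBINT x. (cutoff R x)\<^sup>2 * q x) = 0"
    using T_eq_0[OF R] T_def[OF R] by simp
  then have "AE x in lborel. (cutoff R x)\<^sup>2 * q x = 0"
    by (subst (asm) integral_nonneg_eq_0_iff_AE) (auto intro: integrable_basic[OF R] simp: q_nonneg)
  then have "(cutoff R x)\<^sup>2 * q x = 0"
    by (rule AE_eq_0_continuous) (intro continuous_intros q_cont)
  moreover have "3 / 4 \<le> cutoff R x"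
    using R norm_ge_zero[of x] by (intro cutoff_ge) (linarith, simp add: R_def)
  ultimately have "q x = 0" by auto
  then show ?thesis using u_sq_le[of i x] by simp
qed

end

section \<open>Smooth functions of compact support on the line\<close>

text \<open>The derivative is existentially quantified, so closure under sums, products and affine
  substitutions is an induction on witnesses.\<close>

primrec smooth_k :: "nat \<Rightarrow> (real \<Rightarrow> complex) \<Rightarrow> bool" where
  "smooth_k 0 f \<longleftrightarrow> continuous_on UNIV f"
| "smooth_k (Suc k) f \<longleftrightarrow> (\<exists>f'. (\<forall>t. (f has_vector_derivative f' t) (at t)) \<and> smooth_k k f')"

lemma smooth_k_SucD: "smooth_k (Suc k) f \<Longrightarrow> smooth_k k f"
proof (induction k arbitrary: f)
  case 0
  then show ?case by (auto simp: continuous_on_eq_continuous_within intro: has_vector_derivative_continuous)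
qed auto

lemma smooth_k_const: "smooth_k k (\<lambda>t. c)"
proof (induction k arbitrary: c)
  case (Suc k)
  then show ?case by (auto intro!: exI[of _ "\<lambda>t. 0"])
qed auto

lemma smooth_k_add: "smooth_k k f \<Longrightarrow> smooth_k k g \<Longrightarrow> smooth_k k (\<lambda>t. f t + g t)"
proof (induction k arbitrary: f g)
  case (Suc k)
  from Suc.prems obtain f' g' where "\<forall>t. (f has_vector_derivative f' t) (at t)" "smooth_k k f'"
     "\<forall>t. (g has_vector_derivative g' t) (at t)" "smooth_k k g'" by auto
  with Suc.IH show ?case
    by (auto intro!: exI[of _ "\<lambda>t. f' t + g' t"] derivative_intros)
qed (auto intro!: continuous_intros)

lemma smooth_k_mult: "smooth_k k f \<Longrightarrow> smooth_k k g \<Longrightarrow> smooth_k k (\<lambda>t. f t * g t)"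
proof (induction k arbitrary: f g)
  case (Suc k)
  from Suc.prems obtain f' g' where *: "\<forall>t. (f has_vector_derivative f' t) (at t)" "smooth_k k f'"
     "\<forall>t. (g has_vector_derivative g' t) (at t)" "smooth_k k g'" by auto
  have "smooth_k k (\<lambda>t. f t * g' t + f' t * g t)"
    using Suc * by (intro smooth_k_add Suc.IH) (blast intro: smooth_k_SucD)+
  moreover have "\<forall>t. ((\<lambda>t. f t * g t) has_vector_derivative f t * g' t + f' t * g t) (at t)"
    using * by (auto intro!: has_vector_derivative_mult)
  ultimately show ?case by auto
qed (auto intro!: continuous_intros)

lemma smooth_k_of_real: "smooth_k k (\<lambda>t. of_real t)"
proof (cases k)
  case (Suc k')
  have "\<forall>t. ((\<lambda>t. complex_of_real t) has_vector_derivative 1) (at t)"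
    by (intro allI has_vector_derivative_of_real[OF DERIV_ident, unfolded of_real_1])
  then show ?thesis
    unfolding Suc smooth_k.simps using smooth_k_const[of k' 1] by (intro exI[of _ "\<lambda>t. 1"]) blast
qed (auto intro!: continuous_intros)

lemma cis_has_vector_derivative:
  "((\<lambda>t. cis (a * t)) has_vector_derivative (\<i> * a * cis (a * t))) (at t)"
proof -
  have "((\<lambda>t. exp (\<i> * of_real (a * t))) has_vector_derivative (\<i> * a * exp (\<i> * of_real (a * t)))) (at t)"
  proof -
    have 1: "((\<lambda>t. \<i> * of_real (a * t)) has_vector_derivative (\<i> * a)) (at t)"
    proof -
      have "((\<lambda>t. complex_of_real (a * t)) has_vector_derivative of_real a) (at t)"
        by (intro has_vector_derivative_of_real) (auto intro!: derivative_eq_intros simp: has_real_derivative_iff_has_vector_derivative[symmetric])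
      then show ?thesis by (rule has_vector_derivative_mult_right)
    qed
    have "(exp has_field_derivative exp (\<i> * of_real (a * t))) (at (\<i> * of_real (a * t)))"
      by (rule DERIV_exp)
    from field_vector_diff_chain_at[OF 1 this] show ?thesis by (simp add: comp_def)
  qed
  then show ?thesis by (simp add: cis_conv_exp)
qed

lemma smooth_k_cis: "smooth_k k (\<lambda>t. c * cis (a * t))"
proof (induction k arbitrary: c)
  case (Suc k)
  have "\<forall>t. ((\<lambda>t. c * cis (a * t)) has_vector_derivative (c * \<i> * a) * cis (a * t)) (at t)"
    using has_vector_derivative_mult_right[OF cis_has_vector_derivative] by (simp add: mult.assoc)
  with Suc show ?case by auto
qed (auto intro!: continuous_intros)

lemma smooth_k_affine: "smooth_k k f \<Longrightarrow> smooth_k k (\<lambda>t. f (a * t + b))"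
proof (induction k arbitrary: f)
  case 0
  then show ?case by (auto intro!: continuous_intros continuous_on_compose2[of UNIV f])
next
  case (Suc k)
  from Suc.prems obtain f' where f': "\<forall>t. (f has_vector_derivative f' t) (at t)" "smooth_k k f'" by auto
  have "((\<lambda>t. f (a * t + b)) has_vector_derivative of_real a * f' (a * t + b)) (at t)" for t
  proof -
    have "((\<lambda>t. a * t + b) has_vector_derivative a) (at t)"
      by (auto intro!: derivative_eq_intros simp: has_real_derivative_iff_has_vector_derivative[symmetric])
    from vector_diff_chain_at[OF this f'(1)[rule_format]] show ?thesis
      by (simp add: comp_def scaleR_conv_of_real)
  qed
  moreover have "smooth_k k (\<lambda>t. of_real a * f' (a * t + b))"
    by (intro smooth_k_mult smooth_k_const Suc.IH f')
  ultimately show ?case by (intro smooth_k.simps(2)[THEN iffD2] exI conjI allI)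
qed

section \<open>Functions flat at the origin\<close>

definition flat :: "real poly \<Rightarrow> real \<Rightarrow> real" where
  "flat q t = (if t > 0 then poly q (1 / t) * exp (- (1 / t)) else 0)"

lemma poly_exp_tendsto_0: "((\<lambda>u. poly q u * exp (- u)) \<longlongrightarrow> 0) at_top" for q :: "real poly"
proof -
  have "((\<lambda>u. \<Sum>i\<le>degree q. coeff q i * (u ^ i / exp u)) \<longlongrightarrow> (\<Sum>i\<le>degree q. coeff q i * 0)) at_top"
    by (intro tendsto_intros tendsto_power_div_exp_0)
  then show ?thesis
    by (simp add: poly_altdef exp_minus sum_distrib_right divide_inverse mult.assoc)
qed

lemma flat_tendsto_0: "(flat q \<longlongrightarrow> 0) (at_right 0)"
proof -
  have "((\<lambda>t. poly q (1 / t) * exp (- (1 / t))) \<longlongrightarrow> 0) (at_right 0)"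
    using filterlim_compose[OF poly_exp_tendsto_0 filterlim_inverse_at_top_right]
    by (simp add: divide_inverse)
  then show ?thesis
    by (rule Lim_transform_eventually) (auto simp: flat_def eventually_at_filter)
qed

text \<open>The family is closed under differentiation: with u = 1 / t, the derivative in t is -u^2
  times that in u, and the exponential contributes -q beside q'. At 0, division by h multiplies the
  polynomial by its variable, so the difference quotient again belongs to the family and tends to
  0.\<close>

lemma flat_has_derivative: "(flat q has_real_derivative flat ([:0, 0, 1:] * (q - pderiv q)) t) (at t)"
proof -
  consider "t > 0" | "t < 0" | "t = 0" by linarith
  then show ?thesis
  proof cases
    case 1
    have "((\<lambda>t. poly q (1 / t) * exp (- (1 / t))) has_real_derivative
       flat ([:0, 0, 1:] * (q - pderiv q)) t) (at t)"
      using 1 by (auto intro!: derivative_eq_intros DERIV_chain2[OF poly_DERIV] simp: flat_def field_simps power2_eq_square)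
    moreover have "\<forall>\<^sub>F x in nhds t. poly q (1 / x) * exp (- (1 / x)) = flat q x"
      using eventually_nhds_in_open[of "{0<..}" t] 1 by (auto simp: flat_def elim!: eventually_mono)
    ultimately show ?thesis by (subst (asm) DERIV_cong_ev[OF refl _ refl])
  next
    case 2
    have "((\<lambda>t. 0) has_real_derivative flat ([:0, 0, 1:] * (q - pderiv q)) t) (at t)"
      using 2 by (auto simp: flat_def)
    moreover have "\<forall>\<^sub>F x in nhds t. 0 = flat q x"
      using eventually_nhds_in_open[of "{..<0}" t] 2 by (auto simp: flat_def elim!: eventually_mono)
    ultimately show ?thesis by (subst (asm) DERIV_cong_ev[OF refl _ refl])
  next
    case 3
    have "((\<lambda>h. flat q h / h) \<longlongrightarrow> 0) (at_right 0)"
      by (rule Lim_transform_eventually[OF flat_tendsto_0[of "[:0, 1:] * q"]])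
         (auto simp: flat_def eventually_at_filter)
    moreover have "((\<lambda>h. flat q h / h) \<longlongrightarrow> 0) (at_left 0)"
      by (rule tendsto_eventually) (auto simp: flat_def eventually_at_filter)
    ultimately have "((\<lambda>h. flat q h / h) \<longlongrightarrow> 0) (at 0)"
      by (simp add: filterlim_split_at)
    then show ?thesis using 3 by (simp add: DERIV_def flat_def)
  qed
qed

lemma smooth_k_flat: "smooth_k k (\<lambda>t. of_real (flat q t))"
proof (induction k arbitrary: q)
  case 0
  have "continuous_on UNIV (flat q)"
    by (rule DERIV_continuous_on) (use flat_has_derivative in \<open>blast intro: has_field_derivative_at_within\<close>)
  then show ?case by (auto intro!: continuous_intros)
next
  case (Suc k)
  have "\<forall>t. ((\<lambda>t. complex_of_real (flat q t)) has_vector_derivative of_real (flat ([:0, 0, 1:] * (q - pderiv q)) t)) (at t)"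
    using flat_has_derivative by (auto intro!: has_vector_derivative_of_real)
  with Suc show ?case by auto
qed

text \<open>Test functions of one variable. Their products over the coordinates are the test
  functions on which the Fourier transform of the velocity is evaluated.\<close>

definition bumps :: "(real \<Rightarrow> complex) set" where
  "bumps = {f. (\<forall>k. smooth_k k f) \<and> (\<exists>a. \<forall>t. a < \<bar>t\<bar> \<longrightarrow> f t = 0)}"

lemma bumps_mult2: "f \<in> bumps \<Longrightarrow> (\<And>k. smooth_k k g) \<Longrightarrow> (\<lambda>t. g t * f t) \<in> bumps"
  by (auto simp: bumps_def intro!: smooth_k_mult)

lemma bumps_scale:
  assumes "f \<in> bumps" "c \<noteq> 0"
  shows "(\<lambda>t. f (c * t)) \<in> bumps"
proof -
  obtain a where a: "\<And>t. a < \<bar>t\<bar> \<Longrightarrow> f t = 0" using assms by (auto simp: bumps_def)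
  have "f (c * t) = 0" if "a / \<bar>c\<bar> < \<bar>t\<bar>" for t
    using that assms(2) by (intro a) (simp add: abs_mult field_simps)
  then show ?thesis
    using assms smooth_k_affine[of _ f c 0] by (auto simp: bumps_def)
qed

lemma bumps_derivative:
  assumes "f \<in> bumps"
  obtains f' where "\<And>t. (f has_vector_derivative f' t) (at t)" "f' \<in> bumps"
proof -
  \<comment> \<open>Every order k supplies its own derivative function; fixing
    \<open>vector_derivative\<close> beforehand lets uniqueness identify all of them.\<close>
  define f' where "f' t = vector_derivative f (at t)" for t
  have f': "(f has_vector_derivative f' t) (at t)" and s: "smooth_k k f'" for t k
  proof -
    have "smooth_k (Suc k) f" using assms unfolding bumps_def by blast
    then obtain d where d: "\<And>t. (f has_vector_derivative d t) (at t)" "smooth_k k d" by auto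
    then have "f' = d" by (auto simp: f'_def vector_derivative_at)
    with d show "(f has_vector_derivative f' t) (at t)" "smooth_k k f'" by auto
  qed
  obtain a where a: "\<And>t. a < \<bar>t\<bar> \<Longrightarrow> f t = 0" using assms by (auto simp: bumps_def)
  have "f' t = 0" if t: "a < \<bar>t\<bar>" for t
  proof -
    have "\<forall>\<^sub>F x in nhds t. a < \<bar>x\<bar>"
    proof -
      have "open {x::real. a < \<bar>x\<bar>}" by (intro open_Collect_less continuous_intros)
      from eventually_nhds_in_open[OF this, of t] t show ?thesis by simp
    qed
    then have "\<forall>\<^sub>F x in nhds t. f x = 0" by (rule eventually_mono) (rule a)
    then have "((\<lambda>x. 0) has_vector_derivative f' t) (at t)"
      using has_vector_derivative_cong_ev[where x=t and S=UNIV and f=f and g="\<lambda>x. 0"] f'[of t] a[OF t]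
      by simp
    then show ?thesis using vector_derivative_at by force
  qed
  with s have "f' \<in> bumps" unfolding bumps_def by blast
  with f' that show ?thesis by blast
qed

lemma bumps_continuous: "f \<in> bumps \<Longrightarrow> continuous_on UNIV f"
  unfolding bumps_def using smooth_k.simps(1) by blast

lemma bumps_bounded_support: "f \<in> bumps \<Longrightarrow> \<exists>a>0. \<forall>t. a < \<bar>t\<bar> \<longrightarrow> f t = 0"
proof -
  assume "f \<in> bumps"
  then obtain a where "\<And>t. a < \<bar>t\<bar> \<Longrightarrow> f t = 0" by (auto simp: bumps_def)
  then show ?thesis by (intro exI[of _ "max a 1"]) auto
qed

lemma bumps_integrable: "f \<in> bumps \<Longrightarrow> integrable lborel f"
proof -
  assume f: "f \<in> bumps"
  obtain a where a: "a > 0" "\<And>t. a < \<bar>t\<bar> \<Longrightarrow> f t = 0" using bumps_bounded_support[OF f] by blast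
  have "integrable lborel (\<lambda>t. indicator {-a..a} t *\<^sub>R f t)"
    using bumps_continuous[OF f] by (intro borel_integrable_compact) (auto intro: continuous_on_subset)
  moreover have "(\<lambda>t. indicator {-a..a} t *\<^sub>R f t) = f"
    using a(2) by (auto simp: fun_eq_iff indicator_def not_le)
  ultimately show ?thesis by simp
qed

lemma bumps_integral_derivative:
  assumes "f \<in> bumps" "\<And>t. (f has_vector_derivative f' t) (at t)" "f' \<in> bumps"
  shows "(LBINT t. f' t) = 0"
proof -
  obtain a where a: "a > 0" "\<And>t. a < \<bar>t\<bar> \<Longrightarrow> f t = 0" using bumps_bounded_support[OF assms(1)] by blast
  obtain b where b: "b > 0" "\<And>t. b < \<bar>t\<bar> \<Longrightarrow> f' t = 0" using bumps_bounded_support[OF assms(3)] by blast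
  define c where "c = max a b + 1"
  have c: "c > 0" using a by (simp add: c_def)
  have "(LBINT t. indicator {-c..c} t *\<^sub>R f' t) = f c - f (- c)"
    using c assms bumps_continuous[OF assms(3)]
    by (intro integral_FTC_atLeastAtMost) (auto intro: continuous_on_subset has_vector_derivative_at_within)
  moreover have "(LBINT t. indicator {-c..c} t *\<^sub>R f' t) = (LBINT t. f' t)"
  proof (rule Bochner_Integration.integral_cong[OF refl])
    fix t show "indicator {-c..c} t *\<^sub>R f' t = f' t"
    proof (cases "\<bar>t\<bar> \<le> c")
      case True
      then show ?thesis by (simp add: indicator_def abs_le_iff)
    next
      case False
      then have "f' t = 0" by (intro b(2)) (simp add: c_def)
      then show ?thesis by simp
    qed
  qed
  moreover have "f c = 0" "f (- c) = 0" by (auto intro!: a(2) simp: c_def)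
  ultimately show ?thesis by (metis diff_self)
qed

section \<open>The Fourier transform on the line\<close>

definition ft :: "(real \<Rightarrow> complex) \<Rightarrow> real \<Rightarrow> complex" where
  "ft f s = (CLBINT t. cis (- (s * t)) * f t)"

lemma bumps_cis: "f \<in> bumps \<Longrightarrow> (\<lambda>t. cis (- (s * t)) * f t) \<in> bumps"
  using smooth_k_cis[of _ 1 "- s"] by (intro bumps_mult2) simp_all

text \<open>Integrate the derivative of cis (-st) f(t), which has integral 0.\<close>

lemma ft_derivative_mult:
  assumes f: "f \<in> bumps" and f': "\<And>t. (f has_vector_derivative f' t) (at t)" "f' \<in> bumps"
  shows "ft f' s = \<i> * s * ft f s"
proof -
  have d: "((\<lambda>t. cis (- (s * t)) * f t) has_vector_derivative
      cis (- (s * t)) * f' t + (- \<i> * s) * (cis (- (s * t)) * f t)) (at t)" for t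
    using has_vector_derivative_mult[OF cis_has_vector_derivative[of "- s" t] f'(1)[of t]]
    by (simp add: mult_ac)
  have b: "(\<lambda>t. cis (- (s * t)) * f' t + (- \<i> * s) * (cis (- (s * t)) * f t)) \<in> bumps"
  proof -
    obtain g where g: "\<And>t. ((\<lambda>t. cis (- (s * t)) * f t) has_vector_derivative g t) (at t)" "g \<in> bumps"
      using bumps_derivative[OF bumps_cis[OF f, of s]] by blast
    have "g = (\<lambda>t. cis (- (s * t)) * f' t + (- \<i> * s) * (cis (- (s * t)) * f t))"
      by (rule ext) (rule vector_derivative_unique_at[OF g(1) d])
    with g(2) show ?thesis by simp
  qed
  have "(CLBINT t. cis (- (s * t)) * f' t + (- \<i> * s) * (cis (- (s * t)) * f t)) = 0"
    by (rule bumps_integral_derivative[OF bumps_cis[OF f] d b])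
  moreover have "integrable lborel (\<lambda>t. cis (- (s * t)) * f' t)" "integrable lborel (\<lambda>t. cis (- (s * t)) * f t)"
    by (intro bumps_integrable bumps_cis f f')+
  ultimately have "ft f' s + (- \<i> * s) * ft f s = 0"
    unfolding ft_def by (simp del: mult_minus_left)
  then show ?thesis by simp
qed

lemma ft_bound: "norm (ft f s) \<le> (LBINT t. norm (f t))"
  unfolding ft_def by (rule order_trans[OF integral_norm_bound]) (simp add: norm_mult)

lemma ft_power_bound: "f \<in> bumps \<Longrightarrow> \<exists>C. \<forall>s. \<bar>s\<bar> ^ n * norm (ft f s) \<le> C"
proof (induction n arbitrary: f)
  case 0
  then show ?case using ft_bound by auto
next
  case (Suc n)
  obtain f' where f': "\<And>t. (f has_vector_derivative f' t) (at t)" "f' \<in> bumps"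
    using bumps_derivative[OF Suc.prems] by blast
  from Suc.IH[OF f'(2)] obtain C where "\<And>s. \<bar>s\<bar> ^ n * norm (ft f' s) \<le> C" by blast
  then have "\<bar>s\<bar> ^ Suc n * norm (ft f s) \<le> C" for s
    using ft_derivative_mult[OF Suc.prems f'] by (simp add: norm_mult mult_ac)
  then show ?case by blast
qed

text \<open>The cube is needed in \<open>G_tail\<close>, which spends one factor on integrability
  and two on decay in n. The inequality (1 + y)^3 \<le> 4 (1 + y^3) amounts to 3 (y - 1)^2 (y + 1)
  \<ge> 0.\<close>

lemma ft_decay: assumes "f \<in> bumps" shows "\<exists>C\<ge>0. \<forall>s. norm (ft f s) \<le> C / (1 + s\<^sup>2) ^ 3"
proof -
  obtain C0 where C0: "\<And>s. \<bar>s\<bar> ^ 0 * norm (ft f s) \<le> C0" using ft_power_bound[OF assms] by blast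
  obtain C6 where C6: "\<And>s. \<bar>s\<bar> ^ 6 * norm (ft f s) \<le> C6" using ft_power_bound[OF assms] by blast
  have "norm (ft f s) \<le> 4 * (C0 + C6) / (1 + s\<^sup>2) ^ 3" for s
  proof -
    have "(1 + s\<^sup>2) ^ 3 \<le> 4 * (1 + \<bar>s\<bar> ^ 6)"
    proof -
      define y where "y = s\<^sup>2"
      have y: "y \<ge> 0" by (simp add: y_def)
      have "0 \<le> 3 * ((y - 1)\<^sup>2 * (y + 1))" using y by simp
      also have "\<dots> = 4 * (1 + y ^ 3) - (1 + y) ^ 3" by (simp add: algebra_simps eval_nat_numeral)
      finally have "(1 + y) ^ 3 \<le> 4 * (1 + y ^ 3)" by simp
      moreover have "y ^ 3 = \<bar>s\<bar> ^ 6" by (simp add: y_def power_mult[symmetric] power_even_abs)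
      ultimately show ?thesis by (simp add: y_def)
    qed
    then have "(1 + s\<^sup>2) ^ 3 * norm (ft f s) \<le> 4 * (1 + \<bar>s\<bar> ^ 6) * norm (ft f s)"
      by (intro mult_right_mono) auto
    also have "\<dots> \<le> 4 * (C0 + C6)" using C0[of s] C6[of s] by (simp add: algebra_simps)
    finally show ?thesis by (simp add: pos_le_divide_eq mult.commute add_pos_nonneg)
  qed
  moreover have "0 \<le> 4 * (C0 + C6)"
  proof -
    have "0 \<le> C0" using C0[of 0] norm_ge_zero[of "ft f 0"] by (simp del: norm_ge_zero)
    moreover have "0 \<le> C6" using C6[of 0] by simp
    ultimately show ?thesis by simp
  qed
  ultimately show ?thesis by blast
qed

lemma cis_diff_le: "norm (cis a - cis b) \<le> \<bar>a - b\<bar>"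
proof -
  have "cis a - cis b = cis b * (cis (a - b) - 1)"
    by (simp add: algebra_simps cis_mult)
  then have "norm (cis a - cis b) = norm (cis (a - b) - 1)" by (simp add: norm_mult)
  also have "\<dots> \<le> \<bar>a - b\<bar>"
    using iexp_approx1[of "a - b" 0] by (simp add: cis_conv_exp)
  finally show ?thesis .
qed

lemma has_vector_derivative_iff_lim:
  fixes f :: "real \<Rightarrow> 'a::real_normed_vector"
  shows "(f has_vector_derivative d) (at t) \<longleftrightarrow> ((\<lambda>h. (f (t + h) - f t) /\<^sub>R h) \<longlongrightarrow> d) (at 0)"
proof -
  have "norm (f (t + h) - f t - h *\<^sub>R d) / \<bar>h\<bar> = norm ((f (t + h) - f t) /\<^sub>R h - d)" if "h \<noteq> 0" for h
  proof -
    have "f (t + h) - f t - h *\<^sub>R d = h *\<^sub>R ((f (t + h) - f t) /\<^sub>R h - d)"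
      using that by (simp add: scaleR_right_diff_distrib)
    then show ?thesis using that by simp
  qed
  then have "((\<lambda>h. norm (f (t + h) - f t - h *\<^sub>R d) / \<bar>h\<bar>) \<longlongrightarrow> 0) (at 0)
     \<longleftrightarrow> ((\<lambda>h. norm ((f (t + h) - f t) /\<^sub>R h - d)) \<longlongrightarrow> 0) (at 0)"
    by (intro filterlim_cong refl) (auto simp: eventually_at_filter)
  then show ?thesis
    unfolding has_vector_derivative_def has_derivative_at
    by (simp add: bounded_linear_scaleR_left tendsto_norm_zero_iff LIM_zero_iff)
qed

text \<open>Differentiation under the integral: |cis a - cis b| \<le> |a - b| dominates the
  difference quotients by |w h|. The general measure and phase w serve both the transform on the
  line and the inverse transform in space.\<close>

lemma has_vector_derivative_integral_cis:
  fixes h :: "'a \<Rightarrow> complex" and w :: "'a \<Rightarrow> real"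
  assumes h: "integrable M h" and wh: "integrable M (\<lambda>y. w y * h y)" and [measurable]: "w \<in> borel_measurable M"
  shows "((\<lambda>t. \<integral>y. cis (t * w y) * h y \<partial>M) has_vector_derivative (\<integral>y. cis (t * w y) * (\<i> * (w y * h y)) \<partial>M)) (at t)"
proof -
  define F where "F t = (\<integral>y. cis (t * w y) * h y \<partial>M)" for t
  have [measurable]: "h \<in> borel_measurable M" using h by auto
  have [measurable]: "cis \<in> borel_measurable borel" by (intro borel_measurable_continuous_onI continuous_intros)
  have i: "integrable M (\<lambda>y. cis (t * w y) * h y)" for t
    by (rule Bochner_Integration.integrable_bound[OF h]) (auto simp: norm_mult)
  have "((\<lambda>s. (F (t + s) - F t) /\<^sub>R s) \<longlongrightarrow> (\<integral>y. cis (t * w y) * (\<i> * (w y * h y)) \<partial>M)) (at 0)"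
    unfolding tendsto_at_iff_sequentially comp_def
  proof (intro allI impI)
    fix X :: "nat \<Rightarrow> real" assume X: "\<forall>i. X i \<in> UNIV - {0}" "X \<longlonglongrightarrow> 0"
    have eq: "(F (t + X n) - F t) /\<^sub>R X n = (\<integral>y. ((cis ((t + X n) * w y) - cis (t * w y)) /\<^sub>R X n) * h y \<partial>M)" for n
    proof -
      have "F (t + X n) - F t = (\<integral>y. (cis ((t + X n) * w y) - cis (t * w y)) * h y \<partial>M)"
        unfolding F_def left_diff_distrib by (rule Bochner_Integration.integral_diff[symmetric]) (rule i)+
      then show ?thesis by simp
    qed
    show "(\<lambda>n. (F (t + X n) - F t) /\<^sub>R X n) \<longlonglongrightarrow> (\<integral>y. cis (t * w y) * (\<i> * (w y * h y)) \<partial>M)"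
      unfolding eq
    proof (rule integral_dominated_convergence[where w="\<lambda>y. norm (w y * h y)"])
      show "integrable M (\<lambda>y. norm (w y * h y))" using wh by (rule integrable_norm)
      show "AE y in M. (\<lambda>n. ((cis ((t + X n) * w y) - cis (t * w y)) /\<^sub>R X n) * h y) \<longlonglongrightarrow> cis (t * w y) * (\<i> * (w y * h y))"
      proof (rule AE_I2)
        fix y
        have "((\<lambda>s. cis (w y * s)) has_vector_derivative (\<i> * w y * cis (w y * t))) (at t)"
          by (rule cis_has_vector_derivative)
        then have "((\<lambda>s. (cis (w y * (t + s)) - cis (w y * t)) /\<^sub>R s) \<longlongrightarrow> \<i> * w y * cis (w y * t)) (at 0)"
          by (simp only: has_vector_derivative_iff_lim)
        then have "(\<lambda>n. (cis (w y * (t + X n)) - cis (w y * t)) /\<^sub>R X n) \<longlonglongrightarrow> \<i> * w y * cis (w y * t)"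
          using X unfolding tendsto_at_iff_sequentially comp_def by blast
        from tendsto_mult[OF this tendsto_const[of "h y"]]
        show "(\<lambda>n. ((cis ((t + X n) * w y) - cis (t * w y)) /\<^sub>R X n) * h y) \<longlonglongrightarrow> cis (t * w y) * (\<i> * (w y * h y))"
          by (simp add: mult_ac)
      qed
      show "AE y in M. norm (((cis ((t + X n) * w y) - cis (t * w y)) /\<^sub>R X n) * h y) \<le> norm (w y * h y)" for n
      proof (rule AE_I2)
        fix y
        have "norm (cis ((t + X n) * w y) - cis (t * w y)) \<le> \<bar>X n\<bar> * \<bar>w y\<bar>"
          using cis_diff_le[of "(t + X n) * w y" "t * w y"] by (simp add: algebra_simps abs_mult)
        then have "norm ((cis ((t + X n) * w y) - cis (t * w y)) /\<^sub>R X n) \<le> \<bar>w y\<bar>"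
        proof -
          assume "norm (cis ((t + X n) * w y) - cis (t * w y)) \<le> \<bar>X n\<bar> * \<bar>w y\<bar>"
          then have "inverse \<bar>X n\<bar> * norm (cis ((t + X n) * w y) - cis (t * w y)) \<le> inverse \<bar>X n\<bar> * (\<bar>X n\<bar> * \<bar>w y\<bar>)"
            by (intro mult_left_mono) auto
          moreover have "X n \<noteq> 0" using X(1) by auto
          ultimately show ?thesis by (simp add: mult.assoc[symmetric])
        qed
        then show "norm (((cis ((t + X n) * w y) - cis (t * w y)) /\<^sub>R X n) * h y) \<le> norm (w y * h y)"
          unfolding norm_mult by (simp add: mult_right_mono del: norm_scaleR)
      qed
    qed measurable
  qed
  then show ?thesis
    unfolding F_def[symmetric] has_vector_derivative_iff_lim .
qed

lemma ft_has_vector_derivative: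
  assumes f: "f \<in> bumps"
  shows "(ft f has_vector_derivative ft (\<lambda>t. - (\<i> * t) * f t) s) (at s)"
proof -
  have "(\<lambda>t. complex_of_real (- t) * f t) \<in> bumps"
    using smooth_k_mult[OF smooth_k_const[of _ "-1"] smooth_k_of_real] by (intro bumps_mult2 f) simp
  from has_vector_derivative_integral_cis[of lborel f uminus s] bumps_integrable[OF f] bumps_integrable[OF this]
  show ?thesis unfolding ft_def[abs_def] by (simp add: mult.assoc)
qed

section \<open>Gaussians and Plancherel's inequality\<close>

lemma prod_Basis_cart:
  fixes x :: "real^'n::finite" and f :: "real^'n \<Rightarrow> real \<Rightarrow> 'b::comm_monoid_mult"
  shows "(\<Prod>b\<in>Basis. f b (x \<bullet> b)) = (\<Prod>i\<in>UNIV. f (axis i 1) (x $ i))"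
proof -
  have "inj (\<lambda>i::'n. axis i (1::real))" by (auto simp: inj_on_def axis_eq_axis)
  moreover have "Basis = range (\<lambda>i::'n. axis i (1::real))" by (auto simp: Basis_vec_def)
  ultimately show ?thesis
    by (rule prod.reindex_cong) (simp add: inner_axis)
qed

text \<open>Lebesgue measure on the space is the image of a product measure indexed by the basis
  vectors; \<open>the_inv\<close> carries the factors from coordinate indices to basis
  vectors.\<close>

lemma integral_lborel_prod_cart:
  fixes f :: "'n::finite \<Rightarrow> real \<Rightarrow> complex"
  assumes f: "\<And>i. integrable lborel (f i)"
  shows "integrable lborel (\<lambda>x::real^'n. \<Prod>i\<in>UNIV. f i (x $ i))"
    and "integral\<^sup>L lborel (\<lambda>x::real^'n. \<Prod>i\<in>UNIV. f i (x $ i)) = (\<Prod>i\<in>UNIV. LBINT t. f i t)"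
proof -
  define g :: "real^'n \<Rightarrow> real \<Rightarrow> complex" where "g b = f (the_inv (\<lambda>i. axis i (1::real)) b)" for b
  have inj: "inj (\<lambda>i::'n. axis i (1::real))" by (auto simp: inj_on_def axis_eq_axis)
  have g: "g (axis i 1) = f i" for i
    by (simp add: g_def the_inv_f_f[OF inj])
  have gi: "integrable lborel (g b)" for b by (simp add: g_def f)
  have [measurable]: "g b \<in> borel_measurable borel" for b
    using borel_measurable_integrable[OF gi[of b]] by simp
  interpret product_sigma_finite "\<lambda>b::real^'n. lborel :: real measure"
    by standard
  let ?T = "\<lambda>h::real^'n \<Rightarrow> real. \<Sum>b\<in>Basis. h b *\<^sub>R b"
  have T: "?T h \<bullet> b = h b" if "b \<in> Basis" for h and b :: "real^'n"
    using that by (simp add: inner_sum_left inner_Basis if_distrib cong: if_cong)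
  have [measurable]: "?T \<in> borel_measurable (\<Pi>\<^sub>M b\<in>Basis. lborel)" by measurable
  have fg: "(\<Prod>i\<in>UNIV. f i (x $ i)) = (\<Prod>b\<in>Basis. g b (x \<bullet> b))" for x :: "real^'n"
    unfolding prod_Basis_cart g ..
  have meas: "(\<lambda>x::real^'n. \<Prod>b\<in>Basis. g b (x \<bullet> b)) \<in> borel_measurable borel"
    by measurable
  have eq: "(\<Prod>b\<in>Basis. g b (?T h \<bullet> b)) = (\<Prod>b\<in>Basis. g b (h b))" for h
    by (intro prod.cong refl) (simp add: T)
  show "integrable lborel (\<lambda>x::real^'n. \<Prod>i\<in>UNIV. f i (x $ i))"
    unfolding fg
    by (subst lborel_eq, subst integrable_distr_eq[OF _ meas], measurable)
       (unfold eq, intro product_integrable_prod finite_Basis gi)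
  have "integral\<^sup>L lborel (\<lambda>x::real^'n. \<Prod>i\<in>UNIV. f i (x $ i)) = (\<integral>h. (\<Prod>b\<in>Basis. g b (h b)) \<partial>(\<Pi>\<^sub>M b\<in>(Basis::(real^'n) set). lborel))"
    unfolding fg by (subst lborel_eq, subst integral_distr[OF _ meas], measurable)
  also have "\<dots> = (\<Prod>b\<in>(Basis::(real^'n) set). LBINT t. g b t)"
    by (intro product_integral_prod finite_Basis gi)
  also have "\<dots> = (\<Prod>i\<in>UNIV. LBINT t. f i t)"
    using prod_Basis_cart[of "\<lambda>b _. LBINT t. g b t" "0::real^'n"] by (simp add: g)
  finally show "integral\<^sup>L lborel (\<lambda>x::real^'n. \<Prod>i\<in>UNIV. f i (x $ i)) = (\<Prod>i\<in>UNIV. LBINT t. f i t)" .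
qed

lemma integral_lborel_prod_cart_real:
  fixes f :: "'n::finite \<Rightarrow> real \<Rightarrow> real"
  assumes f: "\<And>i. integrable lborel (f i)"
  shows "integrable lborel (\<lambda>x::real^'n. \<Prod>i\<in>UNIV. f i (x $ i))"
    and "integral\<^sup>L lborel (\<lambda>x::real^'n. \<Prod>i\<in>UNIV. f i (x $ i)) = (\<Prod>i\<in>UNIV. LBINT t. f i t)"
proof -
  have i: "integrable lborel (\<lambda>t. complex_of_real (f i t))" for i
    using f by (rule integrable_of_real)
  from integral_lborel_prod_cart(1)[of "\<lambda>i t. complex_of_real (f i t)", OF i]
  show 1: "integrable lborel (\<lambda>x::real^'n. \<Prod>i\<in>UNIV. f i (x $ i))"
    unfolding of_real_prod[symmetric] complex_of_real_integrable_eq .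
  from integral_lborel_prod_cart(2)[of "\<lambda>i t. complex_of_real (f i t)", OF i]
  show "integral\<^sup>L lborel (\<lambda>x::real^'n. \<Prod>i\<in>UNIV. f i (x $ i)) = (\<Prod>i\<in>UNIV. LBINT t. f i t)"
    unfolding of_real_prod[symmetric] integral_complex_of_real of_real_eq_iff .
qed

lemma measurable_cis [measurable]: "cis \<in> borel_measurable borel"
  by (intro borel_measurable_continuous_onI continuous_intros)

lemma measurable_cnj [measurable]: "cnj \<in> borel_measurable borel"
  by (intro borel_measurable_continuous_onI continuous_intros)

section \<open>Gaussians and Fourier inversion at the origin\<close>

definition gauss :: "real \<Rightarrow> real \<Rightarrow> real" where
  "gauss d s = exp (- (d\<^sup>2 * s\<^sup>2 / 2))"

lemma measurable_gauss [measurable]: "gauss d \<in> borel_measurable borel"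
  unfolding gauss_def[abs_def] by measurable

lemma gauss_std: "gauss d s = sqrt (2 * pi) * std_normal_density (d * s)"
  by (simp add: gauss_def std_normal_density_def power_mult_distrib)

lemma gauss_integrable: assumes "d > 0" shows "integrable lborel (gauss d)"
proof -
  have "integrable lborel (\<lambda>s. std_normal_density (0 + d * s))"
    using assms by (intro lborel_integrable_real_affine) auto
  then show ?thesis unfolding gauss_std[abs_def] by simp
qed

text \<open>A rescaling of the characteristic function of the standard normal law. Since
  \<open>gauss\<close> has value 1 at 0, it tends to 1 as d tends to 0 while its transform
  concentrates at the origin.\<close>

lemma ft_gauss:
  assumes "d > 0"
  shows "(CLBINT s. cis (s * t) * gauss d s) = complex_of_real (2 * pi * normal_density 0 d t)"
proof -
  have "char std_normal_distribution (t / d) = (\<integral>x. cis (t / d * x) \<partial>std_normal_distribution)"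
    by (simp add: char_def cis_conv_exp)
  also have "\<dots> = (CLBINT x. std_normal_density x *\<^sub>R cis (t / d * x))"
    by (subst integral_density) auto
  finally have c: "(CLBINT x. std_normal_density x *\<^sub>R cis (t / d * x)) = exp (- ((t / d)\<^sup>2 / 2))"
    using char_std_normal_distribution by (simp add: fun_eq_iff exp_of_real)
  have "(CLBINT x. std_normal_density x *\<^sub>R cis (t / d * x))
      = \<bar>d\<bar> *\<^sub>R (CLBINT s. std_normal_density (0 + d * s) *\<^sub>R cis (t / d * (0 + d * s)))"
    using assms by (intro lborel_integral_real_affine) auto
  also have "\<dots> = d *\<^sub>R (CLBINT s. std_normal_density (d * s) *\<^sub>R cis (s * t))"
    using assms by (simp add: mult.commute)
  finally have c2: "d *\<^sub>R (CLBINT s. std_normal_density (d * s) *\<^sub>R cis (s * t)) = exp (- ((t / d)\<^sup>2 / 2))"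
    using c by simp
  have "(CLBINT s. cis (s * t) * gauss d s) = (CLBINT s. sqrt (2 * pi) *\<^sub>R (std_normal_density (d * s) *\<^sub>R cis (s * t)))"
    by (simp add: gauss_std scaleR_conv_of_real mult_ac)
  also have "\<dots> = sqrt (2 * pi) *\<^sub>R (CLBINT s. std_normal_density (d * s) *\<^sub>R cis (s * t))"
    by (rule integral_scaleR_right)
  also have "(CLBINT s. std_normal_density (d * s) *\<^sub>R cis (s * t)) = complex_of_real (exp (- ((t / d)\<^sup>2 / 2)) / d)"
    using c2 assms by (simp add: scaleR_conv_of_real field_simps)
  also have "sqrt (2 * pi) *\<^sub>R complex_of_real (exp (- ((t / d)\<^sup>2 / 2)) / d) = complex_of_real (2 * pi * normal_density 0 d t)"
  proof -
    have "sqrt (2 * pi) * (exp (- ((t / d)\<^sup>2 / 2)) / d) = 2 * pi * normal_density 0 d t"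
      using assms real_sqrt_mult_self[of "2 * pi"]
      by (simp add: normal_density_def power_divide real_sqrt_mult field_simps)
    then show ?thesis by (metis of_real_mult scaleR_conv_of_real)
  qed
  finally show ?thesis .
qed

lemma gauss_le_1: "gauss d s \<le> 1" and gauss_nonneg: "0 \<le> gauss d s"
  by (auto simp: gauss_def)

lemma gauss_tendsto_1: "(\<lambda>n. gauss (1 / real (Suc n)) s) \<longlonglongrightarrow> 1"
proof -
  have "(\<lambda>n. exp (- ((1 / real (Suc n))\<^sup>2 * s\<^sup>2 / 2))) \<longlonglongrightarrow> exp (- (0\<^sup>2 * s\<^sup>2 / 2))"
    by (intro tendsto_intros LIMSEQ_Suc[OF lim_1_over_n]) auto
  then show ?thesis by (simp add: gauss_def)
qed

text \<open>Fourier inversion at a single point. A Gaussian factor permits Fubini and turns the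
  integral into 2 pi times the average of f under a normal law of width \<open>d n\<close>; both
  sides converge as the width shrinks.\<close>

lemma integral_ft:
  fixes f :: "real \<Rightarrow> complex"
  assumes f: "f \<in> bumps"
  shows "integrable lborel (ft f)" and "(LBINT s. ft f s) = 2 * pi * f 0"
proof -
  have fi: "integrable lborel f" by (rule bumps_integrable[OF f])
  have [measurable]: "f \<in> borel_measurable borel"
    using fi by auto
  have fc: "continuous_on UNIV (ft f)"
    unfolding continuous_on_eq_continuous_within
    using ft_has_vector_derivative[OF f] has_vector_derivative_continuous by blast
  then have [measurable]: "ft f \<in> borel_measurable borel"
    by (rule borel_measurable_continuous_onI)
  obtain C where C: "C \<ge> 0" "\<And>s. norm (ft f s) \<le> C / (1 + s\<^sup>2) ^ 3" using ft_decay[OF f] by blast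
  show int: "integrable lborel (ft f)"
  proof (rule Bochner_Integration.integrable_bound)
    show "integrable lborel (\<lambda>s. C * inverse (1 + s\<^sup>2))"
      using integrable_inverse_1_plus_square by (simp add: set_integrable_def)
    show "AE s in lborel. norm (ft f s) \<le> norm (C * inverse (1 + s\<^sup>2))"
    proof (rule AE_I2)
      fix s :: real
      have "C / (1 + s\<^sup>2) ^ 3 \<le> C / (1 + s\<^sup>2) ^ 1"
        using C by (intro divide_left_mono power_increasing) (auto intro!: mult_pos_pos add_pos_nonneg)
      then have "norm (ft f s) \<le> C / (1 + s\<^sup>2)"
        using order_trans[OF C(2)[of s]] by simp
      then show "norm (ft f s) \<le> norm (C * inverse (1 + s\<^sup>2))"
        using C(1) by (simp add: divide_inverse abs_mult)
    qed
  qed simp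
  define d where "d n = 1 / real (Suc n)" for n
  have d: "d n > 0" for n by (simp add: d_def)
  have eq: "(LBINT s. gauss (d n) s * ft f s) = (LBINT t. 2 * pi * (std_normal_density t *\<^sub>R f (d n * t)))" for n
  proof -
    have "(LBINT s. gauss (d n) s * ft f s) = (CLBINT s. (CLBINT t. gauss (d n) s * (cis (- (s * t)) * f t)))"
      unfolding ft_def by simp
    also have "\<dots> = (CLBINT t. (CLBINT s. gauss (d n) s * (cis (- (s * t)) * f t)))"
    proof (rule lborel_pair.Fubini_integral[symmetric])
      show "integrable (lborel \<Otimes>\<^sub>M lborel) (\<lambda>(s, t). gauss (d n) s * (cis (- (s * t)) * f t))"
      proof (rule lborel_pair.Fubini_integrable)
        show "(\<lambda>(s, t). complex_of_real (gauss (d n) s) * (cis (- (s * t)) * f t)) \<in> borel_measurable (lborel \<Otimes>\<^sub>M lborel)"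
          by measurable
        have "integrable lborel (\<lambda>s. gauss (d n) s * (LBINT t. norm (f t)))"
          using gauss_integrable[OF d] by simp
        then show "integrable lborel (\<lambda>s. LBINT t. norm (case (s, t) of (s, t) \<Rightarrow> complex_of_real (gauss (d n) s) * (cis (- (s * t)) * f t)))"
          by (simp add: norm_mult gauss_nonneg)
        show "AE s in lborel. integrable lborel (\<lambda>t. case (s, t) of (s, t) \<Rightarrow> complex_of_real (gauss (d n) s) * (cis (- (s * t)) * f t))"
          using bumps_integrable[OF bumps_cis[OF f]] by simp
      qed
    qed
    also have "\<dots> = (CLBINT t. (CLBINT s. cis (s * (- t)) * gauss (d n) s) * f t)"
      by (simp add: mult_ac flip: integral_mult_right_zero)
    also have "\<dots> = (CLBINT t. complex_of_real (2 * pi * normal_density 0 (d n) (- t)) * f t)"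
      by (simp only: ft_gauss[OF d])
    also have "\<dots> = (CLBINT t. complex_of_real (2 * pi * normal_density 0 (d n) t) * f t)"
      by (simp add: normal_density_def)
    also have "\<dots> = \<bar>d n\<bar> *\<^sub>R (CLBINT t. complex_of_real (2 * pi * normal_density 0 (d n) (0 + d n * t)) * f (0 + d n * t))"
      using d[of n] by (intro lborel_integral_real_affine) auto
    also have "\<dots> = (CLBINT t. d n *\<^sub>R (complex_of_real (2 * pi * normal_density 0 (d n) (d n * t)) * f (d n * t)))"
      using d[of n] by simp
    also have "\<dots> = (LBINT t. 2 * pi * (std_normal_density t *\<^sub>R f (d n * t)))"
    proof (intro Bochner_Integration.integral_cong refl)
      fix t
      have "d n * normal_density 0 (d n) (d n * t) = std_normal_density t"
        using d[of n] by (simp add: normal_density_def power_mult_distrib real_sqrt_mult)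
      then have "complex_of_real (d n) * complex_of_real (normal_density 0 (d n) (d n * t)) = complex_of_real (std_normal_density t)"
        by (metis of_real_mult)
      then show "d n *\<^sub>R (complex_of_real (2 * pi * normal_density 0 (d n) (d n * t)) * f (d n * t))
        = 2 * pi * (std_normal_density t *\<^sub>R f (d n * t))"
        by (simp add: scaleR_conv_of_real mult_ac)
    qed
    finally show ?thesis .
  qed
  have "(\<lambda>n. LBINT s. gauss (d n) s * ft f s) \<longlonglongrightarrow> (LBINT s. ft f s)"
  proof (rule integral_dominated_convergence[where w="\<lambda>s. norm (ft f s)"])
    show "AE s in lborel. (\<lambda>n. complex_of_real (gauss (d n) s) * ft f s) \<longlonglongrightarrow> ft f s" (is "AE s in lborel. ?P s")
    proof (rule AE_I2)
      fix s
      have "(\<lambda>n. complex_of_real (gauss (d n) s) * ft f s) \<longlonglongrightarrow> complex_of_real 1 * ft f s"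
        unfolding d_def by (intro tendsto_intros gauss_tendsto_1)
      then show "?P s" by simp
    qed
    show "AE s in lborel. norm (complex_of_real (gauss (d n) s) * ft f s) \<le> norm (ft f s)" for n
      by (simp add: norm_mult gauss_nonneg mult_left_le_one_le gauss_le_1)
  qed (use int in auto)
  moreover have "(\<lambda>n. LBINT t. 2 * pi * (std_normal_density t *\<^sub>R f (d n * t))) \<longlonglongrightarrow> (LBINT t. 2 * pi * (std_normal_density t *\<^sub>R f 0))"
  proof -
    have "bounded (range f)"
    proof -
      obtain a where a: "a > 0" "\<And>t. a < \<bar>t\<bar> \<Longrightarrow> f t = 0" using bumps_bounded_support[OF f] by blast
      have "bounded (f ` {-a..a})"
        by (intro compact_imp_bounded compact_continuous_image continuous_on_subset[OF bumps_continuous[OF f]]) auto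
      then have "bounded (insert 0 (f ` {-a..a}))" by simp
      moreover have "range f \<subseteq> insert 0 (f ` {-a..a})"
      proof safe
        fix t assume "f t \<notin> f ` {- a..a}"
        then have "t \<notin> {-a..a}" by blast
        then show "f t = 0" by (intro a(2)) auto
      qed
      ultimately show ?thesis by (rule bounded_subset)
    qed
    then obtain M where M: "\<And>t. norm (f t) \<le> M" by (auto simp: bounded_iff)
    show ?thesis
    proof (rule integral_dominated_convergence[where w="\<lambda>t. 2 * pi * (std_normal_density t * M)"])
      show "AE t in lborel. (\<lambda>n. 2 * pi * (std_normal_density t *\<^sub>R f (d n * t))) \<longlonglongrightarrow> 2 * pi * (std_normal_density t *\<^sub>R f 0)" (is "AE t in lborel. ?P t")
      proof (rule AE_I2)
        fix t
        have "(\<lambda>n. d n * t) \<longlonglongrightarrow> 0 * t"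
          unfolding d_def by (intro tendsto_intros LIMSEQ_Suc[OF lim_1_over_n])
        moreover have "isCont f 0" using bumps_continuous[OF f] by (simp add: continuous_on_eq_continuous_at)
        ultimately have "(\<lambda>n. f (d n * t)) \<longlonglongrightarrow> f 0" by (intro isCont_tendsto_compose[of 0 f]) auto
        then show "?P t"
          by (intro tendsto_intros)
      qed
      show "AE t in lborel. norm (2 * pi * (std_normal_density t *\<^sub>R f (d n * t))) \<le> 2 * pi * (std_normal_density t * M)" (is "AE t in lborel. ?P t") for n
      proof (rule AE_I2)
        fix t
        show "?P t"
          using mult_left_mono[OF M[of "d n * t"], of "std_normal_density t"] by (simp add: norm_mult mult.commute)
      qed
    qed auto
  qed
  moreover have "(LBINT t. 2 * pi * (std_normal_density t *\<^sub>R f 0)) = 2 * pi * f 0"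
  proof -
    have "(LBINT t. 2 * pi * (std_normal_density t *\<^sub>R f 0)) = 2 * pi * (LBINT t. std_normal_density t *\<^sub>R f 0)"
      by (rule integral_mult_right_zero)
    also have "(LBINT t. std_normal_density t *\<^sub>R f 0) = (LBINT t. std_normal_density t) *\<^sub>R f 0"
      by (rule integral_scaleR_left) auto
    finally show ?thesis by simp
  qed
  ultimately show "(LBINT s. ft f s) = 2 * pi * f 0"
    unfolding eq using LIMSEQ_unique by fastforce
qed

section \<open>Inverse Fourier integrals and their L^2 norm\<close>

lemma cis_sum: "cis (\<Sum>i\<in>A. f i) = (\<Prod>i\<in>A. cis (f i))"
  by (induction A rule: infinite_finite_induct) (auto simp: cis_mult[symmetric])

lemma cis_inner: "cis (x \<bullet> y) = (\<Prod>i\<in>UNIV. cis (x $ i * y $ i))" for x y :: "real^'n::finite"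
  by (simp add: inner_vec_def cis_sum)

text \<open>No power of 2 pi appears here; it is supplied by the frequency multiplier, whose
  one-dimensional factors take the value 1 / (2 pi) at 0.\<close>

definition inv_fourier :: "(real^'n::finite \<Rightarrow> complex) \<Rightarrow> real^'n \<Rightarrow> complex" where
  "inv_fourier h x = (CLBINT \<xi>. cis (x \<bullet> \<xi>) * h \<xi>)"

lemma Fubini_bounded:
  fixes k :: "'a::euclidean_space \<Rightarrow> 'b::euclidean_space \<Rightarrow> complex"
  assumes [measurable]: "(\<lambda>(x, y). k x y) \<in> borel_measurable (lborel \<Otimes>\<^sub>M lborel)"
    and le: "\<And>x y. norm (k x y) \<le> a x * b y" and a: "integrable lborel a" and b: "integrable lborel b"
  shows "(LBINT x. LBINT y. k x y) = (LBINT y. LBINT x. k x y)"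
proof (rule lborel_pair.Fubini_integral[symmetric])
  have i: "integrable lborel (k x)" for x
  proof (rule Bochner_Integration.integrable_bound)
    show "integrable lborel (\<lambda>y. a x * b y)" using b by simp
    show "AE y in lborel. norm (k x y) \<le> norm (a x * b y)"
      using le[of x] by (auto intro: order_trans[OF _ abs_ge_self])
  qed measurable
  show "integrable (lborel \<Otimes>\<^sub>M lborel) (\<lambda>(x, y). k x y)"
  proof (rule lborel_pair.Fubini_integrable)
    show "integrable lborel (\<lambda>x. LBINT y. norm (case (x, y) of (x, y) \<Rightarrow> k x y))"
    proof (rule Bochner_Integration.integrable_bound)
      show "integrable lborel (\<lambda>x. a x * (LBINT y. b y))" using a by simp
      show "AE x in lborel. norm (LBINT y. norm (case (x, y) of (x, y) \<Rightarrow> k x y)) \<le> norm (a x * (LBINT y. b y))" (is "AE x in lborel. ?P x")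
      proof (rule AE_I2)
        fix x
        have "(LBINT y. norm (k x y)) \<le> (LBINT y. a x * b y)"
          using i b le by (intro integral_mono) auto
        then show "?P x"
          by simp
      qed
    qed measurable
  qed (use i in auto)
qed

definition gauss_cart :: "real \<Rightarrow> real^'n::finite \<Rightarrow> real" where
  "gauss_cart d x = (\<Prod>i\<in>UNIV. gauss d (x $ i))"

definition normal_cart :: "real^'n::finite \<Rightarrow> real \<Rightarrow> real^'n \<Rightarrow> real" where
  "normal_cart m d x = (\<Prod>i\<in>UNIV. normal_density (m $ i) d (x $ i))"

lemma measurable_gauss_cart [measurable]: "gauss_cart d \<in> borel_measurable borel"
  unfolding gauss_cart_def[abs_def] by measurable

lemma measurable_normal_cart [measurable]:
  "(\<lambda>(m :: real^'n::finite, x). normal_cart m d x) \<in> borel_measurable (borel \<Otimes>\<^sub>M borel)"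
proof -
  have [measurable]: "(\<lambda>p :: (real^'n) \<times> (real^'n). fst p $ i) \<in> borel_measurable (borel \<Otimes>\<^sub>M borel)" for i
    by (rule measurable_compose[OF measurable_fst]) simp
  have [measurable]: "(\<lambda>p :: (real^'n) \<times> (real^'n). snd p $ i) \<in> borel_measurable (borel \<Otimes>\<^sub>M borel)" for i
    by (rule measurable_compose[OF measurable_snd]) simp
  show ?thesis unfolding normal_cart_def normal_density_def split_beta by measurable
qed

lemma gauss_cart_nonneg: "0 \<le> gauss_cart d x" and gauss_cart_le_1: "gauss_cart d x \<le> 1"
  by (auto simp: gauss_cart_def intro!: prod_nonneg prod_le_1 gauss_nonneg gauss_le_1)

lemma gauss_cart_integrable: "d > 0 \<Longrightarrow> integrable lborel (gauss_cart d)"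
  unfolding gauss_cart_def[abs_def] by (intro integral_lborel_prod_cart_real gauss_integrable)

lemma normal_cart_nonneg: "0 \<le> normal_cart m d x"
  by (auto simp: normal_cart_def intro!: prod_nonneg)

lemma normal_cart_commute: "normal_cart m d x = normal_cart x d m"
  by (simp add: normal_cart_def normal_density_def power2_commute)

lemma nn_integral_normal_cart: "d > 0 \<Longrightarrow> (\<integral>\<^sup>+ x. ennreal (normal_cart m d x) \<partial>lborel) = 1"
proof -
  assume d: "d > 0"
  have "integrable lborel (normal_cart m d)"
    unfolding normal_cart_def[abs_def] using d by (intro integral_lborel_prod_cart_real) auto
  moreover have "integral\<^sup>L lborel (normal_cart m d) = (\<Prod>i\<in>UNIV. LBINT t. normal_density (m $ i) d t)"
    unfolding normal_cart_def[abs_def] using d by (intro integral_lborel_prod_cart_real) auto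
  moreover have "\<dots> = 1" using d by simp
  ultimately have "integrable lborel (normal_cart m d)" "integral\<^sup>L lborel (normal_cart m d) = 1" by simp_all
  then show ?thesis by (simp add: nn_integral_eq_integral normal_cart_nonneg)
qed

lemma fourier_gauss_cart:
  fixes z :: "real^'n::finite"
  assumes "d > 0"
  shows "(CLBINT x. cis (x \<bullet> (z - y)) * gauss_cart d x) = complex_of_real ((2 * pi) ^ CARD('n) * normal_cart z d y)"
proof -
  have i: "integrable lborel (\<lambda>s. cis (s * (z - y) $ i) * gauss d s)" for i
    by (rule Bochner_Integration.integrable_bound[OF gauss_integrable[OF assms]]) (auto simp: norm_mult)
  have "(CLBINT x. cis (x \<bullet> (z - y)) * gauss_cart d x)
      = integral\<^sup>L lborel (\<lambda>x::real^'n. \<Prod>i\<in>UNIV. cis (x $ i * (z - y) $ i) * gauss d (x $ i))"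
    by (simp add: cis_inner gauss_cart_def prod.distrib)
  also have "\<dots> = (\<Prod>i\<in>UNIV. CLBINT s. cis (s * (z - y) $ i) * gauss d s)"
    by (rule integral_lborel_prod_cart(2)) (rule i)
  also have "\<dots> = (\<Prod>i\<in>UNIV. complex_of_real (2 * pi * normal_density (z $ i) d (y $ i)))"
    unfolding ft_gauss[OF assms] by (intro prod.cong refl) (simp add: normal_density_def power2_commute)
  also have "\<dots> = complex_of_real ((2 * pi) ^ CARD('n) * normal_cart z d y)"
    by (simp add: normal_cart_def prod.distrib)
  finally show ?thesis .
qed

text \<open>Only the inequality in Plancherel's theorem is needed: with a Gaussian weight in \<open>x\<close>, the
  \<open>L\<^sup>2\<close> norm becomes a double integral against a probability kernel, to which Schur's test applies.\<close>

lemma inv_fourier_L2: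
  fixes h :: "real^'n::finite \<Rightarrow> complex"
  assumes h: "integrable lborel h" and h2: "integrable lborel (\<lambda>\<xi>. (norm (h \<xi>))\<^sup>2)"
  shows "integrable lborel (\<lambda>x. (norm (inv_fourier h x))\<^sup>2)"
    and "(LBINT x. (norm (inv_fourier h x))\<^sup>2) \<le> (2 * pi) ^ CARD('n) * (LBINT \<xi>. (norm (h \<xi>))\<^sup>2)"
proof -
  define F where "F = inv_fourier h"
  define c where "c = (2 * pi) ^ CARD('n)"
  have c: "c \<ge> 0" by (simp add: c_def)
  have [measurable]: "h \<in> borel_measurable borel" using borel_measurable_integrable[OF h] by simp
  have Fm [measurable]: "F \<in> borel_measurable borel"
    unfolding F_def inv_fourier_def[abs_def] by measurable
  have Fb: "norm (F x) \<le> (LBINT \<xi>. norm (h \<xi>))" for x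
    unfolding F_def inv_fourier_def by (rule order_trans[OF integral_norm_bound]) (simp add: norm_mult)
  define C where "C = (LBINT \<xi>. norm (h \<xi>))"
  have Cn: "C \<ge> 0" by (simp add: C_def)
  have hn: "integrable lborel (\<lambda>\<xi>. norm (h \<xi>))" using h by (rule integrable_norm)
  have key: "(\<integral>\<^sup>+ x. ennreal (gauss_cart d x * (norm (F x))\<^sup>2) \<partial>lborel) \<le> ennreal (c * (LBINT \<xi>. (norm (h \<xi>))\<^sup>2))"
    if d: "d > 0" for d
  proof -
    define Q where "Q \<xi> = (CLBINT \<eta>. complex_of_real (c * normal_cart \<xi> d \<eta>) * cnj (h \<eta>))" for \<xi>
    have "(CLBINT x. complex_of_real (gauss_cart d x * (norm (F x))\<^sup>2))
       = (CLBINT x. CLBINT \<xi>. gauss_cart d x * cnj (F x) * (cis (x \<bullet> \<xi>) * h \<xi>))"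
    proof (intro Bochner_Integration.integral_cong refl)
      fix x
      have "complex_of_real (gauss_cart d x * (norm (F x))\<^sup>2) = gauss_cart d x * cnj (F x) * F x"
        by (simp add: complex_norm_square mult_ac del: of_real_power)
      also have "\<dots> = (CLBINT \<xi>. gauss_cart d x * cnj (F x) * (cis (x \<bullet> \<xi>) * h \<xi>))"
        by (subst integral_mult_right_zero) (simp add: F_def inv_fourier_def)
      finally show "complex_of_real (gauss_cart d x * (norm (F x))\<^sup>2)
        = (CLBINT \<xi>. gauss_cart d x * cnj (F x) * (cis (x \<bullet> \<xi>) * h \<xi>))" .
    qed
    also have "\<dots> = (CLBINT \<xi>. CLBINT x. gauss_cart d x * cnj (F x) * (cis (x \<bullet> \<xi>) * h \<xi>))"
    proof (rule Fubini_bounded)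
      show "(\<lambda>(x, \<xi>). gauss_cart d x * cnj (F x) * (cis (x \<bullet> \<xi>) * h \<xi>)) \<in> borel_measurable (lborel \<Otimes>\<^sub>M lborel)"
        by measurable
      show "norm (gauss_cart d x * cnj (F x) * (cis (x \<bullet> \<xi>) * h \<xi>)) \<le> (C * gauss_cart d x) * norm (h \<xi>)" for x \<xi>
      proof -
        have "gauss_cart d x * norm (F x) \<le> C * gauss_cart d x"
          using mult_left_mono[OF Fb[of x, folded C_def] gauss_cart_nonneg, of d x] by (simp add: mult.commute)
        from mult_right_mono[OF this norm_ge_zero[of "h \<xi>"]] show ?thesis
          by (simp add: norm_mult gauss_cart_nonneg)
      qed
      show "integrable lborel (\<lambda>x::real^'n. C * gauss_cart d x)" by (intro integrable_mult_right gauss_cart_integrable d)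
    qed (rule hn)
    also have "\<dots> = (LBINT \<xi>. Q \<xi> * h \<xi>)"
    proof (intro Bochner_Integration.integral_cong refl)
      fix \<xi>
      have "(CLBINT x. gauss_cart d x * cnj (F x) * (cis (x \<bullet> \<xi>) * h \<xi>))
         = (CLBINT x. gauss_cart d x * cnj (F x) * cis (x \<bullet> \<xi>)) * h \<xi>"
        by (simp add: mult.assoc[symmetric])
      also have "(CLBINT x. gauss_cart d x * cnj (F x) * cis (x \<bullet> \<xi>))
         = (CLBINT x. CLBINT \<eta>. cis (x \<bullet> (\<xi> - \<eta>)) * gauss_cart d x * cnj (h \<eta>))"
      proof (intro Bochner_Integration.integral_cong refl)
        fix x
        have "cnj (F x) = (CLBINT \<eta>. cnj (cis (x \<bullet> \<eta>) * h \<eta>))"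
          unfolding F_def inv_fourier_def by (rule Bochner_Integration.integral_cnj[symmetric])
        then have "gauss_cart d x * cnj (F x) * cis (x \<bullet> \<xi>)
           = (CLBINT \<eta>. gauss_cart d x * cis (x \<bullet> \<xi>) * cnj (cis (x \<bullet> \<eta>) * h \<eta>))"
          by (subst integral_mult_right_zero) (simp add: mult_ac)
        also have "\<dots> = (CLBINT \<eta>. cis (x \<bullet> (\<xi> - \<eta>)) * gauss_cart d x * cnj (h \<eta>))"
        proof (intro Bochner_Integration.integral_cong refl)
          fix \<eta>
          have "cis (x \<bullet> \<xi>) * cis (- (x \<bullet> \<eta>)) = cis (x \<bullet> (\<xi> - \<eta>))"
            by (simp add: cis_mult inner_diff_right)
          then have "(cis (x \<bullet> \<xi>) * cis (- (x \<bullet> \<eta>))) * (gauss_cart d x * cnj (h \<eta>))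
            = cis (x \<bullet> (\<xi> - \<eta>)) * (gauss_cart d x * cnj (h \<eta>))" by simp
          then show "gauss_cart d x * cis (x \<bullet> \<xi>) * cnj (cis (x \<bullet> \<eta>) * h \<eta>) = cis (x \<bullet> (\<xi> - \<eta>)) * gauss_cart d x * cnj (h \<eta>)"
            by (simp add: cis_cnj mult_ac)
        qed
        finally show "gauss_cart d x * cnj (F x) * cis (x \<bullet> \<xi>) = (CLBINT \<eta>. cis (x \<bullet> (\<xi> - \<eta>)) * gauss_cart d x * cnj (h \<eta>))" .
      qed
      also have "\<dots> = (CLBINT \<eta>. CLBINT x. cis (x \<bullet> (\<xi> - \<eta>)) * gauss_cart d x * cnj (h \<eta>))"
      proof (rule Fubini_bounded)
        show "(\<lambda>(x, \<eta>). cis (x \<bullet> (\<xi> - \<eta>)) * gauss_cart d x * cnj (h \<eta>)) \<in> borel_measurable (lborel \<Otimes>\<^sub>M lborel)"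
          by measurable
        show "norm (cis (x \<bullet> (\<xi> - \<eta>)) * gauss_cart d x * cnj (h \<eta>)) \<le> gauss_cart d x * norm (h \<eta>)" for x \<eta>
          by (simp add: norm_mult gauss_cart_nonneg)
      qed (rule gauss_cart_integrable[OF d], rule hn)
      also have "\<dots> = Q \<xi>"
        unfolding Q_def integral_mult_left_zero fourier_gauss_cart[OF d] c_def ..
      finally show "(CLBINT x. gauss_cart d x * cnj (F x) * (cis (x \<bullet> \<xi>) * h \<xi>)) = Q \<xi> * h \<xi>" .
    qed
    finally have J: "(CLBINT x. complex_of_real (gauss_cart d x * (norm (F x))\<^sup>2)) = (LBINT \<xi>. Q \<xi> * h \<xi>)" .
    have gi: "integrable lborel (\<lambda>x. gauss_cart d x * (norm (F x))\<^sup>2)"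
    proof (rule Bochner_Integration.integrable_bound)
      show "integrable lborel (\<lambda>x::real^'n. C\<^sup>2 * gauss_cart d x)" by (intro integrable_mult_right gauss_cart_integrable d)
      show "AE x in lborel. norm (gauss_cart d x * (norm (F x))\<^sup>2) \<le> norm (C\<^sup>2 * gauss_cart d x)"
        using Fb unfolding C_def[symmetric]
        by (auto simp: abs_mult gauss_cart_nonneg mult.commute intro!: mult_left_mono power_mono)
    qed measurable
    have "(\<integral>\<^sup>+ x. ennreal (gauss_cart d x * (norm (F x))\<^sup>2) \<partial>lborel) = ennreal (LBINT x. gauss_cart d x * (norm (F x))\<^sup>2)"
      by (rule nn_integral_eq_integral[OF gi]) (auto simp: gauss_cart_nonneg)
    also have "\<dots> = ennreal (norm (LBINT \<xi>. Q \<xi> * h \<xi>))"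
      unfolding J[symmetric] integral_complex_of_real by (simp add: gauss_cart_nonneg)
    \<comment> \<open>If the integrand is not integrable, its integral is 0 and the bound is
      trivial.\<close>
    also have "\<dots> \<le> (\<integral>\<^sup>+ \<xi>. ennreal (norm (Q \<xi> * h \<xi>)) \<partial>lborel)"
      by (cases "integrable lborel (\<lambda>\<xi>. Q \<xi> * h \<xi>)") (auto simp: integral_norm_bound_ennreal not_integrable_integral_eq)
    \<comment> \<open>|h(\<xi>)| |h(\<eta>)| is at most half the sum of the squares; in each half
      the kernel will be integrated over the variable that h does not contain, where it has mass
      1.\<close>
    also have "\<dots> \<le> (\<integral>\<^sup>+ \<xi>. \<integral>\<^sup>+ \<eta>. ennreal (c / 2 * (norm (h \<xi>))\<^sup>2) * ennreal (normal_cart \<xi> d \<eta>)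
        + ennreal (c / 2 * (norm (h \<eta>))\<^sup>2) * ennreal (normal_cart \<xi> d \<eta>) \<partial>lborel \<partial>lborel)"
    proof (rule nn_integral_mono)
      fix \<xi>
      have "ennreal (norm (Q \<xi>)) \<le> (\<integral>\<^sup>+ \<eta>. ennreal (norm (complex_of_real (c * normal_cart \<xi> d \<eta>) * cnj (h \<eta>))) \<partial>lborel)"
        unfolding Q_def
        by (cases "integrable lborel (\<lambda>\<eta>. complex_of_real (c * normal_cart \<xi> d \<eta>) * cnj (h \<eta>))")
           (auto simp: integral_norm_bound_ennreal not_integrable_integral_eq)
      then have "ennreal (norm (Q \<xi> * h \<xi>)) \<le> (\<integral>\<^sup>+ \<eta>. ennreal (norm (complex_of_real (c * normal_cart \<xi> d \<eta>) * cnj (h \<eta>))) \<partial>lborel) * ennreal (norm (h \<xi>))"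
        by (simp add: norm_mult ennreal_mult mult_right_mono)
      also have "\<dots> = (\<integral>\<^sup>+ \<eta>. ennreal (norm (complex_of_real (c * normal_cart \<xi> d \<eta>) * cnj (h \<eta>))) * ennreal (norm (h \<xi>)) \<partial>lborel)"
        by (rule nn_integral_multc[symmetric]) measurable
      also have "\<dots> \<le> (\<integral>\<^sup>+ \<eta>. ennreal (c / 2 * (norm (h \<xi>))\<^sup>2) * ennreal (normal_cart \<xi> d \<eta>)
        + ennreal (c / 2 * (norm (h \<eta>))\<^sup>2) * ennreal (normal_cart \<xi> d \<eta>) \<partial>lborel)"
      proof (rule nn_integral_mono)
        fix \<eta>
        have "norm (complex_of_real (c * normal_cart \<xi> d \<eta>) * cnj (h \<eta>)) * norm (h \<xi>)
           = c * normal_cart \<xi> d \<eta> * (norm (h \<xi>) * norm (h \<eta>))"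
          using c normal_cart_nonneg[of \<xi> d \<eta>] by (simp add: norm_mult)
        also have "\<dots> \<le> c * normal_cart \<xi> d \<eta> * (((norm (h \<xi>))\<^sup>2 + (norm (h \<eta>))\<^sup>2) / 2)"
          using sum_squares_bound[of "norm (h \<xi>)" "norm (h \<eta>)"] c
          by (intro mult_left_mono mult_nonneg_nonneg normal_cart_nonneg) auto
        also have "\<dots> = c / 2 * (norm (h \<xi>))\<^sup>2 * normal_cart \<xi> d \<eta> + c / 2 * (norm (h \<eta>))\<^sup>2 * normal_cart \<xi> d \<eta>"
          by (simp add: field_simps)
        finally show "ennreal (norm (complex_of_real (c * normal_cart \<xi> d \<eta>) * cnj (h \<eta>))) * ennreal (norm (h \<xi>))
          \<le> ennreal (c / 2 * (norm (h \<xi>))\<^sup>2) * ennreal (normal_cart \<xi> d \<eta>) + ennreal (c / 2 * (norm (h \<eta>))\<^sup>2) * ennreal (normal_cart \<xi> d \<eta>)"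
          using c normal_cart_nonneg[of \<xi> d \<eta>]
          by (simp add: ennreal_mult[symmetric] ennreal_plus[symmetric] ennreal_leI del: ennreal_plus)
      qed
      finally show "ennreal (norm (Q \<xi> * h \<xi>)) \<le> (\<integral>\<^sup>+ \<eta>. ennreal (c / 2 * (norm (h \<xi>))\<^sup>2) * ennreal (normal_cart \<xi> d \<eta>)
        + ennreal (c / 2 * (norm (h \<eta>))\<^sup>2) * ennreal (normal_cart \<xi> d \<eta>) \<partial>lborel)" .
    qed
    also have "\<dots> = (\<integral>\<^sup>+ \<xi>. ennreal (c / 2 * (norm (h \<xi>))\<^sup>2) \<partial>lborel)
       + (\<integral>\<^sup>+ \<xi>. \<integral>\<^sup>+ \<eta>. ennreal (c / 2 * (norm (h \<eta>))\<^sup>2) * ennreal (normal_cart \<xi> d \<eta>) \<partial>lborel \<partial>lborel)"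
      by (subst nn_integral_add, measurable)+
         (simp add: nn_integral_add nn_integral_cmult nn_integral_normal_cart[OF d])
    also have "(\<integral>\<^sup>+ \<xi>. \<integral>\<^sup>+ \<eta>. ennreal (c / 2 * (norm (h \<eta>))\<^sup>2) * ennreal (normal_cart \<xi> d \<eta>) \<partial>lborel \<partial>lborel)
       = (\<integral>\<^sup>+ \<eta>. \<integral>\<^sup>+ \<xi>. ennreal (c / 2 * (norm (h \<eta>))\<^sup>2) * ennreal (normal_cart \<xi> d \<eta>) \<partial>lborel \<partial>lborel)"
      by (rule lborel_pair.Fubini') measurable
    also have "\<dots> = (\<integral>\<^sup>+ \<eta>. ennreal (c / 2 * (norm (h \<eta>))\<^sup>2) \<partial>lborel)"
      by (subst normal_cart_commute) (simp add: nn_integral_cmult nn_integral_normal_cart[OF d])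
    also have "(\<integral>\<^sup>+ \<eta>. ennreal (c / 2 * (norm (h \<eta>))\<^sup>2) \<partial>lborel) = ennreal (c / 2 * (LBINT \<xi>. (norm (h \<xi>))\<^sup>2))"
      using h2 c by (subst nn_integral_eq_integral) auto
    also have "\<dots> + \<dots> = ennreal (c * (LBINT \<xi>. (norm (h \<xi>))\<^sup>2))"
      using c by (simp add: ennreal_plus[symmetric] del: ennreal_plus)
    finally show ?thesis .
  qed
  \<comment> \<open>Fatou's lemma along d = 1 / (n + 1) removes the Gaussian weight, which tends to
    1.\<close>
  have "(\<integral>\<^sup>+ x. ennreal ((norm (F x))\<^sup>2) \<partial>lborel)
     = (\<integral>\<^sup>+ x. liminf (\<lambda>n. ennreal (gauss_cart (1 / real (Suc n)) x * (norm (F x))\<^sup>2)) \<partial>lborel)"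
  proof (intro nn_integral_cong)
    fix x
    have "(\<lambda>n. gauss_cart (1 / real (Suc n)) x * (norm (F x))\<^sup>2) \<longlonglongrightarrow> (\<Prod>i\<in>(UNIV::'n set). 1) * (norm (F x))\<^sup>2"
      unfolding gauss_cart_def by (intro tendsto_intros gauss_tendsto_1)
    then have "(\<lambda>n. ennreal (gauss_cart (1 / real (Suc n)) x * (norm (F x))\<^sup>2)) \<longlonglongrightarrow> ennreal ((norm (F x))\<^sup>2)"
      by (intro tendsto_ennrealI) simp
    then show "ennreal ((norm (F x))\<^sup>2) = liminf (\<lambda>n. ennreal (gauss_cart (1 / real (Suc n)) x * (norm (F x))\<^sup>2))"
      by (simp add: lim_imp_Liminf)
  qed
  also have "\<dots> \<le> liminf (\<lambda>n. \<integral>\<^sup>+ x. ennreal (gauss_cart (1 / real (Suc n)) x * (norm (F x))\<^sup>2) \<partial>lborel)"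
    by (rule nn_integral_liminf) measurable
  also have "\<dots> \<le> liminf (\<lambda>n::nat. ennreal (c * (LBINT \<xi>. (norm (h \<xi>))\<^sup>2)))"
    by (intro Liminf_mono always_eventually allI key) simp
  finally have le: "(\<integral>\<^sup>+ x. ennreal ((norm (F x))\<^sup>2) \<partial>lborel) \<le> ennreal (c * (LBINT \<xi>. (norm (h \<xi>))\<^sup>2))"
    by (simp add: Liminf_const)
  show i: "integrable lborel (\<lambda>x. (norm (inv_fourier h x))\<^sup>2)"
    unfolding F_def[symmetric]
    by (rule integrableI_bounded) (use le in \<open>auto simp: order_le_less_trans\<close>)
  show "(LBINT x. (norm (inv_fourier h x))\<^sup>2) \<le> (2 * pi) ^ CARD('n) * (LBINT \<xi>. (norm (h \<xi>))\<^sup>2)"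
    using le unfolding F_def c_def by (subst (asm) nn_integral_eq_integral[OF i]) auto
qed

section \<open>Fourier inversion integrals\<close>

text \<open>Bounded support keeps multiples by continuous functions integrable, so the inverse
  transform can be differentiated as often as wanted without decay conditions.\<close>

definition adm :: "(real^'n::finite \<Rightarrow> complex) \<Rightarrow> bool" where
  "adm h \<longleftrightarrow> integrable lborel h \<and> (\<exists>r. \<forall>\<xi>. r < norm \<xi> \<longrightarrow> h \<xi> = 0)"

lemma adm_measurable: "adm h \<Longrightarrow> h \<in> borel_measurable borel"
  unfolding adm_def using borel_measurable_integrable by fastforce

lemma adm_mult:
  assumes h: "adm h" and c: "continuous_on UNIV c"
  shows "adm (\<lambda>\<xi>. c \<xi> * h \<xi>)"
proof -
  obtain r where r: "\<And>\<xi>. r < norm \<xi> \<Longrightarrow> h \<xi> = 0" using h by (auto simp: adm_def)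
  have "bounded (c ` cball 0 r)"
    by (intro compact_imp_bounded compact_continuous_image continuous_on_subset[OF c]) auto
  then obtain M where M: "\<And>\<xi>. norm \<xi> \<le> r \<Longrightarrow> norm (c \<xi>) \<le> M" unfolding bounded_iff by (metis imageI mem_cball_0)
  have "integrable lborel (\<lambda>\<xi>. c \<xi> * h \<xi>)"
  proof (rule Bochner_Integration.integrable_bound)
    show "integrable lborel (\<lambda>\<xi>. M * norm (h \<xi>))" using h by (simp add: adm_def)
    show "(\<lambda>\<xi>. c \<xi> * h \<xi>) \<in> borel_measurable lborel"
      using adm_measurable[OF h] borel_measurable_continuous_onI[OF c] by simp
    show "AE \<xi> in lborel. norm (c \<xi> * h \<xi>) \<le> norm (M * norm (h \<xi>))"
    proof (rule AE_I2)
      fix \<xi>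
      show "norm (c \<xi> * h \<xi>) \<le> norm (M * norm (h \<xi>))"
      proof (cases "norm \<xi> \<le> r")
        case True
        have "norm (c \<xi>) \<le> \<bar>M\<bar>" using M[OF True] by linarith
        then show ?thesis by (simp add: norm_mult abs_mult mult_right_mono)
      qed (simp add: r)
    qed
  qed
  with r show ?thesis unfolding adm_def by (metis mult_zero_right)
qed

text \<open>The Fourier symbol of the k-th partial derivative.\<close>

definition D :: "'n \<Rightarrow> (real^'n::finite \<Rightarrow> complex) \<Rightarrow> real^'n \<Rightarrow> complex" where
  "D k h \<xi> = \<i> * complex_of_real (\<xi> $ k) * h \<xi>"

lemma adm_D: "adm h \<Longrightarrow> adm (D k h)"
  unfolding D_def[abs_def] by (intro adm_mult continuous_intros)

lemma adm_cis: "adm h \<Longrightarrow> adm (\<lambda>\<xi>. cis (x \<bullet> \<xi>) * h \<xi>)"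
  by (intro adm_mult continuous_intros)

lemma adm_integrable_cis: "adm h \<Longrightarrow> integrable lborel (\<lambda>\<xi>. cis (x \<bullet> \<xi>) * h \<xi>)"
  using adm_cis unfolding adm_def by blast

lemma inv_fourier_has_vector_derivative:
  assumes h: "adm h"
  shows "((\<lambda>t. inv_fourier h (x + t *\<^sub>R axis k 1)) has_vector_derivative inv_fourier (D k h) x) (at 0)"
proof -
  have "adm (\<lambda>\<xi>. complex_of_real (\<xi> $ k) * (cis (x \<bullet> \<xi>) * h \<xi>))"
    by (intro adm_mult adm_cis h continuous_intros)
  then have 1: "integrable lborel (\<lambda>\<xi>. complex_of_real (\<xi> $ k) * (cis (x \<bullet> \<xi>) * h \<xi>))"
    by (simp add: adm_def)
  have "((\<lambda>t. CLBINT \<xi>. cis (t * \<xi> $ k) * (cis (x \<bullet> \<xi>) * h \<xi>)) has_vector_derivative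
     (CLBINT \<xi>. cis (0 * \<xi> $ k) * (\<i> * (complex_of_real (\<xi> $ k) * (cis (x \<bullet> \<xi>) * h \<xi>))))) (at 0)"
    by (rule has_vector_derivative_integral_cis[OF adm_integrable_cis[OF h] 1]) simp
  moreover have "cis (t * \<xi> $ k) * (cis (x \<bullet> \<xi>) * h \<xi>) = cis ((x + t *\<^sub>R axis k 1) \<bullet> \<xi>) * h \<xi>" for t \<xi>
    by (simp add: inner_add_left inner_axis' cis_mult[symmetric] mult_ac)
  then have "(\<lambda>t. CLBINT \<xi>. cis (t * \<xi> $ k) * (cis (x \<bullet> \<xi>) * h \<xi>)) = (\<lambda>t. inv_fourier h (x + t *\<^sub>R axis k 1))"
    by (simp only: inv_fourier_def)
  moreover have "(CLBINT \<xi>. cis (0 * \<xi> $ k) * (\<i> * (complex_of_real (\<xi> $ k) * (cis (x \<bullet> \<xi>) * h \<xi>)))) = inv_fourier (D k h) x"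
    unfolding inv_fourier_def D_def by (intro Bochner_Integration.integral_cong refl) (simp add: mult_ac)
  ultimately show ?thesis by simp
qed

lemma pd_Re_inv_fourier: "adm h \<Longrightarrow> pd k (\<lambda>x. Re (inv_fourier h x)) (\<lambda>x. Re (inv_fourier (D k h) x))"
  unfolding pd_def
proof
  fix x assume "adm h"
  from bounded_linear.has_vector_derivative[OF bounded_linear_Re inv_fourier_has_vector_derivative[OF this]]
  show "((\<lambda>t. Re (inv_fourier h (x + t *\<^sub>R axis k 1))) has_real_derivative Re (inv_fourier (D k h) x)) (at 0)"
    by (simp add: has_real_derivative_iff_has_vector_derivative)
qed

lemma continuous_inv_fourier:
  assumes h: "adm h"
  shows "continuous_on UNIV (inv_fourier h)"
proof (rule continuous_at_imp_continuous_on, rule ballI)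
  fix x
  have [measurable]: "h \<in> borel_measurable borel" by (rule adm_measurable[OF h])
  show "isCont (inv_fourier h) x"
    unfolding continuous_at_sequentially comp_def inv_fourier_def
  proof (intro allI impI)
    fix X assume X: "X \<longlonglongrightarrow> x"
    show "(\<lambda>n. CLBINT \<xi>. cis (X n \<bullet> \<xi>) * h \<xi>) \<longlonglongrightarrow> (CLBINT \<xi>. cis (x \<bullet> \<xi>) * h \<xi>)"
    proof (rule integral_dominated_convergence[where w="\<lambda>\<xi>. norm (h \<xi>)"])
      show "AE \<xi> in lborel. (\<lambda>n. cis (X n \<bullet> \<xi>) * h \<xi>) \<longlonglongrightarrow> cis (x \<bullet> \<xi>) * h \<xi>"
        by (intro AE_I2 tendsto_intros X)
      show "integrable lborel (\<lambda>\<xi>. norm (h \<xi>))" using h by (simp add: adm_def)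
    qed (simp_all add: norm_mult)
  qed
qed

lemma continuous_Re_inv_fourier: "adm h \<Longrightarrow> continuous_on UNIV (\<lambda>x. Re (inv_fourier h x))"
  by (intro continuous_intros continuous_inv_fourier)

lemma inv_fourier_diff: "adm h \<Longrightarrow> adm g \<Longrightarrow> inv_fourier (\<lambda>\<xi>. h \<xi> - g \<xi>) x = inv_fourier h x - inv_fourier g x"
  unfolding inv_fourier_def by (simp add: right_diff_distrib adm_integrable_cis)

lemma inv_fourier_minus: "inv_fourier (\<lambda>\<xi>. - h \<xi>) x = - inv_fourier h x"
  unfolding inv_fourier_def by simp

lemma inv_fourier_sum:
  "(\<And>a. a \<in> A \<Longrightarrow> adm (h a)) \<Longrightarrow> inv_fourier (\<lambda>\<xi>. \<Sum>a\<in>A. h a \<xi>) x = (\<Sum>a\<in>A. inv_fourier (h a) x)"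
  unfolding inv_fourier_def sum_distrib_left
  by (intro Bochner_Integration.integral_sum) (auto intro: adm_integrable_cis)

lemma inv_fourier_cong_AE:
  assumes "AE \<xi> in lborel. h \<xi> = g \<xi>" "h \<in> borel_measurable borel" "g \<in> borel_measurable borel"
  shows "inv_fourier h x = inv_fourier g x"
  unfolding inv_fourier_def using assms by (intro integral_cong_AE) auto

text \<open>Liouville's theorem for square integrable harmonic functions: Caccioppoli's inequality
  with zero right side bounds the local gradient by a multiple of 1 / R for every large R.\<close>

lemma harmonic_L2_gradient:
  fixes H :: "real^3 \<Rightarrow> real"
  assumes H: "continuous_on UNIV H" "integrable lborel (\<lambda>x. (H x)\<^sup>2)"
    and H1: "\<And>k. pd k H (H1 k)" "\<And>k. continuous_on UNIV (H1 k)"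
    and H2: "\<And>k. pd k (H1 k) (H2 k)" "\<And>k. continuous_on UNIV (H2 k)"
    and harm: "\<And>x. (\<Sum>k\<in>UNIV. H2 k x) = 0"
  shows "H1 k x = 0"
proof -
  have caccioppoli: "(\<Sum>k\<in>UNIV. LBINT x. (cutoff R x)\<^sup>2 * (H1 k x)\<^sup>2) \<le> 200 / R * (LBINT x. (H x)\<^sup>2)" if R: "R \<ge> 1" for R
  proof -
    have "(\<Sum>k\<in>UNIV. H2 k x) = 0 - 0" for x by (simp add: harm)
    from gradient_estimate[where a="\<lambda>_. 0" and b="\<lambda>_. 0", OF R H H1 H2 continuous_on_const pd_const continuous_on_const
        continuous_on_const pd_const continuous_on_const this]
    show ?thesis by simp
  qed
  define r where "r = 2 * norm x + 1"
  have r: "r \<ge> 1" by (simp add: r_def)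
  have i: "integrable lborel (\<lambda>x. (cutoff R x)\<^sup>2 * (H1 k x)\<^sup>2)" if "R \<ge> 1" for R k
  proof -
    have "cc R (\<lambda>x. (cutoff R x)\<^sup>2)"
      using cc_cutoff_power[of R 1] that by (simp add: eval_nat_numeral)
    then show ?thesis by (intro cc_integrable[OF cc_mult1] continuous_intros H1)
  qed
  have "\<forall>\<^sub>F R in at_top. (LBINT x. (cutoff r x)\<^sup>2 * (H1 k x)\<^sup>2) \<le> 200 / R * (LBINT x. (H x)\<^sup>2)"
    using eventually_ge_at_top[of r]
  proof eventually_elim
    case (elim R)
    then have R: "R \<ge> 1" using r by simp
    have "(LBINT x. (cutoff r x)\<^sup>2 * (H1 k x)\<^sup>2) \<le> (LBINT x. (cutoff R x)\<^sup>2 * (H1 k x)\<^sup>2)"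
      using r elim by (intro integral_mono i R mult_right_mono power_mono cutoff_mono) auto
    also have "\<dots> \<le> (\<Sum>k\<in>UNIV. LBINT x. (cutoff R x)\<^sup>2 * (H1 k x)\<^sup>2)"
      using member_le_sum[of k UNIV "\<lambda>k. LBINT x. (cutoff R x)\<^sup>2 * (H1 k x)\<^sup>2"] by simp
    also have "\<dots> \<le> 200 / R * (LBINT x. (H x)\<^sup>2)" by (rule caccioppoli[OF R])
    finally show ?case .
  qed
  moreover have "((\<lambda>R. 200 / R * (LBINT x. (H x)\<^sup>2)) \<longlongrightarrow> 0 * (LBINT x. (H x)\<^sup>2)) at_top"
    by (intro tendsto_intros real_tendsto_divide_at_top[OF tendsto_const] filterlim_ident)
  ultimately have "(LBINT x. (cutoff r x)\<^sup>2 * (H1 k x)\<^sup>2) \<le> 0 * (LBINT x. (H x)\<^sup>2)"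
    by (intro tendsto_le[OF _ _ tendsto_const]) auto
  moreover have "0 \<le> (LBINT x. (cutoff r x)\<^sup>2 * (H1 k x)\<^sup>2)" by simp
  ultimately have "(LBINT x. (cutoff r x)\<^sup>2 * (H1 k x)\<^sup>2) = 0" by simp
  then have "AE x in lborel. (cutoff r x)\<^sup>2 * (H1 k x)\<^sup>2 = 0"
    by (subst (asm) integral_nonneg_eq_0_iff_AE) (auto intro: i[OF r])
  then have "(cutoff r x)\<^sup>2 * (H1 k x)\<^sup>2 = 0"
    by (rule AE_eq_0_continuous) (intro continuous_intros H1)
  moreover have "3 / 4 \<le> cutoff r x"
    using r norm_ge_zero[of x] by (intro cutoff_ge) (linarith, simp add: r_def)
  ultimately show ?thesis by auto
qed

section \<open>The vector potential\<close>

text \<open>Both flat factors equal exp (-1) at t = 0, hence the factor \<open>exp 2\<close>. The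
  value 1 / (2 pi) there makes the transform have integral 1 by \<open>integral_ft\<close>.\<close>

lemma normalized_bump:
  "\<exists>b M. (\<lambda>t. complex_of_real (b t)) \<in> bumps \<and> (\<forall>t. 0 \<le> b t \<and> b t \<le> M) \<and> b 0 = 1 / (2 * pi)"
proof -
  define b where "b t = exp 2 / (2 * pi) * (flat 1 (1 + t) * flat 1 (1 - t))" for t :: real
  have flat: "0 \<le> flat 1 t" "flat 1 t \<le> 1" for t by (auto simp: flat_def)
  have "smooth_k k (\<lambda>t. complex_of_real (flat 1 (1 * t + 1)))" "smooth_k k (\<lambda>t. complex_of_real (flat 1 ((-1) * t + 1)))" for k
    by (intro smooth_k_affine[OF smooth_k_flat])+
  then have "smooth_k k (\<lambda>t. complex_of_real (exp 2 / (2 * pi)) * (complex_of_real (flat 1 (1 * t + 1)) * complex_of_real (flat 1 ((-1) * t + 1))))" for k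
    by (intro smooth_k_mult smooth_k_const)
  then have "smooth_k k (\<lambda>t. complex_of_real (b t))" for k
    by (simp add: b_def add.commute)
  moreover have "b t = 0" if "1 < \<bar>t\<bar>" for t
    using that by (auto simp: b_def flat_def)
  ultimately have "(\<lambda>t. complex_of_real (b t)) \<in> bumps"
    unfolding bumps_def by (auto intro!: exI[of _ 1])
  moreover have "0 \<le> b t \<and> b t \<le> exp 2 / (2 * pi)" for t
    using flat mult_le_one[of "flat 1 (1 + t)" "flat 1 (1 - t)"] by (auto simp: b_def intro!: divide_right_mono)
  moreover have "b 0 = 1 / (2 * pi)"
  proof -
    have "exp 2 * (exp (- 1) * exp (- 1)) = (1::real)" by (simp flip: exp_add)
    then show ?thesis by (simp add: b_def flat_def)
  qed
  ultimately show ?thesis by blast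
qed

text \<open>An integrable majorant, up to constants, of products of one-dimensional transforms.
  Being at most 1 as well, it can be paired with a function in L^p, p \<ge> 1.\<close>

definition weight :: "real^3 \<Rightarrow> real" where
  "weight y = (\<Prod>j\<in>UNIV. inverse (1 + (y $ j)\<^sup>2))"

lemma integrable_inverse_square: "integrable lborel (\<lambda>t::real. inverse (1 + t\<^sup>2))"
  using integrable_inverse_1_plus_square by (simp add: set_integrable_def)

lemma weight_integrable: "integrable lborel weight"
  unfolding weight_def[abs_def] by (rule integral_lborel_prod_cart_real) (rule integrable_inverse_square)

lemma weight_nonneg: "0 \<le> weight y"
  unfolding weight_def by (intro prod_nonneg) simp

lemma weight_le_1: "weight y \<le> 1"
  unfolding weight_def by (intro prod_le_1) (auto simp: inverse_le_1_iff)

text \<open>Modulating the test functions by x moves the duality identity from the transforms at y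
  to those at y - x, so it yields convolutions.\<close>

lemma ft_modulate: "ft (\<lambda>t. cis (a * t) * f t) s = ft f (s - a)"
  unfolding ft_def mult.assoc[symmetric] cis_mult by (simp add: algebra_simps)

lemma bumps_modulate: "f \<in> bumps \<Longrightarrow> (\<lambda>t. cis (a * t) * f t) \<in> bumps"
  using smooth_k_cis[of _ 1 a] by (intro bumps_mult2) simp_all

lemma bumps_times_t:
  assumes "f \<in> bumps" shows "(\<lambda>t. \<i> * complex_of_real t * f t) \<in> bumps" "(\<lambda>t. - (\<i> * complex_of_real t) * f t) \<in> bumps"
proof -
  have s: "smooth_k k (\<lambda>t. \<i> * complex_of_real t)" for k
    by (intro smooth_k_mult smooth_k_const smooth_k_of_real)
  then show "(\<lambda>t. \<i> * complex_of_real t * f t) \<in> bumps"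
    by (rule bumps_mult2[OF assms])
  have "smooth_k k (\<lambda>t. (-1) * (\<i> * complex_of_real t))" for k
    by (intro smooth_k_mult[OF smooth_k_const s])
  then show "(\<lambda>t. - (\<i> * complex_of_real t) * f t) \<in> bumps"
    by (intro bumps_mult2[OF assms]) simp
qed

section \<open>Products of one-dimensional transforms\<close>

lemma continuous_ft: "f \<in> bumps \<Longrightarrow> continuous_on UNIV (ft f)"
  unfolding continuous_on_eq_continuous_within
  using ft_has_vector_derivative has_vector_derivative_continuous by blast

abbreviation ft_prod :: "('n::finite \<Rightarrow> real \<Rightarrow> complex) \<Rightarrow> real^'n \<Rightarrow> complex" where
  "ft_prod f y \<equiv> \<Prod>j\<in>UNIV. ft (f j) (y $ j)"

lemma continuous_prod_ft:
  assumes "\<And>j. f j \<in> bumps"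
  shows "continuous_on UNIV (\<lambda>y::real^'n::finite. \<Prod>j\<in>UNIV. ft (f j) ((y - x) $ j))"
  by (intro continuous_on_prod continuous_on_compose2[OF continuous_ft[OF assms]] continuous_intros) auto

lemma prod_ft_le_weight:
  assumes "\<And>j. f j \<in> bumps"
  shows "\<exists>C\<ge>0. \<forall>y. norm (ft_prod f y) \<le> C * weight y"
proof -
  have "\<exists>C. \<forall>j. C j \<ge> 0 \<and> (\<forall>s. norm (ft (f j) s) \<le> C j / (1 + s\<^sup>2) ^ 3)"
    using ft_decay[OF assms] by (intro choice) blast
  then obtain C where C: "\<And>j. C j \<ge> 0" "\<And>j s. norm (ft (f j) s) \<le> C j / (1 + s\<^sup>2) ^ 3" by blast
  have "norm (ft_prod f y) \<le> (\<Prod>j\<in>UNIV. C j) * weight y" for y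
  proof -
    have "norm (ft (f j) (y $ j)) \<le> C j * inverse (1 + (y $ j)\<^sup>2)" for j
    proof -
      have "C j / (1 + (y $ j)\<^sup>2) ^ 3 \<le> C j / (1 + (y $ j)\<^sup>2) ^ 1"
        using C by (intro divide_left_mono power_increasing) (auto intro!: mult_pos_pos add_pos_nonneg)
      then show ?thesis using order_trans[OF C(2)[of j "y $ j"]] by (simp add: divide_inverse)
    qed
    then show ?thesis
      unfolding weight_def prod.distrib[symmetric] prod_norm[symmetric] by (intro prod_mono) simp
  qed
  moreover have "(\<Prod>j\<in>UNIV. C j) \<ge> 0" by (intro prod_nonneg) (simp add: C)
  ultimately show ?thesis by blast
qed

lemma pd_prod_ft:
  assumes f: "f \<in> bumps"
  shows "pd i (\<lambda>y::real^3. Re (\<Prod>j\<in>UNIV. ft f ((y - x) $ j)))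
    (\<lambda>y. Re (\<Prod>j\<in>UNIV. ft (if j = i then (\<lambda>t. - (\<i> * complex_of_real t) * f t) else f) ((y - x) $ j)))"
  unfolding pd_def
proof
  fix y :: "real^3"
  define c where "c = (\<Prod>j\<in>UNIV - {i}. ft f ((y - x) $ j))"
  have 1: "(\<Prod>j\<in>UNIV. ft f ((y + t *\<^sub>R axis i 1 - x) $ j)) = ft f ((y - x) $ i + t) * c" for t
    unfolding c_def prod.remove[OF finite_class.finite_UNIV UNIV_I[of i]]
    by (intro arg_cong2[of _ _ _ _ "(*)"] prod.cong refl) (auto simp: axis_def algebra_simps)
  have 2: "(\<Prod>j\<in>UNIV. ft (if j = i then (\<lambda>t. - (\<i> * complex_of_real t) * f t) else f) ((y - x) $ j))
     = ft (\<lambda>t. - (\<i> * complex_of_real t) * f t) ((y - x) $ i) * c"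
    unfolding c_def prod.remove[OF finite_class.finite_UNIV UNIV_I[of i]]
    by (intro arg_cong2[of _ _ _ _ "(*)"] prod.cong refl) auto
  have s: "((\<lambda>t. (y - x) $ i + t) has_vector_derivative 1) (at 0)"
    by (auto intro!: derivative_eq_intros)
  have "((\<lambda>t. ft f ((y - x) $ i + t)) has_vector_derivative 1 *\<^sub>R ft (\<lambda>t. - (\<i> * complex_of_real t) * f t) ((y - x) $ i)) (at 0)"
    using vector_diff_chain_at[OF s, of "ft f" "ft (\<lambda>t. - (\<i> * complex_of_real t) * f t) ((y - x) $ i)"]
      ft_has_vector_derivative[OF f, of "(y - x) $ i"] by (simp add: comp_def)
  then have "((\<lambda>t. ft f ((y - x) $ i + t) * c) has_vector_derivative ft (\<lambda>t. - (\<i> * complex_of_real t) * f t) ((y - x) $ i) * c) (at 0)"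
    by (intro has_vector_derivative_mult_left) simp
  from bounded_linear.has_vector_derivative[OF bounded_linear_Re this]
  show "((\<lambda>t. Re (\<Prod>j\<in>UNIV. ft f ((y + t *\<^sub>R axis i 1 - x) $ j))) has_real_derivative
     Re (\<Prod>j\<in>UNIV. ft (if j = i then (\<lambda>t. - (\<i> * complex_of_real t) * f t) else f) ((y - x) $ j))) (at 0)"
    unfolding 1 2 by (simp add: has_real_derivative_iff_has_vector_derivative)
qed

text \<open>Integration by parts against a function without compact support. The squared cutoff at
  radius n + 1 has partial derivatives of size at most 4 / (n + 1), and the two integrability
  hypotheses dominate the passage to the limit.\<close>

lemma div_free_orthogonal_gradient:
  fixes u :: "3 \<Rightarrow> real^3 \<Rightarrow> real"
  assumes u: "\<And>i. continuous_on UNIV (u i)" "\<And>i k. continuous_on UNIV (du i k)" "\<And>i k. pd k (u i) (du i k)"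
    and div: "\<And>x. (\<Sum>k\<in>UNIV. du k k x) = 0"
    and k: "continuous_on UNIV k" "\<And>i. pd i k (k1 i)" "\<And>i. continuous_on UNIV (k1 i)"
    and int: "\<And>i. integrable lborel (\<lambda>y. u i y * k y)" "\<And>i. integrable lborel (\<lambda>y. u i y * k1 i y)"
  shows "(\<Sum>i\<in>UNIV. LBINT y. u i y * k1 i y) = 0"
proof -
  define s where "s n = cutoff (real (Suc n))" for n
  define t where "t n i x = - (4 / (real (Suc n))\<^sup>2) * x $ i * s n x" for n and i :: 3 and x :: "real^3"
  have s01: "0 \<le> s n x" "s n x \<le> 1" for n x by (auto simp: s_def)
  have sc: "continuous_on UNIV (s n)" for n by (simp add: s_def continuous_cutoff)
  have cs: "cc (real (Suc n)) (\<lambda>x. (s n x)\<^sup>2)" for n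
    using cc_cutoff_power[of "real (Suc n)" 1] by (simp add: s_def eval_nat_numeral)
  have ps: "pd i (\<lambda>x. (s n x)\<^sup>2) (t n i)" for i n
    using pd_cutoff_power[of i "real (Suc n)" 0] by (simp add: s_def t_def[abs_def] eval_nat_numeral)
  have tc: "continuous_on UNIV (t n i)" for n i
  proof -
    have "continuous_on UNIV (\<lambda>x. c * x $ i * s n x)" for c :: real
      using sc by (intro continuous_intros)
    then show ?thesis unfolding t_def[abs_def] .
  qed
  have tb: "\<bar>t n i x\<bar> \<le> 4 * (1 / real (Suc n))" for n i x
  proof -
    have "\<bar>t n i x\<bar> = 4 / (real (Suc n))\<^sup>2 * (\<bar>x $ i\<bar> * s n x)" by (simp add: t_def abs_mult s01)
    also have "\<dots> \<le> 4 / (real (Suc n))\<^sup>2 * (real (Suc n) * s n x)"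
      unfolding s_def by (intro mult_left_mono cutoff_coord_bound) auto
    also have "\<dots> \<le> 4 / (real (Suc n))\<^sup>2 * (real (Suc n) * 1)"
      by (intro mult_left_mono s01) auto
    also have "\<dots> = 4 * (1 / real (Suc n))" by (simp add: power2_eq_square del: of_nat_Suc)
    finally show ?thesis .
  qed
  note cont = u(1,2) k(1,3) sc tc
  have zero: "(\<Sum>i\<in>UNIV. LBINT y. u i y * (k1 i y * (s n y)\<^sup>2 + k y * t n i y)) = 0" for n
  proof -
    have f: "cc (real (Suc n)) (\<lambda>y. k y * (s n y)\<^sup>2)" by (intro cc_mult2 cs cont)
    have ibp: "(LBINT y. du i i y * (k y * (s n y)\<^sup>2)) = - (LBINT y. u i y * (k1 i y * (s n y)\<^sup>2 + k y * t n i y))" for i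
      by (rule integral_by_parts_pd[where i=i, OF f]) (intro pd_mult k ps u continuous_intros cont)+
    have "(\<Sum>i\<in>UNIV. LBINT y. u i y * (k1 i y * (s n y)\<^sup>2 + k y * t n i y))
        = - (\<Sum>i\<in>UNIV. LBINT y. du i i y * (k y * (s n y)\<^sup>2))"
      unfolding ibp by (simp add: sum_negf)
    also have "(\<Sum>i\<in>UNIV. LBINT y. du i i y * (k y * (s n y)\<^sup>2)) = (LBINT y. (\<Sum>i\<in>UNIV. du i i y * (k y * (s n y)\<^sup>2)))"
      by (intro Bochner_Integration.integral_sum[symmetric] cc_integrable[OF cc_mult2[OF f]] cont)
    also have "\<dots> = 0" unfolding sum_distrib_right[symmetric] div by simp
    finally show ?thesis by simp
  qed
  have "(\<lambda>n. LBINT y. u i y * (k1 i y * (s n y)\<^sup>2 + k y * t n i y)) \<longlonglongrightarrow> (LBINT y. u i y * k1 i y)" for i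
  proof (rule integral_dominated_convergence[where w="\<lambda>y. \<bar>u i y * k1 i y\<bar> + 4 * \<bar>u i y * k y\<bar>"])
    show "(\<lambda>y. u i y * k1 i y) \<in> borel_measurable lborel" "\<And>n. (\<lambda>y. u i y * (k1 i y * (s n y)\<^sup>2 + k y * t n i y)) \<in> borel_measurable lborel"
      using cont by (auto intro!: borel_measurable_continuous_onI continuous_intros)
    show "integrable lborel (\<lambda>y. \<bar>u i y * k1 i y\<bar> + 4 * \<bar>u i y * k y\<bar>)"
      by (intro Bochner_Integration.integrable_add integrable_mult_right integrable_abs int)
    show "AE y in lborel. (\<lambda>n. u i y * (k1 i y * (s n y)\<^sup>2 + k y * t n i y)) \<longlonglongrightarrow> u i y * k1 i y" (is "AE y in lborel. ?P y")
    proof (rule AE_I2)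
      fix y
      have "(\<lambda>n. \<Sum>i\<in>UNIV. (y $ i)\<^sup>2 / (real (Suc n))\<^sup>2) \<longlonglongrightarrow> (\<Sum>i\<in>(UNIV::3 set). (y $ i)\<^sup>2 * 0\<^sup>2)"
        unfolding divide_inverse power_inverse[symmetric] by (intro tendsto_intros LIMSEQ_inverse_real_of_nat)
      then have "(\<lambda>n. max 0 (1 - (\<Sum>i\<in>UNIV. (y $ i)\<^sup>2) / (real (Suc n))\<^sup>2)) \<longlonglongrightarrow> max 0 (1 - 0)"
        by (intro tendsto_intros) (simp add: sum_divide_distrib)
      then have s1: "(\<lambda>n. s n y) \<longlonglongrightarrow> 1" by (simp add: s_def cutoff_def)
      have "(\<lambda>n. t n i y) \<longlonglongrightarrow> 0"
      proof (rule Lim_null_comparison)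
        show "\<forall>\<^sub>F n in sequentially. norm (t n i y) \<le> 4 * (1 / real (Suc n))" using tb by simp
        show "(\<lambda>n. 4 * (1 / real (Suc n))) \<longlonglongrightarrow> 0"
          using tendsto_mult_right_zero[OF LIMSEQ_Suc[OF lim_1_over_n], of 4] by simp
      qed
      then have "(\<lambda>n. u i y * (k1 i y * (s n y)\<^sup>2 + k y * t n i y)) \<longlonglongrightarrow> u i y * (k1 i y * 1\<^sup>2 + k y * 0)"
        by (intro tendsto_intros s1)
      then show "?P y" by simp
    qed
    fix n
    show "AE y in lborel. norm (u i y * (k1 i y * (s n y)\<^sup>2 + k y * t n i y)) \<le> \<bar>u i y * k1 i y\<bar> + 4 * \<bar>u i y * k y\<bar>" (is "AE y in lborel. ?P y")
    proof (rule AE_I2)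
      fix y
      have "\<bar>u i y * k1 i y\<bar> * (s n y)\<^sup>2 \<le> \<bar>u i y * k1 i y\<bar> * 1"
        by (intro mult_left_mono power_le_one s01) auto
      moreover have "\<bar>u i y * k y\<bar> * \<bar>t n i y\<bar> \<le> \<bar>u i y * k y\<bar> * 4"
      proof (intro mult_left_mono)
        have "4 * (1 / real (Suc n)) \<le> 4" by (simp add: divide_le_eq)
        then show "\<bar>t n i y\<bar> \<le> 4" using tb[of n i y] by linarith
      qed simp
      moreover have "\<bar>u i y * (k1 i y * (s n y)\<^sup>2 + k y * t n i y)\<bar> \<le> \<bar>u i y * k1 i y\<bar> * (s n y)\<^sup>2 + \<bar>u i y * k y\<bar> * \<bar>t n i y\<bar>"
        using abs_triangle_ineq[of "u i y * k1 i y * (s n y)\<^sup>2" "u i y * k y * t n i y"]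
        by (simp add: abs_mult algebra_simps)
      ultimately show "?P y"
        by simp
    qed
  qed
  then have "(\<lambda>n. \<Sum>i\<in>UNIV. LBINT y. u i y * (k1 i y * (s n y)\<^sup>2 + k y * t n i y)) \<longlonglongrightarrow> (\<Sum>i\<in>UNIV. LBINT y. u i y * k1 i y)"
    by (intro tendsto_sum)
  then show ?thesis unfolding zero by (simp add: LIMSEQ_const_iff)
qed

lemma prod_one_plus_ge: "finite A \<Longrightarrow> (\<And>j. j \<in> A \<Longrightarrow> 0 \<le> a j) \<Longrightarrow> 1 + sum a A \<le> (\<Prod>j\<in>A. 1 + a j)" for a :: "'i \<Rightarrow> real"
proof (induction A rule: finite_induct)
  case (insert x A)
  have "0 \<le> sum a A" "0 \<le> a x" using insert by (auto intro: sum_nonneg)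
  then have "1 + (a x + sum a A) \<le> (1 + a x) * (1 + sum a A)"
    by (simp add: algebra_simps)
  also have "\<dots> \<le> (1 + a x) * (\<Prod>j\<in>A. 1 + a j)"
    using insert by (intro mult_left_mono) auto
  finally show ?case using insert by simp
qed auto

text \<open>\<open>\<gamma> i\<close> is a Borel density of the Fourier transform of
  \<open>u i\<close>, known through \<open>dual\<close> on products of bumps and through the
  weighted L^2 bound that expresses the negative Sobolev norm. The bump \<open>b\<close> is the
  profile of the frequency truncation.\<close>

locale hdot_field =
  fixes u :: "3 \<Rightarrow> real^3 \<Rightarrow> real" and du :: "3 \<Rightarrow> 3 \<Rightarrow> real^3 \<Rightarrow> real" and p :: real
    and \<gamma> :: "3 \<Rightarrow> real^3 \<Rightarrow> complex" and b :: "real \<Rightarrow> real" and M :: real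
  assumes u_cont: "continuous_on UNIV (u i)" "continuous_on UNIV (du i k)" and u_pd: "pd k (u i) (du i k)"
    and div_u: "(\<Sum>k\<in>UNIV. du k k x) = 0"
    and p: "1 \<le> p" and u_Lp: "integrable lborel (\<lambda>x. \<bar>u i x\<bar> powr p)"
    and \<gamma>_meas: "\<gamma> i \<in> borel_measurable borel"
    and \<gamma>_L2: "integrable lborel (\<lambda>\<xi>. (norm (\<gamma> i \<xi>) / norm \<xi>)\<^sup>2)"
    and dual: "(\<And>j. f j \<in> bumps) \<Longrightarrow>
      (CLBINT y. complex_of_real (u i y) * ft_prod f y) = (CLBINT \<xi>. \<gamma> i \<xi> * (\<Prod>j\<in>UNIV. f j (\<xi> $ j)))"
    and b: "(\<lambda>t. complex_of_real (b t)) \<in> bumps" "0 \<le> b t" "b t \<le> M" "b 0 = 1 / (2 * pi)"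
begin

declare \<gamma>_meas [measurable]

text \<open>The dilation opens the frequency window as n grows; n + 1 avoids division by 0.\<close>

definition bn :: "nat \<Rightarrow> real \<Rightarrow> complex" where
  "bn n t = complex_of_real (b (1 / real (Suc n) * t))"

definition m :: "nat \<Rightarrow> real^3 \<Rightarrow> complex" where
  "m n \<xi> = (\<Prod>j\<in>UNIV. bn n (\<xi> $ j))"

text \<open>Its square integrability is the Sobolev hypothesis; the symbols below are measured
  against it.\<close>

definition \<theta> :: "3 \<Rightarrow> real^3 \<Rightarrow> real" where
  "\<theta> i \<xi> = norm (\<gamma> i \<xi>) / norm \<xi>"

text \<open>Symbols of \<open>\<Delta>\<^sup>-\<^sup>1 (\<partial>\<^sub>j u\<^sub>i - \<partial>\<^sub>i u\<^sub>j)\<close> and of \<open>H = \<Delta>\<^sup>-\<^sup>1 div u\<close>; division by zero makes both vanish at the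
  origin. The gradient of \<open>H\<close> is the defect in \<open>\<Sum>\<^sub>j \<partial>\<^sub>j B\<^sub>i\<^sub>j = v\<^sub>i\<close>; it is zero because \<open>H\<close> is harmonic and
  square integrable.\<close>

abbreviation "symB i j \<xi> \<equiv> - \<i> * (\<xi> $ j * \<gamma> i \<xi> - \<xi> $ i * \<gamma> j \<xi>) / complex_of_real ((norm \<xi>)\<^sup>2)"
abbreviation "symH \<xi> \<equiv> - \<i> * (\<Sum>j\<in>UNIV. \<xi> $ j * \<gamma> j \<xi>) / complex_of_real ((norm \<xi>)\<^sup>2)"

definition hv :: "nat \<Rightarrow> 3 \<Rightarrow> real^3 \<Rightarrow> complex" where
  "hv n i \<xi> = m n \<xi> * \<gamma> i \<xi>"

definition hB :: "nat \<Rightarrow> 3 \<Rightarrow> 3 \<Rightarrow> real^3 \<Rightarrow> complex" where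
  "hB n i j \<xi> = m n \<xi> * symB i j \<xi>"

definition hH :: "nat \<Rightarrow> real^3 \<Rightarrow> complex" where
  "hH n \<xi> = m n \<xi> * symH \<xi>"

text \<open>(2 pi)^3 comes from Plancherel's inequality, M^6 from the squared multiplier and 12 = 4
  * 3 from the square of twice a sum of three terms. No n appears, because dilating \<open>b\<close>
  does not change its bound \<open>M\<close>.\<close>

definition K :: real where
  "K = (2 * pi) ^ 3 * (12 * M ^ 6 * (\<Sum>i\<in>UNIV. LBINT \<xi>. (\<theta> i \<xi>)\<^sup>2))"

section \<open>The truncated symbols\<close>

lemma bn_bumps: "bn n \<in> bumps"
  unfolding bn_def[abs_def] using b(1) by (rule bumps_scale) simp

lemma M_nonneg: "0 \<le> M"
  using b(2,3)[of 0] by linarith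

lemma m_bound: "norm (m n \<xi>) \<le> M ^ 3"
proof -
  have "norm (m n \<xi>) = (\<Prod>j\<in>UNIV. b (1 / real (Suc n) * \<xi> $ j))"
    unfolding m_def prod_norm[symmetric] bn_def by (simp add: b(2))
  also have "\<dots> \<le> (\<Prod>j\<in>(UNIV::3 set). M)"
    by (intro prod_mono) (simp add: b)
  finally show ?thesis by simp
qed

lemma m_cont: "continuous_on UNIV (m n)"
  unfolding m_def[abs_def]
  by (intro continuous_on_prod continuous_on_compose2[OF bumps_continuous[OF bn_bumps]] continuous_intros) auto

lemma m_meas [measurable]: "m n \<in> borel_measurable borel"
  by (rule borel_measurable_continuous_onI[OF m_cont])

lemma m_support: "\<exists>r>0. \<forall>\<xi>. r < norm \<xi> \<longrightarrow> m n \<xi> = 0"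
proof -
  obtain a where a: "a > 0" "\<And>t. a < \<bar>t\<bar> \<Longrightarrow> bn n t = 0" using bumps_bounded_support[OF bn_bumps] by blast
  have "m n \<xi> = 0" if "3 * a < norm \<xi>" for \<xi>
  proof -
    have "\<exists>j. a < \<bar>\<xi> $ j\<bar>"
    proof (rule ccontr)
      assume "\<not> ?thesis"
      then have "(\<Sum>j\<in>UNIV. \<bar>\<xi> $ j\<bar>) \<le> (\<Sum>j\<in>(UNIV::3 set). a)" by (intro sum_mono) (auto simp: not_less)
      then show False using norm_le_l1_cart[of \<xi>] that by simp
    qed
    then show ?thesis using a(2) unfolding m_def by (intro prod_zero) auto
  qed
  then show ?thesis using a(1) by (intro exI[of _ "3 * a"]) auto
qed

lemma \<theta>_meas [measurable]: "\<theta> i \<in> borel_measurable borel"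
  unfolding \<theta>_def[abs_def] by measurable

lemma \<theta>_nonneg: "0 \<le> \<theta> i \<xi>" by (simp add: \<theta>_def)

lemma \<theta>_int: "integrable lborel (\<lambda>\<xi>. (\<theta> i \<xi>)\<^sup>2)"
  using \<gamma>_L2 by (simp add: \<theta>_def)

lemma \<gamma>_\<theta>: "\<xi> \<noteq> 0 \<Longrightarrow> norm (\<gamma> i \<xi>) = norm \<xi> * \<theta> i \<xi>"
  by (simp add: \<theta>_def)

abbreviation "\<Theta> \<xi> \<equiv> \<Sum>i\<in>UNIV. \<theta> i \<xi>"
abbreviation "\<Theta>\<^sub>2 \<xi> \<equiv> \<Sum>i\<in>UNIV. (\<theta> i \<xi>)\<^sup>2"

text \<open>On the bounded support of \<open>m n\<close>, \<theta> \<le> 1 + \<theta>^2 turns square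
  integrability into integrability. The factor 2 + |\<xi>| covers both \<gamma>, of size |\<xi>|
  \<theta>, and the symbols of B and H, which have no growing factor.\<close>

lemma adm_m:
  assumes [measurable]: "f \<in> borel_measurable borel"
    and f: "\<And>\<xi>. \<xi> \<noteq> 0 \<Longrightarrow> norm (f \<xi>) \<le> (2 + norm \<xi>) * \<Theta> \<xi>"
  shows "adm (\<lambda>\<xi>. m n \<xi> * f \<xi>)"
proof -
  obtain r where r: "r > 0" "\<And>\<xi>. r < norm \<xi> \<Longrightarrow> m n \<xi> = 0" using m_support by blast
  have "integrable lborel (\<lambda>\<xi>. m n \<xi> * f \<xi>)"
  proof (rule Bochner_Integration.integrable_bound)
    have "integrable lborel (indicat_real (cball (0::real^3) r))"
      by (rule integrable_real_indicator) (simp, rule emeasure_bounded_finite, simp)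
    then show "integrable lborel (\<lambda>\<xi>. M ^ 3 * ((2 + r) * (3 * indicat_real (cball (0::real^3) r) \<xi> + \<Theta>\<^sub>2 \<xi>)))"
      by (intro integrable_mult_right Bochner_Integration.integrable_add Bochner_Integration.integrable_sum \<theta>_int)
    show "AE \<xi> in lborel. norm (m n \<xi> * f \<xi>) \<le> norm (M ^ 3 * ((2 + r) * (3 * indicat_real (cball (0::real^3) r) \<xi> + \<Theta>\<^sub>2 \<xi>)))"
      using AE_lborel_singleton[of "0::real^3"]
    proof eventually_elim
      case (elim \<xi>)
      show ?case
      proof (cases "norm \<xi> \<le> r")
        case True
        have "\<theta> i \<xi> \<le> 1 + (\<theta> i \<xi>)\<^sup>2" for i
          using sum_squares_bound[of "\<theta> i \<xi>" 1] by (simp add: \<theta>_nonneg)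
             (smt (verit) \<theta>_nonneg)
        then have "\<Theta> \<xi> \<le> (\<Sum>i\<in>(UNIV::3 set). 1 + (\<theta> i \<xi>)\<^sup>2)" by (intro sum_mono)
        then have "\<Theta> \<xi> \<le> 3 + \<Theta>\<^sub>2 \<xi>" by (simp add: sum.distrib)
        moreover have "0 \<le> \<Theta> \<xi>" by (intro sum_nonneg \<theta>_nonneg)
        ultimately have "(2 + norm \<xi>) * \<Theta> \<xi> \<le> (2 + r) * (3 + \<Theta>\<^sub>2 \<xi>)"
          using True r(1) by (intro mult_mono) auto
        then have "norm (f \<xi>) \<le> (2 + r) * (3 + \<Theta>\<^sub>2 \<xi>)"
          using f[OF elim] by linarith
        then have "norm (m n \<xi> * f \<xi>) \<le> M ^ 3 * ((2 + r) * (3 + \<Theta>\<^sub>2 \<xi>))"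
          unfolding norm_mult using M_nonneg by (intro mult_mono m_bound) auto
        then show ?thesis using True by (simp add: order_trans[OF _ abs_ge_self])
      next
        case False
        then show ?thesis by (simp add: r(2))
      qed
    qed
  qed measurable
  then show ?thesis unfolding adm_def using r(2) by (auto intro!: exI[of _ r])
qed

text \<open>Since the symbol is bounded by \<theta> without a factor |\<xi>|, the L^2 bound does not
  see the width of the frequency window.\<close>

lemma Re_inv_fourier_L2:
  assumes [measurable]: "f \<in> borel_measurable borel"
    and f: "\<And>\<xi>. \<xi> \<noteq> 0 \<Longrightarrow> norm (f \<xi>) \<le> 2 * \<Theta> \<xi>"
  shows "adm (\<lambda>\<xi>. m n \<xi> * f \<xi>)"
    and "integrable lborel (\<lambda>x. (Re (inv_fourier (\<lambda>\<xi>. m n \<xi> * f \<xi>) x))\<^sup>2)"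
    and "(LBINT x. (Re (inv_fourier (\<lambda>\<xi>. m n \<xi> * f \<xi>) x))\<^sup>2) \<le> K"
proof -
  define h where "h \<xi> = m n \<xi> * f \<xi>" for \<xi>
  have [measurable]: "h \<in> borel_measurable borel" unfolding h_def[abs_def] by measurable
  show adm: "adm (\<lambda>\<xi>. m n \<xi> * f \<xi>)"
  proof (rule adm_m)
    fix \<xi> :: "real^3" assume "\<xi> \<noteq> 0"
    have "2 * \<Theta> \<xi> \<le> (2 + norm \<xi>) * \<Theta> \<xi>"
      by (intro mult_right_mono sum_nonneg \<theta>_nonneg) auto
    then show "norm (f \<xi>) \<le> (2 + norm \<xi>) * \<Theta> \<xi>" using f[OF \<open>\<xi> \<noteq> 0\<close>] by linarith
  qed measurable
  have h1: "integrable lborel h" using adm by (simp add: adm_def h_def[abs_def])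
  have bound: "AE \<xi> in lborel. (norm (h \<xi>))\<^sup>2 \<le> 12 * M ^ 6 * \<Theta>\<^sub>2 \<xi>"
    using AE_lborel_singleton[of "0::real^3"]
  proof eventually_elim
    case (elim \<xi>)
    have "norm (h \<xi>) \<le> M ^ 3 * (2 * \<Theta> \<xi>)"
      unfolding h_def norm_mult using M_nonneg by (intro mult_mono m_bound f elim) auto
    then have "(norm (h \<xi>))\<^sup>2 \<le> (M ^ 3 * (2 * \<Theta> \<xi>))\<^sup>2" by (intro power_mono) auto
    also have "\<dots> = 4 * M ^ 6 * (\<Sum>i\<in>UNIV. 1 * \<theta> i \<xi>)\<^sup>2" by (simp add: power_mult_distrib flip: power_mult)
    also have "\<dots> \<le> 4 * M ^ 6 * ((\<Sum>i\<in>(UNIV::3 set). 1\<^sup>2) * \<Theta>\<^sub>2 \<xi>)"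
      using M_nonneg by (intro mult_left_mono Cauchy_Schwarz_ineq_sum) auto
    finally show ?case by simp
  qed
  have i: "integrable lborel (\<lambda>\<xi>. 12 * M ^ 6 * \<Theta>\<^sub>2 \<xi>)"
    by (intro integrable_mult_right Bochner_Integration.integrable_sum \<theta>_int)
  have h2: "integrable lborel (\<lambda>\<xi>. (norm (h \<xi>))\<^sup>2)"
    by (rule Bochner_Integration.integrable_bound[OF i]) (use bound in \<open>auto elim!: eventually_mono intro: order_trans[OF _ abs_ge_self]\<close>)
  have "(LBINT \<xi>. (norm (h \<xi>))\<^sup>2) \<le> (LBINT \<xi>. 12 * M ^ 6 * \<Theta>\<^sub>2 \<xi>)"
    by (intro integral_mono_AE h2 i bound)
  also have "\<dots> = 12 * M ^ 6 * (\<Sum>i\<in>UNIV. LBINT \<xi>. (\<theta> i \<xi>)\<^sup>2)"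
    by (simp add: Bochner_Integration.integral_sum \<theta>_int)
  finally have hK: "(2 * pi) ^ CARD(3) * (LBINT \<xi>. (norm (h \<xi>))\<^sup>2) \<le> K"
    unfolding K_def by (simp add: mult_left_mono)
  note F = inv_fourier_L2[OF h1 h2]
  have [measurable]: "inv_fourier h \<in> borel_measurable borel"
    using continuous_inv_fourier[OF adm] unfolding h_def[abs_def] by (rule borel_measurable_continuous_onI)
  have Re: "(Re z)\<^sup>2 \<le> (norm z)\<^sup>2" for z :: complex
    using abs_Re_le_cmod[of z] by (simp add: abs_le_square_iff[symmetric])
  have iR: "integrable lborel (\<lambda>x. (Re (inv_fourier h x))\<^sup>2)"
    by (rule Bochner_Integration.integrable_bound[OF F(1)]) (auto simp: Re)
  then show "integrable lborel (\<lambda>x. (Re (inv_fourier (\<lambda>\<xi>. m n \<xi> * f \<xi>) x))\<^sup>2)"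
    by (simp add: h_def[abs_def])
  have "(LBINT x. (Re (inv_fourier h x))\<^sup>2) \<le> (LBINT x. (norm (inv_fourier h x))\<^sup>2)"
    by (intro integral_mono iR F(1) Re)
  with F(2) hK show "(LBINT x. (Re (inv_fourier (\<lambda>\<xi>. m n \<xi> * f \<xi>) x))\<^sup>2) \<le> K"
    by (simp add: h_def[abs_def])
qed

lemma adm_hv: "adm (hv n i)"
  unfolding hv_def[abs_def]
proof (rule adm_m)
  fix \<xi> :: "real^3" assume "\<xi> \<noteq> 0"
  then have "norm (\<gamma> i \<xi>) = norm \<xi> * \<theta> i \<xi>" by (rule \<gamma>_\<theta>)
  also have "\<dots> \<le> (2 + norm \<xi>) * \<Theta> \<xi>"
    using member_le_sum[of i UNIV "\<lambda>i. \<theta> i \<xi>"] by (intro mult_mono) (auto simp: \<theta>_nonneg)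
  finally show "norm (\<gamma> i \<xi>) \<le> (2 + norm \<xi>) * \<Theta> \<xi>" .
qed measurable

lemma hB_symbol:
  "symB i j \<in> borel_measurable borel"
  "\<xi> \<noteq> 0 \<Longrightarrow> norm (symB i j \<xi>) \<le> 2 * \<Theta> \<xi>"
proof -
  show "symB i j \<in> borel_measurable borel"
    by measurable
  assume \<xi>: "\<xi> \<noteq> 0"
  have "norm (\<xi> $ j * \<gamma> i \<xi> - \<xi> $ i * \<gamma> j \<xi>) \<le> \<bar>\<xi> $ j\<bar> * norm (\<gamma> i \<xi>) + \<bar>\<xi> $ i\<bar> * norm (\<gamma> j \<xi>)"
    by (rule order_trans[OF norm_triangle_ineq4]) (simp add: norm_mult)
  also have "\<dots> \<le> norm \<xi> * (norm \<xi> * \<theta> i \<xi>) + norm \<xi> * (norm \<xi> * \<theta> j \<xi>)"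
    unfolding \<gamma>_\<theta>[OF \<xi>] by (intro add_mono mult_right_mono component_le_norm_cart) (auto simp: \<theta>_nonneg)
  finally have "norm (\<xi> $ j * \<gamma> i \<xi> - \<xi> $ i * \<gamma> j \<xi>) \<le> (norm \<xi>)\<^sup>2 * (\<theta> i \<xi> + \<theta> j \<xi>)"
    by (simp add: power2_eq_square algebra_simps)
  then have "norm (symB i j \<xi>) \<le> \<theta> i \<xi> + \<theta> j \<xi>"
    using \<xi> by (simp add: norm_divide norm_mult norm_power divide_le_eq mult.commute)
  also have "\<dots> \<le> 2 * \<Theta> \<xi>"
    using member_le_sum[of i UNIV "\<lambda>i. \<theta> i \<xi>"] member_le_sum[of j UNIV "\<lambda>i. \<theta> i \<xi>"] by (simp add: \<theta>_nonneg)
  finally show "norm (symB i j \<xi>) \<le> 2 * \<Theta> \<xi>" .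
qed

lemma hH_symbol:
  "symH \<in> borel_measurable borel"
  "\<xi> \<noteq> 0 \<Longrightarrow> norm (symH \<xi>) \<le> 2 * \<Theta> \<xi>"
proof -
  show "symH \<in> borel_measurable borel"
    by measurable
  assume \<xi>: "\<xi> \<noteq> 0"
  have "norm (\<Sum>j\<in>UNIV. \<xi> $ j * \<gamma> j \<xi>) \<le> (\<Sum>j\<in>UNIV. \<bar>\<xi> $ j\<bar> * norm (\<gamma> j \<xi>))"
    by (rule order_trans[OF norm_sum]) (simp add: norm_mult)
  also have "\<dots> \<le> (\<Sum>j\<in>UNIV. norm \<xi> * (norm \<xi> * \<theta> j \<xi>))"
    unfolding \<gamma>_\<theta>[OF \<xi>] by (intro sum_mono mult_right_mono component_le_norm_cart) (auto simp: \<theta>_nonneg)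
  also have "\<dots> = (norm \<xi>)\<^sup>2 * (\<Sum>j\<in>UNIV. \<theta> j \<xi>)"
    by (simp add: power2_eq_square sum_distrib_left mult.assoc)
  finally have "norm (symH \<xi>) \<le> (\<Sum>j\<in>UNIV. \<theta> j \<xi>)"
    using \<xi> by (simp add: norm_divide norm_mult norm_power divide_le_eq mult.commute)
  also have "\<dots> \<le> 2 * \<Theta> \<xi>"
    by (simp add: sum_nonneg \<theta>_nonneg)
  finally show "norm (symH \<xi>) \<le> 2 * \<Theta> \<xi>" .
qed

lemma adm_hB: "adm (hB n i j)" and B_L2: "integrable lborel (\<lambda>x. (Re (inv_fourier (hB n i j) x))\<^sup>2)"
  "(LBINT x. (Re (inv_fourier (hB n i j) x))\<^sup>2) \<le> K"
  using Re_inv_fourier_L2[OF hB_symbol] unfolding hB_def[abs_def] by auto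

lemma adm_hH: "adm (hH n)" and H_L2: "integrable lborel (\<lambda>x. (Re (inv_fourier (hH n) x))\<^sup>2)"
  using Re_inv_fourier_L2[OF hH_symbol] unfolding hH_def[abs_def] by auto

section \<open>The regularised velocity and its divergence\<close>

lemma u_weight: "integrable lborel (\<lambda>y. \<bar>u i y\<bar> * weight (y - x))"
proof (rule Bochner_Integration.integrable_bound)
  show "integrable lborel (\<lambda>y. weight (y - x) + \<bar>u i y\<bar> powr p)"
    using lborel_integrable_translate[OF weight_integrable, of "- x"]
    by (intro Bochner_Integration.integrable_add u_Lp) simp
  have [measurable]: "u i \<in> borel_measurable borel" by (rule borel_measurable_continuous_onI[OF u_cont(1)])
  have [measurable]: "weight \<in> borel_measurable borel" using borel_measurable_integrable[OF weight_integrable] by simp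
  show "(\<lambda>y. \<bar>u i y\<bar> * weight (y - x)) \<in> borel_measurable lborel" by measurable
  show "AE y in lborel. norm (\<bar>u i y\<bar> * weight (y - x)) \<le> norm (weight (y - x) + \<bar>u i y\<bar> powr p)" (is "AE y in lborel. ?P y")
  proof (rule AE_I2)
    fix y
    have w: "0 \<le> weight (y - x)" "weight (y - x) \<le> 1" by (rule weight_nonneg weight_le_1)+
    have "\<bar>u i y\<bar> * weight (y - x) \<le> weight (y - x) + \<bar>u i y\<bar> powr p"
    proof (cases "\<bar>u i y\<bar> \<le> 1")
      case True
      then show ?thesis using mult_right_mono[OF True w(1)] by (simp add: add_increasing2)
    next
      case False
      then have "\<bar>u i y\<bar> powr 1 \<le> \<bar>u i y\<bar> powr p" using p by (intro powr_mono) auto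
      then show ?thesis using False w mult_left_mono[OF w(2), of "\<bar>u i y\<bar>"] by simp
    qed
    then show "?P y"
      using w by (simp add: abs_mult)
  qed
qed

lemma u_prod_ft_integrable:
  assumes f: "\<And>j. f j \<in> bumps"
  shows "integrable lborel (\<lambda>y. complex_of_real (u i y) * ft_prod f (y - x))"
    and "integrable lborel (\<lambda>y. u i y * Re (ft_prod f (y - x)))"
proof -
  obtain C where C: "C \<ge> 0" "\<And>y. norm (ft_prod f y) \<le> C * weight y"
    using prod_ft_le_weight[of f] f by blast
  show 1: "integrable lborel (\<lambda>y. complex_of_real (u i y) * ft_prod f (y - x))"
  proof (rule Bochner_Integration.integrable_bound)
    show "integrable lborel (\<lambda>y. C * (\<bar>u i y\<bar> * weight (y - x)))"
      by (intro integrable_mult_right u_weight)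
    show "(\<lambda>y. complex_of_real (u i y) * ft_prod f (y - x)) \<in> borel_measurable lborel"
      using continuous_prod_ft[of f x] f u_cont by (auto intro!: borel_measurable_continuous_onI continuous_intros)
    show "AE y in lborel. norm (complex_of_real (u i y) * ft_prod f (y - x)) \<le> norm (C * (\<bar>u i y\<bar> * weight (y - x)))" (is "AE y in lborel. ?P y")
    proof (rule AE_I2)
      fix y
      have "\<bar>u i y\<bar> * norm (ft_prod f (y - x)) \<le> \<bar>u i y\<bar> * (C * weight (y - x))"
        by (intro mult_left_mono C) simp
      then show "?P y"
        using C(1) weight_nonneg[of "y - x"] by (simp add: norm_mult abs_mult mult_ac)
    qed
  qed
  from integrable_Re[OF 1] show "integrable lborel (\<lambda>y. u i y * Re (ft_prod f (y - x)))" by simp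
qed

lemma Re_dual:
  assumes f: "\<And>j. f j \<in> bumps"
  shows "Re (CLBINT \<xi>. \<gamma> i \<xi> * (\<Prod>j\<in>UNIV. cis (x $ j * \<xi> $ j) * f j (\<xi> $ j)))
    = (LBINT y. u i y * Re (ft_prod f (y - x)))"
proof -
  have "(CLBINT \<xi>. \<gamma> i \<xi> * (\<Prod>j\<in>UNIV. cis (x $ j * \<xi> $ j) * f j (\<xi> $ j)))
     = (CLBINT y. complex_of_real (u i y) * ft_prod f (y - x))"
    using dual[of "\<lambda>j t. cis (x $ j * t) * f j t" i] f by (simp add: bumps_modulate ft_modulate)
  moreover have "Re (CLBINT y. complex_of_real (u i y) * ft_prod f (y - x))
     = (LBINT y. Re (complex_of_real (u i y) * ft_prod f (y - x)))"
    by (rule integral_Re[symmetric]) (rule u_prod_ft_integrable[OF f])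
  ultimately show ?thesis by simp
qed

text \<open>Duality exhibits the regularised velocity as a convolution of u with an explicit kernel,
  so its convergence can be studied without inverting the transform of u.\<close>

lemma v_eq: "Re (inv_fourier (hv n i) x) = (LBINT y. u i y * Re (ft_prod (\<lambda>j. bn n) (y - x)))"
proof -
  have "inv_fourier (hv n i) x = (CLBINT \<xi>. \<gamma> i \<xi> * (\<Prod>j\<in>UNIV. cis (x $ j * \<xi> $ j) * bn n (\<xi> $ j)))"
    unfolding inv_fourier_def hv_def m_def cis_inner by (simp add: prod.distrib mult_ac)
  then show ?thesis using Re_dual[of "\<lambda>j. bn n"] by (simp add: bn_bumps)
qed

text \<open>The symbol of d_i times the multiplier is again a product of bumps, so duality applies
  and turns the divergence into the integral of u against the gradient of the kernel, which vanishes
  because div u = 0. \<open>f\<close> differentiates in x on the frequency side and \<open>g\<close>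
  differentiates the kernel in y; since the kernel depends on y - x, they differ by a sign.\<close>

lemma div_v: "(\<Sum>i\<in>UNIV. Re (inv_fourier (D i (hv n i)) x)) = 0"
proof -
  define f where "f i j = (if j = i then (\<lambda>t. \<i> * complex_of_real t * bn n t) else bn n)" for i j :: 3
  define g where "g i j = (if j = i then (\<lambda>t. - (\<i> * complex_of_real t) * bn n t) else bn n)" for i j :: 3
  have fb: "f i j \<in> bumps" and gb: "g i j \<in> bumps" for i j
    unfolding f_def g_def by (split if_split, intro conjI impI bumps_times_t bn_bumps)+
  have "Re (inv_fourier (D i (hv n i)) x) = - (LBINT y. u i y * Re (ft_prod (g i) (y - x)))" for i
  proof -
    have pf: "(\<Prod>j\<in>UNIV. cis (x $ j * \<xi> $ j) * f i j (\<xi> $ j)) = cis (x \<bullet> \<xi>) * (\<i> * complex_of_real (\<xi> $ i) * m n \<xi>)" for \<xi>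
    proof -
      have "(\<Prod>j\<in>UNIV. f i j (\<xi> $ j)) = (\<Prod>j\<in>UNIV. (if j = i then \<i> * complex_of_real (\<xi> $ i) else 1) * bn n (\<xi> $ j))"
        by (intro prod.cong refl) (simp add: f_def)
      also have "\<dots> = \<i> * complex_of_real (\<xi> $ i) * m n \<xi>"
        by (simp add: prod.distrib m_def)
      finally show ?thesis by (simp add: prod.distrib cis_inner)
    qed
    have "inv_fourier (D i (hv n i)) x = (CLBINT \<xi>. \<gamma> i \<xi> * (\<Prod>j\<in>UNIV. cis (x $ j * \<xi> $ j) * f i j (\<xi> $ j)))"
      unfolding inv_fourier_def D_def hv_def pf by (simp add: mult_ac)
    then have "Re (inv_fourier (D i (hv n i)) x) = (LBINT y. u i y * Re (ft_prod (f i) (y - x)))"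
      using Re_dual[of "f i" i x] fb by simp
    moreover have "ft_prod (f i) (y - x) = - ft_prod (g i) (y - x)" for y
    proof -
      have "ft (f i j) s = (if j = i then - 1 else 1) * ft (g i j) s" for j s
        by (auto simp: f_def g_def ft_def)
      then show ?thesis by (simp add: prod.distrib)
    qed
    ultimately show ?thesis by simp
  qed
  then have "(\<Sum>i\<in>UNIV. Re (inv_fourier (D i (hv n i)) x))
     = - (\<Sum>i\<in>UNIV. LBINT y. u i y * Re (ft_prod (g i) (y - x)))"
    by (simp add: sum_negf)
  also have "(\<Sum>i\<in>UNIV. LBINT y. u i y * Re (ft_prod (g i) (y - x))) = 0"
  proof (rule div_free_orthogonal_gradient[OF u_cont u_pd div_u])
    show "continuous_on UNIV (\<lambda>y. Re (ft_prod (\<lambda>j. bn n) (y - x)))"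
      using continuous_prod_ft[of "\<lambda>j. bn n" x] by (intro continuous_on_Re) (simp add: bn_bumps)
    show "continuous_on UNIV (\<lambda>y. Re (ft_prod (g i) (y - x)))" for i
      using continuous_prod_ft[of "g i" x] gb by (intro continuous_on_Re) simp
    show "pd i (\<lambda>y. Re (ft_prod (\<lambda>j. bn n) (y - x))) (\<lambda>y. Re (ft_prod (g i) (y - x)))" for i
      unfolding g_def by (rule pd_prod_ft[OF bn_bumps])
    show "integrable lborel (\<lambda>y. u i y * Re (ft_prod (\<lambda>j. bn n) (y - x)))" for i
      by (rule u_prod_ft_integrable) (rule bn_bumps)
    show "integrable lborel (\<lambda>y. u i y * Re (ft_prod (g i) (y - x)))" for i
      by (rule u_prod_ft_integrable) (rule gb)
  qed
  finally show ?thesis by simp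
qed

lemma H_gradient: "Re (inv_fourier (D k (hH n)) x) = 0"
proof (rule harmonic_L2_gradient)
  show "continuous_on UNIV (\<lambda>x. Re (inv_fourier (hH n) x))" by (intro continuous_Re_inv_fourier adm_hH)
  show "integrable lborel (\<lambda>x. (Re (inv_fourier (hH n) x))\<^sup>2)" by (rule H_L2)
  show "pd k (\<lambda>x. Re (inv_fourier (hH n) x)) (\<lambda>x. Re (inv_fourier (D k (hH n)) x))" for k
    by (intro pd_Re_inv_fourier adm_hH)
  show "continuous_on UNIV (\<lambda>x. Re (inv_fourier (D k (hH n)) x))" for k
    by (intro continuous_Re_inv_fourier adm_D adm_hH)
  show "pd k (\<lambda>x. Re (inv_fourier (D k (hH n)) x)) (\<lambda>x. Re (inv_fourier (D k (D k (hH n))) x))" for k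
    by (intro pd_Re_inv_fourier adm_D adm_hH)
  show "continuous_on UNIV (\<lambda>x. Re (inv_fourier (D k (D k (hH n))) x))" for k
    by (intro continuous_Re_inv_fourier adm_D adm_hH)
  fix x
  have "(\<Sum>k\<in>UNIV. D k (D k (hH n)) \<xi>) = (\<Sum>i\<in>UNIV. D i (hv n i) \<xi>)" for \<xi>
  proof -
    have "(\<Sum>k\<in>UNIV. D k (D k (hH n)) \<xi>) = (\<Sum>k\<in>UNIV. - complex_of_real ((\<xi> $ k)\<^sup>2) * hH n \<xi>)"
      by (intro sum.cong refl) (simp add: D_def power2_eq_square algebra_simps)
    also have "\<dots> = - complex_of_real ((norm \<xi>)\<^sup>2) * hH n \<xi>"
      by (simp add: sum_negf sum_distrib_right flip: sum_squares_norm)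
    \<comment> \<open>At \<xi> = 0 both sides vanish: the left by |\<xi>|^2, the right by the
      factors \<xi>_j.\<close>
    also have "\<dots> = m n \<xi> * (\<i> * (\<Sum>j\<in>UNIV. \<xi> $ j * \<gamma> j \<xi>))"
      by (cases "\<xi> = 0") (simp_all add: hH_def)
    also have "\<dots> = (\<Sum>i\<in>UNIV. D i (hv n i) \<xi>)"
      by (simp add: D_def hv_def sum_distrib_left mult_ac)
    finally show ?thesis .
  qed
  then have "(\<Sum>k\<in>UNIV. inv_fourier (D k (D k (hH n))) x) = (\<Sum>i\<in>UNIV. inv_fourier (D i (hv n i)) x)"
    by (simp add: adm_D adm_hH adm_hv flip: inv_fourier_sum)
  then have "Re (\<Sum>k\<in>UNIV. inv_fourier (D k (D k (hH n))) x) = Re (\<Sum>i\<in>UNIV. inv_fourier (D i (hv n i)) x)" by simp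
  then show "(\<Sum>k\<in>UNIV. Re (inv_fourier (D k (D k (hH n))) x)) = 0" by (simp add: div_v)
qed

text \<open>Away from the origin the symbol of the divergence is the multiplier times \<gamma>_i -
  \<xi>_i (\<xi> . \<gamma>) / |\<xi>|^2, the projection onto divergence free fields; the subtracted
  term is the gradient of H and disappears by \<open>H_gradient\<close>.\<close>

lemma div_B: "(\<Sum>j\<in>UNIV. Re (inv_fourier (D j (hB n i j)) x)) = Re (inv_fourier (hv n i) x)"
proof -
  have "inv_fourier (\<lambda>\<xi>. \<Sum>j\<in>UNIV. D j (hB n i j) \<xi>) x = inv_fourier (\<lambda>\<xi>. hv n i \<xi> - D i (hH n) \<xi>) x"
  proof (rule inv_fourier_cong_AE)
    show "AE \<xi> in lborel. (\<Sum>j\<in>UNIV. D j (hB n i j) \<xi>) = hv n i \<xi> - D i (hH n) \<xi>"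
      using AE_lborel_singleton[of "0::real^3"]
    proof eventually_elim
      case (elim \<xi>)
      define N where "N = complex_of_real ((norm \<xi>)\<^sup>2)"
      have N: "N \<noteq> 0" using elim by (simp add: N_def)
      have N2: "N = (\<Sum>j\<in>UNIV. complex_of_real (\<xi> $ j) * complex_of_real (\<xi> $ j))"
        unfolding N_def sum_squares_norm[symmetric] by (simp add: power2_eq_square)
      have "(\<Sum>j\<in>UNIV. D j (hB n i j) \<xi>)
        = (\<Sum>j\<in>UNIV. m n \<xi> * (\<gamma> i \<xi> * (complex_of_real (\<xi> $ j) * complex_of_real (\<xi> $ j)) - \<xi> $ i * (\<xi> $ j * \<gamma> j \<xi>)) / N)"
        by (intro sum.cong refl) (simp add: D_def hB_def N_def algebra_simps)
      also have "\<dots> = m n \<xi> * (\<gamma> i \<xi> * N - \<xi> $ i * (\<Sum>j\<in>UNIV. \<xi> $ j * \<gamma> j \<xi>)) / N"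
        unfolding N2[symmetric] sum_divide_distrib[symmetric] sum_distrib_left[symmetric] sum_subtractf ..
      also have "\<dots> = hv n i \<xi> - D i (hH n) \<xi>"
      proof -
        have "(complex_of_real (norm \<xi>))\<^sup>2 = N" by (simp add: N_def)
        then show ?thesis using N by (simp add: hv_def D_def hH_def field_simps)
      qed
      finally show ?case .
    qed
    show "(\<lambda>\<xi>. \<Sum>j\<in>UNIV. D j (hB n i j) \<xi>) \<in> borel_measurable borel"
      by (intro borel_measurable_sum adm_measurable adm_D adm_hB)
    show "(\<lambda>\<xi>. hv n i \<xi> - D i (hH n) \<xi>) \<in> borel_measurable borel"
      by (intro borel_measurable_diff adm_measurable adm_D adm_hH adm_hv)
  qed
  then have "Re (\<Sum>j\<in>UNIV. inv_fourier (D j (hB n i j)) x) = Re (inv_fourier (hv n i) x - inv_fourier (D i (hH n)) x)"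
    by (simp add: inv_fourier_sum inv_fourier_diff adm_D adm_hB adm_hv adm_hH)
  then show ?thesis by (simp add: H_gradient)
qed

lemma lap_B: "(\<Sum>k\<in>UNIV. Re (inv_fourier (D k (D k (hB n i j))) x))
   = Re (inv_fourier (D j (hv n i)) x) - Re (inv_fourier (D i (hv n j)) x)"
proof -
  have "(\<Sum>k\<in>UNIV. D k (D k (hB n i j)) \<xi>) = D j (hv n i) \<xi> - D i (hv n j) \<xi>" for \<xi>
  proof -
    have "(\<Sum>k\<in>UNIV. D k (D k (hB n i j)) \<xi>) = (\<Sum>k\<in>UNIV. - complex_of_real ((\<xi> $ k)\<^sup>2) * hB n i j \<xi>)"
      by (intro sum.cong refl) (simp add: D_def power2_eq_square algebra_simps)
    also have "\<dots> = - complex_of_real ((norm \<xi>)\<^sup>2) * hB n i j \<xi>"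
      by (simp add: sum_negf sum_distrib_right flip: sum_squares_norm)
    also have "\<dots> = m n \<xi> * (\<i> * (\<xi> $ j * \<gamma> i \<xi> - \<xi> $ i * \<gamma> j \<xi>))"
      by (cases "\<xi> = 0") (simp_all add: hB_def)
    also have "\<dots> = D j (hv n i) \<xi> - D i (hv n j) \<xi>"
      by (simp add: D_def hv_def algebra_simps)
    finally show ?thesis .
  qed
  then have "(\<Sum>k\<in>UNIV. inv_fourier (D k (D k (hB n i j))) x) = inv_fourier (D j (hv n i)) x - inv_fourier (D i (hv n j)) x"
    by (simp add: adm_D adm_hB adm_hv flip: inv_fourier_sum inv_fourier_diff)
  then have "Re (\<Sum>k\<in>UNIV. inv_fourier (D k (D k (hB n i j))) x) = Re (inv_fourier (D j (hv n i)) x - inv_fourier (D i (hv n j)) x)"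
    by simp
  then show ?thesis by simp
qed

section \<open>The smoothing kernel as an approximate identity\<close>

abbreviation "\<beta> \<equiv> ft (\<lambda>t. complex_of_real (b t))"

definition G :: "nat \<Rightarrow> real^3 \<Rightarrow> complex" where
  "G n y = (\<Prod>j\<in>UNIV. ft (bn n) (y $ j))"

lemma ft_bn: "ft (bn n) s = real (Suc n) * \<beta> (real (Suc n) * s)"
proof -
  define N where "N = real (Suc n)"
  have N: "N > 0" by (simp add: N_def)
  have "\<beta> (N * s) = \<bar>1 / N\<bar> *\<^sub>R (CLBINT t. cis (- (N * s * (0 + 1 / N * t))) * complex_of_real (b (0 + 1 / N * t)))"
    unfolding ft_def using N by (intro lborel_integral_real_affine) auto
  also have "\<dots> = complex_of_real (1 / N) * ft (bn n) s"
    using N by (simp add: ft_def bn_def N_def[symmetric] scaleR_conv_of_real del: of_nat_Suc)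
  finally show ?thesis using N by (simp add: N_def[symmetric] del: of_nat_Suc)
qed

lemma G_integrable: "integrable lborel (G n)" and G_integral: "(LBINT y. G n y) = 1"
proof -
  note i = integral_ft(1)[OF bn_bumps[of n]]
  show "integrable lborel (G n)" unfolding G_def[abs_def] by (intro integral_lborel_prod_cart i)
  have "(LBINT y. G n y) = (\<Prod>j\<in>(UNIV::3 set). LBINT s. ft (bn n) s)"
    unfolding G_def[abs_def] by (intro integral_lborel_prod_cart i)
  also have "\<dots> = 1" unfolding integral_ft(2)[OF bn_bumps] by (simp add: bn_def b(4))
  finally show "(LBINT y. G n y) = 1" .
qed

text \<open>The kernel need not be positive, so its L^1 norm is required beside its integral;
  scaling makes this norm independent of n.\<close>

lemma G_L1: "(LBINT y. norm (G n y)) = (LBINT s. norm (\<beta> s)) ^ 3"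
proof -
  have i: "integrable lborel (\<lambda>s. norm (ft (bn n) s))"
    by (intro integrable_norm integral_ft bn_bumps)
  have "(LBINT y. norm (G n y)) = (\<Prod>j\<in>(UNIV::3 set). LBINT s. norm (ft (bn n) s))"
    unfolding G_def[abs_def] prod_norm[symmetric] by (intro integral_lborel_prod_cart_real i)
  also have "(LBINT s. norm (ft (bn n) s)) = (LBINT s. norm (\<beta> s))"
  proof -
    have "(LBINT s. norm (\<beta> s)) = \<bar>real (Suc n)\<bar> *\<^sub>R (LBINT s. norm (\<beta> (0 + real (Suc n) * s)))"
      by (intro lborel_integral_real_affine) auto
    then show ?thesis unfolding ft_bn by (simp add: norm_mult del: of_nat_Suc)
  qed
  finally show ?thesis by simp
qed

text \<open>With Q the product of 1 + (N y_j)^2, the kernel is at most N^3 C^3 / Q^3. One factor 1 /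
  Q is below the weight; the other two are below (N \<delta>)^-4, because Q \<ge> |N y|^2. The
  powers of N combine to 1 / N.\<close>

lemma G_tail:
  assumes \<beta>: "\<And>s. norm (\<beta> s) \<le> C / (1 + s\<^sup>2) ^ 3" and C: "C \<ge> 0" and \<delta>: "0 < \<delta>" "\<delta> \<le> norm y"
  shows "norm (G n y) \<le> C ^ 3 / \<delta> ^ 4 * (1 / real (Suc n)) * weight y"
proof -
  define N where "N = real (Suc n)"
  have N: "N \<ge> 1" by (simp add: N_def)
  define Q where "Q = (\<Prod>j\<in>UNIV. 1 + (N * y $ j)\<^sup>2)"
  have "1 + (\<Sum>j\<in>UNIV. (N * y $ j)\<^sup>2) \<le> Q"
    unfolding Q_def by (rule prod_one_plus_ge) auto
  moreover have "(\<Sum>j\<in>UNIV. (N * y $ j)\<^sup>2) = N\<^sup>2 * (norm y)\<^sup>2"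
    by (simp add: power_mult_distrib sum_distrib_left flip: sum_squares_norm)
  moreover have "N\<^sup>2 * \<delta>\<^sup>2 \<le> N\<^sup>2 * (norm y)\<^sup>2"
    using \<delta> by (intro mult_left_mono power_mono) auto
  ultimately have Q1: "N\<^sup>2 * \<delta>\<^sup>2 \<le> Q" by linarith
  have Npos: "0 < N\<^sup>2 * \<delta>\<^sup>2" using N \<delta> by simp
  then have Q0: "Q > 0" using Q1 by linarith
  have "inverse Q \<le> weight y"
    unfolding Q_def weight_def prod_inversef[symmetric] comp_def
  proof (intro prod_mono conjI)
    fix j
    have "(y $ j)\<^sup>2 \<le> (N * y $ j)\<^sup>2"
      using N by (simp add: power_mult_distrib mult_le_cancel_right1 one_le_power)
    then show "inverse (1 + (N * y $ j)\<^sup>2) \<le> inverse (1 + (y $ j)\<^sup>2)"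
      by (intro le_imp_inverse_le) (auto intro: add_pos_nonneg)
  qed simp
  moreover have "(inverse Q)\<^sup>2 \<le> (inverse (N\<^sup>2 * \<delta>\<^sup>2))\<^sup>2"
    using Q1 Npos by (intro power_mono le_imp_inverse_le) auto
  ultimately have Q3: "inverse Q * (inverse Q)\<^sup>2 \<le> weight y * (inverse (N\<^sup>2 * \<delta>\<^sup>2))\<^sup>2"
    using weight_nonneg Q0 by (intro mult_mono) auto
  have "norm (G n y) = (\<Prod>j\<in>UNIV. N * norm (\<beta> (N * y $ j)))"
    unfolding G_def prod_norm[symmetric] ft_bn N_def[symmetric] using N by (simp add: norm_mult)
  also have "\<dots> \<le> (\<Prod>j\<in>UNIV. N * (C / (1 + (N * y $ j)\<^sup>2) ^ 3))"
    using N by (intro prod_mono conjI mult_left_mono \<beta>) auto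
  also have "\<dots> = N ^ 3 * C ^ 3 * (inverse Q * (inverse Q)\<^sup>2)"
    by (simp add: Q_def prod.distrib divide_inverse prod_inversef[symmetric] prod_power_distrib power_inverse[symmetric] eval_nat_numeral)
  also have "\<dots> \<le> N ^ 3 * C ^ 3 * (weight y * (inverse (N\<^sup>2 * \<delta>\<^sup>2))\<^sup>2)"
    using N C by (intro mult_left_mono Q3) auto
  also have "\<dots> = C ^ 3 / \<delta> ^ 4 * (1 / N) * weight y"
    using N \<delta> by (simp add: field_simps eval_nat_numeral)
  finally show ?thesis by (simp add: N_def)
qed

text \<open>Near x, uniform continuity of u is paired with the L^1 norm of the kernel. Far from x,
  the tail bound applies with |u(y)| \<le> 1 + |u(y)|^p: the constant is integrated against the
  weight, and the power by itself.\<close>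

lemma v_lim: "uniform_limit (cball 0 R) (\<lambda>n x. Re (inv_fourier (hv n i) x)) (u i) sequentially"
proof (rule uniform_limitI)
  fix \<epsilon> :: real assume \<epsilon>: "\<epsilon> > 0"
  define I where "I = (LBINT s. norm (\<beta> s)) ^ 3"
  have I: "I \<ge> 0" by (simp add: I_def)
  define \<eta> where "\<eta> = \<epsilon> / (2 * (I + 1))"
  have \<eta>: "\<eta> > 0" using \<epsilon> I by (simp add: \<eta>_def)
  have \<eta>I: "\<eta> * I \<le> \<epsilon> / 2"
    using I \<epsilon> by (simp add: \<eta>_def divide_le_eq)
  have "bounded (u i ` cball 0 R)"
    by (intro compact_imp_bounded compact_continuous_image continuous_on_subset[OF u_cont(1)]) auto
  then obtain A where A: "A > 0" "\<And>x. norm x \<le> R \<Longrightarrow> \<bar>u i x\<bar> \<le> A"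
    unfolding bounded_pos by (metis imageI mem_cball_0 real_norm_def)
  have "uniformly_continuous_on (cball 0 (R + 1)) (u i)"
    by (intro compact_uniformly_continuous continuous_on_subset[OF u_cont(1)]) auto
  then obtain d where d: "d > 0" "\<And>x y. norm x \<le> R + 1 \<Longrightarrow> norm y \<le> R + 1 \<Longrightarrow> dist y x < d \<Longrightarrow> dist (u i y) (u i x) < \<eta>"
    unfolding uniformly_continuous_on_def using \<eta> by (metis mem_cball_0)
  \<comment> \<open>At most 1, so that y stays in the ball of radius R + 1 on which u is uniformly
    continuous.\<close>
  define \<delta> where "\<delta> = min d 1"
  have \<delta>: "\<delta> > 0" using d by (simp add: \<delta>_def)
  have close: "\<bar>u i y - u i x\<bar> \<le> \<eta>" if "norm x \<le> R" "norm (y - x) < \<delta>" for x y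
  proof -
    have "norm y \<le> R + 1" using that norm_triangle_sub[of y x] by (simp add: \<delta>_def)
    then show ?thesis using d(2)[of x y] that by (simp add: \<delta>_def dist_norm)
  qed
  obtain C where C: "C \<ge> 0" "\<And>s. norm (\<beta> s) \<le> C / (1 + s\<^sup>2) ^ 3" using ft_decay[OF b(1)] by blast
  define W where "W = (LBINT y. weight y)"
  define L where "L = (LBINT y. \<bar>u i y\<bar> powr p)"
  define c where "c n = C ^ 3 / \<delta> ^ 4 * (1 / real (Suc n))" for n
  have c: "0 \<le> c n" for n using C \<delta> by (simp add: c_def)
  have "(\<lambda>n. c n * ((1 + A) * W + L)) \<longlonglongrightarrow> C ^ 3 / \<delta> ^ 4 * 0 * ((1 + A) * W + L)"
    unfolding c_def by (intro tendsto_intros LIMSEQ_Suc[OF lim_1_over_n])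
  then have "\<forall>\<^sub>F n in sequentially. c n * ((1 + A) * W + L) < \<epsilon> / 2"
    using \<epsilon> by (intro order_tendstoD(2)) auto
  then show "\<forall>\<^sub>F n in sequentially. \<forall>x\<in>cball 0 R. dist (Re (inv_fourier (hv n i) x)) (u i x) < \<epsilon>"
  proof eventually_elim
    case (elim n)
    show ?case
    proof
      fix x :: "real^3" assume "x \<in> cball 0 R"
      then have x: "norm x \<le> R" by simp
      have Gi: "integrable lborel (\<lambda>y. G n (y - x))"
        using lborel_integrable_translate[OF G_integrable[of n], of "- x"] by simp
      have Wi: "integrable lborel (\<lambda>y. weight (y - x))"
        using lborel_integrable_translate[OF weight_integrable, of "- x"] by simp
      have uGi: "integrable lborel (\<lambda>y. u i y * Re (G n (y - x)))"
        unfolding G_def by (rule u_prod_ft_integrable) (rule bn_bumps)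
      have "(LBINT y. G n (y - x)) = 1"
        using lborel_integral_translate[where f="G n" and a="- x"] by (simp add: G_integral)
      then have 1: "(LBINT y. Re (G n (y - x))) = 1"
        by (simp add: integral_Re[OF Gi])
      have "Re (inv_fourier (hv n i) x) - u i x = (LBINT y. u i y * Re (G n (y - x))) - (LBINT y. u i x * Re (G n (y - x)))"
        unfolding v_eq G_def[symmetric] by (simp add: 1)
      also have "\<dots> = (LBINT y. u i y * Re (G n (y - x)) - u i x * Re (G n (y - x)))"
        by (intro Bochner_Integration.integral_diff[symmetric] uGi integrable_mult_right integrable_Re Gi)
      finally have "\<bar>Re (inv_fourier (hv n i) x) - u i x\<bar> = \<bar>LBINT y. u i y * Re (G n (y - x)) - u i x * Re (G n (y - x))\<bar>"
        by simp
      also have "\<dots> \<le> (LBINT y. \<eta> * norm (G n (y - x)) + c n * ((1 + A) * weight (y - x) + \<bar>u i y\<bar> powr p))" (is "_ \<le> (LBINT y. ?g y)")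
      proof (rule abs_integral_le)
        show "integrable lborel (\<lambda>y. u i y * Re (G n (y - x)) - u i x * Re (G n (y - x)))"
          by (intro Bochner_Integration.integrable_diff uGi integrable_mult_right integrable_Re Gi)
        show "integrable lborel ?g"
          by (intro Bochner_Integration.integrable_add integrable_mult_right integrable_norm Gi Wi u_Lp)
        fix y
        have w: "0 \<le> weight (y - x)" "weight (y - x) \<le> 1" by (rule weight_nonneg weight_le_1)+
        have "\<bar>u i y * Re (G n (y - x)) - u i x * Re (G n (y - x))\<bar> = \<bar>u i y - u i x\<bar> * \<bar>Re (G n (y - x))\<bar>"
          by (simp add: left_diff_distrib[symmetric] abs_mult)
        also have "\<dots> \<le> \<bar>u i y - u i x\<bar> * norm (G n (y - x))"
          by (intro mult_left_mono abs_Re_le_cmod) simp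
        also have "\<dots> \<le> ?g y"
        proof (cases "norm (y - x) < \<delta>")
          case True
          then have "\<bar>u i y - u i x\<bar> * norm (G n (y - x)) \<le> \<eta> * norm (G n (y - x))"
            by (intro mult_right_mono close x) auto
          moreover have "0 \<le> c n * ((1 + A) * weight (y - x) + \<bar>u i y\<bar> powr p)"
            using c w A by (intro mult_nonneg_nonneg add_nonneg_nonneg) auto
          ultimately show ?thesis by simp
        next
          case False
          have "\<bar>u i y\<bar> \<le> 1 + \<bar>u i y\<bar> powr p"
          proof (cases "\<bar>u i y\<bar> \<le> 1")
            case False
            then have "\<bar>u i y\<bar> powr 1 \<le> \<bar>u i y\<bar> powr p" using p by (intro powr_mono) auto
            then show ?thesis using False by simp
          qed (simp add: add_increasing2)
          then have "\<bar>u i y - u i x\<bar> \<le> (1 + A) + \<bar>u i y\<bar> powr p" using A(2)[OF x] by linarith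
          moreover have "norm (G n (y - x)) \<le> c n * weight (y - x)"
            unfolding c_def using False by (intro G_tail[OF C(2,1) \<delta>]) simp
          ultimately have "\<bar>u i y - u i x\<bar> * norm (G n (y - x)) \<le> ((1 + A) + \<bar>u i y\<bar> powr p) * (c n * weight (y - x))"
            using A by (intro mult_mono) auto
          also have "\<dots> = c n * ((1 + A) * weight (y - x) + \<bar>u i y\<bar> powr p * weight (y - x))"
            by (simp add: algebra_simps)
          also have "\<dots> \<le> c n * ((1 + A) * weight (y - x) + \<bar>u i y\<bar> powr p * 1)"
            by (intro mult_left_mono add_left_mono w c) auto
          moreover have "0 \<le> \<eta> * norm (G n (y - x))" using \<eta> by simp
          ultimately show ?thesis by simp
        qed
        finally show "\<bar>u i y * Re (G n (y - x)) - u i x * Re (G n (y - x))\<bar>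
          \<le> ?g y" .
      qed
      also have "\<dots> = \<eta> * (LBINT y. norm (G n (y - x))) + c n * ((1 + A) * (LBINT y. weight (y - x)) + L)"
        by (simp add: Gi Wi u_Lp L_def)
      also have "\<dots> = \<eta> * I + c n * ((1 + A) * W + L)"
        using lborel_integral_translate[where f="\<lambda>y. norm (G n y)" and a="- x"] lborel_integral_translate[where f=weight and a="- x"]
        by (simp add: G_L1 I_def W_def)
      also have "\<dots> < \<epsilon>" using \<eta>I elim by linarith
      finally show "dist (Re (inv_fourier (hv n i) x)) (u i x) < \<epsilon>" by (simp add: dist_real_def)
    qed
  qed
qed

end

section \<open>The Liouville theorem\<close>

lemma pderivative_has_vector_derivative:
  fixes f :: "real^'n::finite \<Rightarrow> 'b::real_normed_vector"
  assumes "f differentiable (at x)"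
  shows "((\<lambda>t. f (x + t *\<^sub>R axis i 1)) has_vector_derivative pderivative i f x) (at 0)"
proof -
  obtain D where D: "(f has_derivative D) (at x)" using assms by (auto simp: differentiable_def)
  have "((\<lambda>t. x + t *\<^sub>R axis i (1::real)) has_vector_derivative axis i 1) (at 0)"
    by (auto intro!: derivative_eq_intros)
  then have "((\<lambda>t. f (x + t *\<^sub>R axis i 1)) has_vector_derivative D (axis i 1)) (at 0)"
    using vector_derivative_diff_chain_within[of "\<lambda>t. x + t *\<^sub>R axis i (1::real)" "axis i 1" 0 UNIV f D]
    by (simp add: comp_def has_derivative_at_withinI[OF D])
  then show ?thesis
    unfolding pderivative_def by (simp add: vector_derivative_works[symmetric] differentiableI_vector)
qed

lemma pd_component:
  fixes U :: "real^'n::finite \<Rightarrow> real^'n"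
  assumes "\<And>x. U differentiable (at x)"
  shows "pd k (\<lambda>x. U x $ i) (\<lambda>x. pderivative k U x $ i)"
  unfolding pd_def has_real_derivative_iff_has_vector_derivative
  using bounded_linear.has_vector_derivative[OF bounded_linear_vec_nth pderivative_has_vector_derivative[OF assms]]
  by blast

lemma pd_pderivative:
  fixes P :: "real^'n::finite \<Rightarrow> real"
  shows "(\<And>x. P differentiable (at x)) \<Longrightarrow> pd k P (pderivative k P)"
  unfolding pd_def has_real_derivative_iff_has_vector_derivative
  using pderivative_has_vector_derivative by blast

lemma gradient_zero_imp_constant:
  fixes P :: "real^'n::finite \<Rightarrow> real"
  assumes "\<And>x. P differentiable (at x)" "\<And>i x. pderivative i P x = 0"
  shows "\<exists>c. \<forall>x. P x = c"
proof -
  have "(P has_derivative (\<lambda>h. 0)) (at x)" for x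
  proof -
    obtain D where D: "(P has_derivative D) (at x)" using assms(1) by (auto simp: differentiable_def)
    have l: "linear D" using D has_derivative_linear by blast
    have "D (axis i 1) = 0" for i
    proof -
      have "((\<lambda>t. x + t *\<^sub>R axis i (1::real)) has_vector_derivative axis i 1) (at 0)"
        by (auto intro!: derivative_eq_intros)
      then have "((\<lambda>t. P (x + t *\<^sub>R axis i 1)) has_vector_derivative D (axis i 1)) (at 0)"
        using vector_derivative_diff_chain_within[of "\<lambda>t. x + t *\<^sub>R axis i (1::real)" "axis i 1" 0 UNIV P D]
        by (simp add: comp_def has_derivative_at_withinI[OF D])
      from vector_derivative_unique_at[OF this pderivative_has_vector_derivative[OF assms(1)]]
      show ?thesis by (simp add: assms(2))
    qed
    then have "D h = 0" for h
      using linear_sum[OF l, of "\<lambda>i. (h $ i) *\<^sub>R axis i 1" UNIV] linear_scale[OF l]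
      by (simp add: basis_expansion scalar_mult_eq_scaleR[symmetric])
    then have "D = (\<lambda>h. 0)" by (rule ext)
    then show ?thesis using D by simp
  qed
  then have "\<exists>c. \<forall>x\<in>UNIV. P x = c"
    by (intro has_derivative_zero_constant) auto
  then show ?thesis by simp
qed

text \<open>The induction on k runs over all families f: a partial derivative of the product is the
  product with one factor replaced by its derivative, again a family of bumps.\<close>

lemma prod_bumps_test_functions:
  fixes f :: "'n::finite \<Rightarrow> real \<Rightarrow> complex"
  assumes f: "\<And>j. f j \<in> bumps"
  shows "(\<lambda>\<xi>::real^'n. \<Prod>j\<in>UNIV. f j (\<xi> $ j)) \<in> test_functions"
proof -
  have "C_k k (\<lambda>\<xi>::real^'n. \<Prod>j\<in>UNIV. f j (\<xi> $ j))" for k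
    using f
  proof (induction k arbitrary: f)
    case 0
    then show ?case
      by (auto intro!: continuous_on_prod continuous_on_compose2[OF bumps_continuous] continuous_intros)
  next
    case (Suc k)
    obtain f' where f': "\<And>j t. (f j has_vector_derivative f' j t) (at t)" "\<And>j. f' j \<in> bumps"
    proof -
      have "\<exists>f'. \<forall>j. (\<forall>t. (f j has_vector_derivative f' j t) (at t)) \<and> f' j \<in> bumps"
        by (intro choice allI) (metis bumps_derivative Suc.prems)
      then show ?thesis using that by blast
    qed
    have diff: "(\<lambda>\<xi>::real^'n. \<Prod>j\<in>UNIV. f j (\<xi> $ j)) differentiable (at x)" for x
    proof -
      have "((\<lambda>\<xi>::real^'n. f j (\<xi> $ j)) has_derivative (\<lambda>h. (h $ j) *\<^sub>R f' j (x $ j))) (at x)" for j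
        using has_derivative_compose[of "\<lambda>\<xi>::real^'n. \<xi> $ j" "\<lambda>h. h $ j" x UNIV "f j" "\<lambda>h. h *\<^sub>R f' j (x $ j)"]
          f'(1)[of j "x $ j"] bounded_linear_imp_has_derivative[OF bounded_linear_vec_nth]
        unfolding has_vector_derivative_def by blast
      then have "((\<lambda>\<xi>::real^'n. \<Prod>j\<in>UNIV. f j (\<xi> $ j)) has_derivative
         (\<lambda>y. \<Sum>i\<in>UNIV. ((y $ i) *\<^sub>R f' i (x $ i)) * (\<Prod>j\<in>UNIV - {i}. f j (x $ j)))) (at x)"
        by (intro has_derivative_prod)
      then show ?thesis unfolding differentiable_def by blast
    qed
    moreover have "pderivative i (\<lambda>\<xi>::real^'n. \<Prod>j\<in>UNIV. f j (\<xi> $ j)) = (\<lambda>\<xi>. \<Prod>j\<in>UNIV. (f(i := f' i)) j (\<xi> $ j))" for i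
    proof
      fix x :: "real^'n"
      define c where "c = (\<Prod>j\<in>UNIV - {i}. f j (x $ j))"
      have 1: "(\<Prod>j\<in>UNIV. f j ((x + t *\<^sub>R axis i 1) $ j)) = f i (x $ i + t) * c" for t
        unfolding c_def prod.remove[OF finite_class.finite_UNIV UNIV_I[of i]]
        by (intro arg_cong2[of _ _ _ _ "(*)"] prod.cong refl) (auto simp: axis_def)
      have 2: "(\<Prod>j\<in>UNIV. (f(i := f' i)) j (x $ j)) = f' i (x $ i) * c"
        unfolding c_def prod.remove[OF finite_class.finite_UNIV UNIV_I[of i]]
        by (intro arg_cong2[of _ _ _ _ "(*)"] prod.cong refl) auto
      have s: "((\<lambda>t. x $ i + t) has_vector_derivative 1) (at 0)"
        by (auto intro!: derivative_eq_intros)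
      have "((\<lambda>t. f i (x $ i + t)) has_vector_derivative 1 *\<^sub>R f' i (x $ i)) (at 0)"
        using vector_diff_chain_at[OF s, of "f i" "f' i (x $ i)"] f'(1)[of i "x $ i"] by (simp add: comp_def)
      then have "((\<lambda>t. f i (x $ i + t) * c) has_vector_derivative f' i (x $ i) * c) (at 0)"
        by (intro has_vector_derivative_mult_left) simp
      then show "pderivative i (\<lambda>\<xi>::real^'n. \<Prod>j\<in>UNIV. f j (\<xi> $ j)) x = (\<Prod>j\<in>UNIV. (f(i := f' i)) j (x $ j))"
        unfolding pderivative_def 1 2 by (rule vector_derivative_at)
    qed
    moreover have "C_k k (\<lambda>\<xi>::real^'n. \<Prod>j\<in>UNIV. (f(i := f' i)) j (\<xi> $ j))" for i
      by (rule Suc.IH) (simp add: Suc.prems f'(2))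
    ultimately show ?case by simp
  qed
  moreover have "bounded {\<xi>::real^'n. (\<Prod>j\<in>UNIV. f j (\<xi> $ j)) \<noteq> 0}"
  proof -
    have "\<exists>a. \<forall>j. a j > 0 \<and> (\<forall>t. a j < \<bar>t\<bar> \<longrightarrow> f j t = 0)"
      using bumps_bounded_support[OF f] by (intro choice) blast
    then obtain a where a: "\<And>j t. a j < \<bar>t\<bar> \<Longrightarrow> f j t = 0" by blast
    have "norm \<xi> \<le> (\<Sum>j\<in>UNIV. a j)" if "(\<Prod>j\<in>UNIV. f j (\<xi> $ j)) \<noteq> 0" for \<xi> :: "real^'n"
    proof -
      have "f j (\<xi> $ j) \<noteq> 0" for j using that by (meson UNIV_I finite_class.finite_UNIV prod_zero)
      then have "\<bar>\<xi> $ j\<bar> \<le> a j" for j using a by (meson not_less)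
      then show ?thesis by (intro order_trans[OF norm_le_l1_cart] sum_mono)
    qed
    then show ?thesis unfolding bounded_iff by blast
  qed
  ultimately show ?thesis by (simp add: test_functions_def)
qed

lemma fourier_prod_bumps:
  fixes f :: "'n::finite \<Rightarrow> real \<Rightarrow> complex"
  assumes f: "\<And>j. f j \<in> bumps"
  shows "fourier (\<lambda>\<xi>::real^'n. \<Prod>j\<in>UNIV. f j (\<xi> $ j)) y = ft_prod f y"
proof -
  have i: "integrable lborel (\<lambda>t. cis (- (y $ j * t)) * f j t)" for j
    by (intro bumps_integrable bumps_cis f)
  have eq: "cis (- (x \<bullet> y)) * (\<Prod>j\<in>UNIV. f j (x $ j)) = (\<Prod>j\<in>UNIV. cis (- (y $ j * x $ j)) * f j (x $ j))" for x :: "real^'n"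
    using cis_inner[of "- x" y] by (simp add: prod.distrib mult.commute)
  show ?thesis
    unfolding fourier_def eq ft_def
    using integral_lborel_prod_cart[of "\<lambda>j t. cis (- (y $ j * t)) * f j t", OF i]
    by (subst integral_completion) (auto dest: borel_measurable_integrable)
qed

text \<open>\<open>L1_loc\<close> refers to the completed measure, while the Fubini arguments work
  with Borel functions. Measurability on the whole space is a limit over balls; then real and
  imaginary parts are modified on a null set.\<close>

lemma L1_loc_borel_version:
  fixes g :: "real^'n::finite \<Rightarrow> complex"
  assumes "g \<in> L1_loc"
  obtains \<gamma> where "\<gamma> \<in> borel_measurable borel" "AE \<xi> in lborel. g \<xi> = \<gamma> \<xi>" "g \<in> borel_measurable lebesgue"
proof -
  have g: "g \<in> borel_measurable lebesgue"
  proof (rule borel_measurable_LIMSEQ_metric)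
    show "(\<lambda>\<xi>. indicator (cball 0 (real n)) \<xi> *\<^sub>R g \<xi>) \<in> borel_measurable lebesgue" for n
      using assms by (auto simp: L1_loc_def set_integrable_def dest!: spec[of _ "cball 0 (real n)"])
    fix \<xi> :: "real^'n"
    obtain N where "norm \<xi> \<le> real N" using real_arch_simple by blast
    then have "\<forall>\<^sub>F n in sequentially. indicator (cball 0 (real n)) \<xi> *\<^sub>R g \<xi> = g \<xi>"
      by (intro eventually_sequentiallyI[of N]) auto
    then show "(\<lambda>n. indicator (cball 0 (real n)) \<xi> *\<^sub>R g \<xi>) \<longlonglongrightarrow> g \<xi>"
      by (rule tendsto_eventually)
  qed
  then have re: "(\<lambda>\<xi>. Re (g \<xi>)) \<in> borel_measurable lebesgue" and im: "(\<lambda>\<xi>. Im (g \<xi>)) \<in> borel_measurable lebesgue"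
    by simp_all
  obtain r where r: "r \<in> borel_measurable lborel" "AE \<xi> in lborel. Re (g \<xi>) = r \<xi>"
    using completion_ex_borel_measurable_real[OF re] by blast
  obtain s where s: "s \<in> borel_measurable lborel" "AE \<xi> in lborel. Im (g \<xi>) = s \<xi>"
    using completion_ex_borel_measurable_real[OF im] by blast
  have [measurable]: "r \<in> borel_measurable borel" "s \<in> borel_measurable borel" using r(1) s(1) by simp_all
  have m: "(\<lambda>\<xi>. complex_of_real (r \<xi>) + \<i> * complex_of_real (s \<xi>)) \<in> borel_measurable borel" by measurable
  moreover have "AE \<xi> in lborel. g \<xi> = complex_of_real (r \<xi>) + \<i> * complex_of_real (s \<xi>)"
    using r(2) s(2) by eventually_elim (simp add: complex_eq_iff)
  ultimately show thesis using that[OF _ _ g] by blast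
qed

text \<open>The bridge from the distributional definition to \<open>hdot_field\<close>: products of
  bumps are test functions, and on them the transformed distribution is the integral of f against
  the product of one-dimensional transforms.\<close>

lemma Hdot_minus1_density:
  fixes f :: "real^'n::finite \<Rightarrow> real"
  assumes "fun_in_Hdot_minus1 f" and fc: "continuous_on UNIV f"
  obtains \<gamma> where "\<gamma> \<in> borel_measurable borel"
    and "integrable lborel (\<lambda>\<xi>. (norm (\<gamma> \<xi>) / norm \<xi>)\<^sup>2)"
    and "\<And>h. (\<And>j. h j \<in> bumps) \<Longrightarrow> (CLBINT y. complex_of_real (f y) * ft_prod h y)
        = (CLBINT \<xi>. \<gamma> \<xi> * (\<Prod>j\<in>UNIV. h j (\<xi> $ j)))"
proof -
  from assms obtain g where g: "g \<in> L1_loc"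
    and dual: "\<And>\<phi>. \<phi> \<in> test_functions \<Longrightarrow> dist_of_fun (\<lambda>x. complex_of_real (f x)) (fourier \<phi>) = dist_of_fun g \<phi>"
    and int: "integrable lebesgue (\<lambda>\<xi>. 1 / (norm \<xi>)\<^sup>2 * (norm (g \<xi>))\<^sup>2)"
    by (auto simp: fun_in_Hdot_minus1_def Hdot_minus1_def fourier_distribution_def)
  obtain \<gamma> where [measurable]: "\<gamma> \<in> borel_measurable borel" and ae: "AE \<xi> in lborel. g \<xi> = \<gamma> \<xi>"
    and gm: "g \<in> borel_measurable lebesgue"
    using L1_loc_borel_version[OF g] .
  have ae': "AE \<xi> in lebesgue. g \<xi> = \<gamma> \<xi>" using ae by (rule AE_completion)
  have \<gamma>m: "\<gamma> \<in> borel_measurable lebesgue" by (rule measurable_completion) simp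
  have "integrable lebesgue (\<lambda>\<xi>. (norm (\<gamma> \<xi>) / norm \<xi>)\<^sup>2)"
  proof (rule integrable_cong_AE_imp[OF int])
    show "(\<lambda>\<xi>. (norm (\<gamma> \<xi>) / norm \<xi>)\<^sup>2) \<in> borel_measurable lebesgue" by (rule measurable_completion) measurable
    show "AE \<xi> in lebesgue. 1 / (norm \<xi>)\<^sup>2 * (norm (g \<xi>))\<^sup>2 = (norm (\<gamma> \<xi>) / norm \<xi>)\<^sup>2"
      using ae' by eventually_elim (simp add: power_divide)
  qed
  then have "integrable lborel (\<lambda>\<xi>. (norm (\<gamma> \<xi>) / norm \<xi>)\<^sup>2)"
    by (subst (asm) integrable_completion) measurable
  moreover have "(CLBINT y. complex_of_real (f y) * ft_prod h y)
        = (CLBINT \<xi>. \<gamma> \<xi> * (\<Prod>j\<in>UNIV. h j (\<xi> $ j)))" if h: "\<And>j. h j \<in> bumps" for h :: "'n \<Rightarrow> real \<Rightarrow> complex"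
  proof -
    have hm [measurable]: "(\<lambda>\<xi>::real^'n. \<Prod>j\<in>UNIV. h j (\<xi> $ j)) \<in> borel_measurable borel"
      by (intro borel_measurable_continuous_onI continuous_on_prod continuous_on_compose2[OF bumps_continuous[OF h]] continuous_intros) auto
    have fm: "(\<lambda>y::real^'n. complex_of_real (f y) * ft_prod h y) \<in> borel_measurable borel"
    proof -
      have "continuous_on UNIV (\<lambda>y::real^'n. \<Prod>j\<in>UNIV. ft (h j) (y $ j))"
        using continuous_prod_ft[of h 0] h by simp
      then show ?thesis
        by (intro borel_measurable_continuous_onI continuous_on_mult continuous_on_of_real fc)
    qed
    have "(CLBINT y. complex_of_real (f y) * ft_prod h y)
       = dist_of_fun (\<lambda>x. complex_of_real (f x)) (fourier (\<lambda>\<xi>. \<Prod>j\<in>UNIV. h j (\<xi> $ j)))"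
      unfolding dist_of_fun_def fourier_prod_bumps[OF h] using fm by (simp add: integral_completion)
    also have "\<dots> = dist_of_fun g (\<lambda>\<xi>. \<Prod>j\<in>UNIV. h j (\<xi> $ j))"
      by (intro dual prod_bumps_test_functions h)
    also have "\<dots> = (\<integral>\<xi>. \<gamma> \<xi> * (\<Prod>j\<in>UNIV. h j (\<xi> $ j)) \<partial>lebesgue)"
      unfolding dist_of_fun_def
    proof (rule integral_cong_AE)
      have "(\<lambda>\<xi>::real^'n. \<Prod>j\<in>UNIV. h j (\<xi> $ j)) \<in> borel_measurable lebesgue"
        by (rule measurable_completion) simp
      then show "(\<lambda>\<xi>. g \<xi> * (\<Prod>j\<in>UNIV. h j (\<xi> $ j))) \<in> borel_measurable lebesgue"
        "(\<lambda>\<xi>. \<gamma> \<xi> * (\<Prod>j\<in>UNIV. h j (\<xi> $ j))) \<in> borel_measurable lebesgue"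
        using gm \<gamma>m by (intro borel_measurable_times; simp)+
      show "AE \<xi> in lebesgue. g \<xi> * (\<Prod>j\<in>UNIV. h j (\<xi> $ j)) = \<gamma> \<xi> * (\<Prod>j\<in>UNIV. h j (\<xi> $ j))"
        using ae' by eventually_elim simp
    qed
    also have "\<dots> = (CLBINT \<xi>. \<gamma> \<xi> * (\<Prod>j\<in>UNIV. h j (\<xi> $ j)))"
      by (rule integral_completion) simp
    finally show ?thesis .
  qed
  ultimately show thesis using that[of \<gamma>] by simp
qed

text \<open>The sum of squares is at most three times the square of the largest component, whence
  the factor 3^(p/2).\<close>

lemma sum_squares_powr_integrable:
  fixes u :: "3 \<Rightarrow> 'a::euclidean_space \<Rightarrow> real"
  assumes u: "\<And>i. continuous_on UNIV (u i)" and p: "0 \<le> p"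
    and int: "\<And>i. integrable lborel (\<lambda>x. \<bar>u i x\<bar> powr p)"
  shows "integrable lborel (\<lambda>x. (\<Sum>i\<in>UNIV. (u i x)\<^sup>2) powr (p / 2))"
proof (rule Bochner_Integration.integrable_bound)
  show "integrable lborel (\<lambda>x. 3 powr (p / 2) * (\<Sum>i\<in>UNIV. \<bar>u i x\<bar> powr p))"
    by (intro integrable_mult_right Bochner_Integration.integrable_sum int)
  have [measurable]: "u i \<in> borel_measurable borel" for i by (rule borel_measurable_continuous_onI[OF u])
  show "(\<lambda>x. (\<Sum>i\<in>UNIV. (u i x)\<^sup>2) powr (p / 2)) \<in> borel_measurable lborel" by measurable
  show "AE x in lborel. norm ((\<Sum>i\<in>UNIV. (u i x)\<^sup>2) powr (p / 2)) \<le> norm (3 powr (p / 2) * (\<Sum>i\<in>UNIV. \<bar>u i x\<bar> powr p))" (is "AE x in lborel. ?P x")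
  proof (rule AE_I2)
    fix x
    have "Max (range (\<lambda>i. \<bar>u i x\<bar>)) \<in> range (\<lambda>i. \<bar>u i x\<bar>)" by (rule Max_in) auto
    then obtain k where "Max (range (\<lambda>i. \<bar>u i x\<bar>)) = \<bar>u k x\<bar>" by blast
    then have k: "\<bar>u i x\<bar> \<le> \<bar>u k x\<bar>" for i
      using Max_ge[of "range (\<lambda>i. \<bar>u i x\<bar>)" "\<bar>u i x\<bar>"] by simp
    have "(\<Sum>i\<in>UNIV. (u i x)\<^sup>2) \<le> (\<Sum>i\<in>(UNIV::3 set). (u k x)\<^sup>2)"
      using k by (intro sum_mono) (simp add: abs_le_square_iff[symmetric])
    then have "(\<Sum>i\<in>UNIV. (u i x)\<^sup>2) powr (p / 2) \<le> (3 * \<bar>u k x\<bar>\<^sup>2) powr (p / 2)"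
      using p by (intro powr_mono2) (auto intro: sum_nonneg)
    also have "\<dots> = 3 powr (p / 2) * \<bar>u k x\<bar> powr p"
    proof -
      have "(\<bar>u k x\<bar>\<^sup>2) powr (p / 2) = \<bar>u k x\<bar> powr p"
        using powr_powr[of "\<bar>u k x\<bar>" 2 "p / 2"] by (cases "u k x = 0") (simp_all add: powr_numeral)
      then show ?thesis by (simp add: powr_mult)
    qed
    also have "\<dots> \<le> 3 powr (p / 2) * (\<Sum>i\<in>UNIV. \<bar>u i x\<bar> powr p)"
      using member_le_sum[of k UNIV "\<lambda>i. \<bar>u i x\<bar> powr p"] by (intro mult_left_mono) auto
    finally show "?P x"
      by (simp add: order_trans[OF _ abs_ge_self])
  qed
qed

theorem theorem2:
  fixes U :: "real^3 \<Rightarrow> real^3" and P :: "real^3 \<Rightarrow> real" and p :: real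
  assumes "smooth_NS_solution U P"
    and "9 / 2 < p"
    and "\<And>i. (\<lambda>x. U x $ i) \<in> Lp p"
    and "\<And>i. fun_in_Hdot_minus1 (\<lambda>x. U x $ i)"
  shows "(\<forall>x. U x = 0) \<and> (\<exists>c. \<forall>x. P x = c)"
proof -
  define u where "u i x = U x $ i" for i x
  define du where "du i k x = pderivative k U x $ i" for i k x
  define d2u where "d2u i k x = pderivative k (pderivative k U) x $ i" for i k x
  have U: "\<And>x. U differentiable (at x)" "\<And>k x. pderivative k U differentiable (at x)"
    "\<And>k l. continuous_on UNIV (pderivative l (pderivative k U))"
    and P: "\<And>x. P differentiable (at x)" "\<And>k. continuous_on UNIV (pderivative k P)"
    and NS: "\<And>x. - laplacian U x + advection U U x + gradient P x = 0"
    and div: "\<And>x. divergence U x = 0"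
    using assms(1) by (auto simp: smooth_NS_solution_def eval_nat_numeral)
  have u_cont: "continuous_on UNIV (u i)" "continuous_on UNIV (du i k)" "continuous_on UNIV (d2u i k)" for i k
  proof -
    have "continuous_on UNIV U" "continuous_on UNIV (pderivative k U)"
      using U(1,2) by (simp_all add: continuous_on_eq_continuous_at differentiable_imp_continuous_within)
    then show "continuous_on UNIV (u i)" "continuous_on UNIV (du i k)" "continuous_on UNIV (d2u i k)"
      using U(3) unfolding u_def[abs_def] du_def[abs_def] d2u_def[abs_def] by (intro continuous_intros; simp)+
  qed
  have u_pd: "pd k (u i) (du i k)" "pd k (du i k) (d2u i k)" for i k
    unfolding u_def[abs_def] du_def[abs_def] d2u_def[abs_def] by (intro pd_component U)+
  have P_cont: "continuous_on UNIV P"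
    using P(1) by (simp add: continuous_on_eq_continuous_at differentiable_imp_continuous_within)
  have div_u: "(\<Sum>k\<in>UNIV. du k k x) = 0" for x
  proof -
    have "pderivative k (\<lambda>y. U y $ k) x = du k k x" for k
      using vector_derivative_at[OF bounded_linear.has_vector_derivative[OF bounded_linear_vec_nth pderivative_has_vector_derivative[OF U(1)]]]
      unfolding du_def pderivative_def[of k "\<lambda>y. U y $ k"] by blast
    then show ?thesis using div[of x] by (simp add: divergence_def)
  qed
  have NS_u: "pderivative i P x = (\<Sum>k\<in>UNIV. d2u i k x) - (\<Sum>k\<in>UNIV. u k x * du i k x)" for i x
    using arg_cong[OF NS[of x], of "\<lambda>w. w $ i"]
    by (simp add: laplacian_def advection_def gradient_def u_def du_def d2u_def)
  have u_Lp: "integrable lborel (\<lambda>x. \<bar>u i x\<bar> powr p)" for i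
  proof -
    have [measurable]: "u i \<in> borel_measurable borel" by (rule borel_measurable_continuous_onI[OF u_cont(1)])
    have "integrable lebesgue (\<lambda>x. \<bar>u i x\<bar> powr p)" using assms(3)[of i] by (simp add: Lp_def u_def)
    then show ?thesis by (subst (asm) integrable_completion) measurable
  qed
  have "\<forall>i. \<exists>\<gamma>. \<gamma> \<in> borel_measurable borel \<and> integrable lborel (\<lambda>\<xi>. (norm (\<gamma> \<xi>) / norm \<xi>)\<^sup>2) \<and>
     (\<forall>h. (\<forall>j. h j \<in> bumps) \<longrightarrow> (CLBINT y. complex_of_real (u i y) * ft_prod h y)
        = (CLBINT \<xi>. \<gamma> \<xi> * (\<Prod>j\<in>UNIV. h j (\<xi> $ j))))" (is "\<forall>i. \<exists>\<gamma>. ?Q i \<gamma>")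
  proof
    fix i
    have "fun_in_Hdot_minus1 (u i)" using assms(4)[of i] by (simp add: u_def[abs_def])
    from Hdot_minus1_density[OF this u_cont(1)] show "\<exists>\<gamma>. ?Q i \<gamma>" by blast
  qed
  from choice[OF this] obtain \<gamma> where \<gamma>: "\<And>i. ?Q i (\<gamma> i)" by blast
  obtain b M where b: "(\<lambda>t. complex_of_real (b t)) \<in> bumps" "\<And>t. 0 \<le> b t" "\<And>t. b t \<le> M" "b 0 = 1 / (2 * pi)"
    using normalized_bump by blast
  interpret H: hdot_field u du p \<gamma> b M
    by standard (use \<gamma> assms(2) in \<open>simp_all add: u_cont u_pd div_u u_Lp b\<close>)
  interpret N: ns_approx u du d2u P "\<lambda>i. pderivative i P"
    "\<lambda>n i x. Re (inv_fourier (H.hv n i) x)" "\<lambda>n i k x. Re (inv_fourier (D k (H.hv n i)) x)"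
    "\<lambda>n i j x. Re (inv_fourier (H.hB n i j) x)" "\<lambda>n i j k x. Re (inv_fourier (D k (H.hB n i j)) x)"
    "\<lambda>n i j k l x. Re (inv_fourier (D l (D k (H.hB n i j))) x)" H.K p
  proof
    show "Re (inv_fourier (H.hB n i j) x) = - Re (inv_fourier (H.hB n j i) x)" for n i j x
    proof -
      have "H.hB n i j = (\<lambda>\<xi>. - H.hB n j i \<xi>)"
        by (simp add: H.hB_def fun_eq_iff diff_divide_distrib algebra_simps)
      then show ?thesis by (simp add: inv_fourier_minus)
    qed
    show "Re (inv_fourier (D l (D k (H.hB n i j))) x) = Re (inv_fourier (D k (D l (H.hB n i j))) x)" for n i j k l x
    proof -
      have "D l (D k (H.hB n i j)) = D k (D l (H.hB n i j))" by (simp add: D_def fun_eq_iff mult_ac)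
      then show ?thesis by simp
    qed
    show "continuous_on UNIV (pderivative i P)" for i by (rule P)
    show "integrable lborel (\<lambda>x. (\<Sum>i\<in>UNIV. (u i x)\<^sup>2) powr (p / 2))"
      using assms(2) by (intro sum_squares_powr_integrable u_cont u_Lp) simp
  qed (use assms(2) in \<open>simp_all add: u_cont u_pd P P_cont pd_pderivative div_u NS_u continuous_Re_inv_fourier pd_Re_inv_fourier
      adm_D H.adm_hv H.adm_hB H.div_B H.lap_B H.B_L2 H.v_lim\<close>)
  have U0: "U = (\<lambda>x. 0)"
    using N.u_eq_0 by (simp add: u_def vec_eq_iff fun_eq_iff)
  have "pderivative k (\<lambda>x::real^3. 0 :: real^3) = (\<lambda>x. 0)" for k
    by (simp add: pderivative_def fun_eq_iff)
  \<comment> \<open>With U = 0 the momentum equation reduces to a vanishing pressure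
    gradient.\<close>
  then have "pderivative i P x = 0" for i x
    using NS_u[of i x] by (simp add: u_def du_def d2u_def U0)
  then show ?thesis using gradient_zero_imp_constant[OF P(1)] U0 by simp
qed

end
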